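(* Let $n\in\mathbb{N}$ and let $\rho:\mathbb{R}^n\setminus\{0\}\to[0,\infty)$ be a radial kernel with $\rho\in L^1_{\mathrm{loc}}(\mathbb{R}^n)$, $\int_{\mathbb{R}^n}\min\{1,|x|^{-1}\}\rho(x)\,dx<\infty$ and $\inf_{\overline{B(0,\varepsilon)}}\rho>0$ for some $\varepsilon>0$. Assume that $K_\rho(x)\ge0$ for $x\neq0$. Let $\Omega\subset\mathbb{R}^n$ be a bounded open set. If $u,v\in H^{\rho,2}_0(\Omega)$ satisfy $\langle u,\phi\rangle_\rho\ge\langle v,\phi\rangle_\rho$ for every nonnegative $\phi\in H^{\rho,2}_0(\Omega)$ and $u\ge v$ in $\Omega^c$, then $u\ge v$ (a.e.) in $\mathbb{R}^n$.
   Context: Fourier transform convention: $\widehat f(\xi)=\int_{\mathbb{R}^n}f(x)e^{-2\pi i x\cdot\xi}\,dx$, extended to tempered distributions. $\overline\rho$ is the radial representation of $\rho$, $\rho(x)=\overline\rho(|x|)$. For $u\in C_c^\infty(\mathbb{R}^n)$, $D_\rho u(x)=\int_{\mathbb{R}^n}\frac{u(x)-u(y)}{|x-y|}\frac{x-y}{|x-y|}\rho(x-y)\,dy$. The space $H^{\rho,2}(\mathbb{R}^n)$ is the closure (completion within $L^2(\mathbb{R}^n)$) of $C_c^\infty(\mathbb{R}^n)$ under the norm $\|u\|_{L^2}+\|D_\rho u\|_{L^2}$, and $H^{\rho,2}_0(\Omega)=\{u\in H^{\rho,2}(\mathbb{R}^n):u=0\text{ a.e. in }\Omega^c\}$. $Q_\rho(x):=\int_{|x|}^\infty\frac{\overline\rho(t)}{t}\,dt$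 ($x\ne0$) is a locally integrable tempered distribution; its Fourier transform is the function $\widehat{Q_\rho}(\xi)=\frac{1}{2\pi|\xi|}\int_{\mathbb{R}^n}\frac{\rho(x)x_1}{|x|^2}\sin(2\pi|\xi|x_1)\,dx$, $\xi\ne0$, and $\lambda_\rho(\xi):=2\pi i\,\xi\,\widehat{Q_\rho}(\xi)$. $K_\rho$ is the tempered distribution $K_\rho=\sum_{j}\partial_jQ_\rho*\partial_jQ_\rho$, equivalently the one with $\widehat{K_\rho}(\xi)=-|\lambda_\rho(\xi)|^2$. The assumption "$K_\rho(x)\ge0$ for $x\ne0$" means that the restriction of $K_\rho$ to $\mathbb{R}^n\setminus\{0\}$ is given by a nonnegative function in $L^1_{\mathrm{loc}}(\mathbb{R}^n\setminus\{0\})$, again denoted $K_\rho$. The bilinear form is $\langle u,v\rangle_\rho:=\int_{\mathbb{R}^n}\int_{\mathbb{R}^n}(u(x)-u(y))(v(x)-v(y))K_\rho(x-y)\,dy\,dx$, which is well defined on $H^{\rho,2}(\mathbb{R}^n)$. *)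

theory Defs
  imports "HOL-Analysis.Analysis"
begin

fun C_k :: "nat \<Rightarrow> (real ^ 'n::finite \<Rightarrow> 'b::real_normed_vector) \<Rightarrow> bool" where
  "C_k 0 f \<longleftrightarrow> continuous_on UNIV f"
| "C_k (Suc k) f \<longleftrightarrow> f differentiable_on UNIV \<and>
     (\<forall>i. C_k k (\<lambda>x. frechet_derivative f (at x) (axis i 1)))"

definition Cc_infinity :: "(real ^ 'n::finite) set \<Rightarrow> (real ^ 'n \<Rightarrow> 'b::real_normed_vector) set" where
  "Cc_infinity U = {f. (\<forall>k. C_k k f) \<and> compact (closure {x. f x \<noteq> 0}) \<and> closure {x. f x \<noteq> 0} \<subseteq> U}"

definition L1_loc :: "(real ^ 'n::finite) set \<Rightarrow> (real ^ 'n \<Rightarrow> real) set" where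
  "L1_loc U = {f. \<forall>C. compact C \<and> C \<subseteq> U \<longrightarrow> set_integrable lebesgue C f}"

text \<open>Elements of \<open>L\<^sup>2\<close> are represented by functions; all statements about them below are
  invariant under modification on null sets.\<close>

definition L2 :: "(real ^ 'n::finite \<Rightarrow> 'b::euclidean_space) set" where
  "L2 = {f \<in> borel_measurable lebesgue. integrable lebesgue (\<lambda>x. (norm (f x))\<^sup>2)}"

definition L2_norm :: "(real ^ 'n::finite \<Rightarrow> 'b::euclidean_space) \<Rightarrow> real" where
  "L2_norm f = sqrt (LINT x|lebesgue. (norm (f x))\<^sup>2)"


text \<open>Kernels are functions on \<open>\<real>\<^sup>n - {0}\<close>; their value at \<open>0\<close> is irrelevant everywhere.\<close>

definition radial_kernel :: "(real ^ 'n::finite \<Rightarrow> real) \<Rightarrow> bool" where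
  "radial_kernel \<rho> \<longleftrightarrow>
     (\<forall>x. x \<noteq> 0 \<longrightarrow> \<rho> x \<ge> 0) \<and> (\<exists>\<rho>bar. \<forall>x. x \<noteq> 0 \<longrightarrow> \<rho> x = \<rho>bar (norm x))"

definition nonlocal_gradient ::
    "(real ^ 'n::finite \<Rightarrow> real) \<Rightarrow> (real ^ 'n \<Rightarrow> real) \<Rightarrow> real ^ 'n \<Rightarrow> real ^ 'n" where
  "nonlocal_gradient \<rho> u x =
     (LINT y|lebesgue. ((u x - u y) / norm (x - y) * \<rho> (x - y)) *\<^sub>R ((x - y) /\<^sub>R norm (x - y)))"

text \<open>The completion of \<open>C\<^sub>c\<^sup>\<infinity>\<close> under \<open>\<parallel>u\<parallel> + \<parallel>D\<^sub>\<rho> u\<parallel>\<close>, realised inside \<open>L\<^sup>2\<close>: the \<open>L\<^sup>2\<close>-limits of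
  sequences of test functions that are Cauchy in this norm.\<close>

definition H_rho2 :: "(real ^ 'n::finite \<Rightarrow> real) \<Rightarrow> (real ^ 'n \<Rightarrow> real) set" where
  "H_rho2 \<rho> = {u \<in> L2. \<exists>\<phi>. (\<forall>k. \<phi> k \<in> Cc_infinity UNIV) \<and>
     (\<lambda>k. L2_norm (\<lambda>x. \<phi> k x - u x)) \<longlonglongrightarrow> 0 \<and>
     (\<forall>e>0. \<exists>N::nat. \<forall>k\<ge>N. \<forall>m\<ge>N.
        L2_norm (\<lambda>x. nonlocal_gradient \<rho> (\<phi> k) x - nonlocal_gradient \<rho> (\<phi> m) x) < e)}"

definition H0_rho2 ::
    "(real ^ 'n::finite \<Rightarrow> real) \<Rightarrow> (real ^ 'n) set \<Rightarrow> (real ^ 'n \<Rightarrow> real) set" where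
  "H0_rho2 \<rho> \<Omega> = {u \<in> H_rho2 \<rho>. AE x in lebesgue. x \<notin> \<Omega> \<longrightarrow> u x = 0}"


definition inverse_fourier :: "(real ^ 'n::finite \<Rightarrow> complex) \<Rightarrow> real ^ 'n \<Rightarrow> complex" where
  "inverse_fourier f x =
     (LINT \<xi>|lebesgue. f \<xi> * exp (2 * complex_of_real pi * \<i> * complex_of_real (x \<bullet> \<xi>)))"

text \<open>Distributions are functionals on complex-valued functions; only their values on test
  functions matter.\<close>

type_synonym 'n distribution = "(real ^ 'n \<Rightarrow> complex) \<Rightarrow> complex"

definition regular_distribution :: "(real ^ 'n::finite \<Rightarrow> real) \<Rightarrow> 'n distribution" where
  "regular_distribution g = (\<lambda>\<phi>. LINT x|lebesgue. complex_of_real (g x) * \<phi> x)"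

definition inverse_fourier_distribution :: "'n::finite distribution \<Rightarrow> 'n distribution" where
  "inverse_fourier_distribution T = (\<lambda>\<phi>. T (inverse_fourier \<phi>))"

text \<open>The Fourier transform (normalised as \<open>\<integral> f(x) exp (-2\<pi>i x\<cdot>\<xi>) dx\<close>) of
  \<open>Q\<^sub>\<rho>(x) = \<integral>\<^sub>t\<^sub>\<ge>\<^sub>|\<^sub>x\<^sub>| \<rho>bar(t)/t dt\<close>, as a function of \<open>\<xi> \<noteq> 0\<close>. An index type has no
  distinguished first element, so the coordinate \<open>x\<^sub>1\<close> is an arbitrary fixed one; as \<open>\<rho>\<close> is radial,
  the choice does not affect the value.\<close>

definition Q_hat :: "(real ^ 'n::finite \<Rightarrow> real) \<Rightarrow> real ^ 'n \<Rightarrow> real" where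
  "Q_hat \<rho> \<xi> = (let i = (SOME i. True) in
     1 / (2 * pi * norm \<xi>) *
       (LINT x|lebesgue. \<rho> x * x $ i / (norm x)\<^sup>2 * sin (2 * pi * norm \<xi> * x $ i)))"

definition lambda_symbol :: "(real ^ 'n::finite \<Rightarrow> real) \<Rightarrow> real ^ 'n \<Rightarrow> complex ^ 'n" where
  "lambda_symbol \<rho> \<xi> = (\<chi> j. 2 * complex_of_real pi * \<i> * complex_of_real (\<xi> $ j * Q_hat \<rho> \<xi>))"

text \<open>The tempered distribution whose Fourier transform is \<open>-|\<lambda>\<^sub>\<rho>|\<^sup>2\<close>.\<close>

definition K_distribution :: "(real ^ 'n::finite \<Rightarrow> real) \<Rightarrow> 'n distribution" where
  "K_distribution \<rho> =
     inverse_fourier_distribution (regular_distribution (\<lambda>\<xi>. - (norm (lambda_symbol \<rho> \<xi>))\<^sup>2))"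

definition represented_off_origin ::
    "'n::finite distribution \<Rightarrow> (real ^ 'n \<Rightarrow> real) \<Rightarrow> bool" where
  "represented_off_origin T g \<longleftrightarrow>
     g \<in> L1_loc (- {0}) \<and> (\<forall>\<phi> \<in> Cc_infinity (- {0}). T \<phi> = regular_distribution g \<phi>)"

definition bilinear_form ::
    "(real ^ 'n::finite \<Rightarrow> real) \<Rightarrow> (real ^ 'n \<Rightarrow> real) \<Rightarrow> (real ^ 'n \<Rightarrow> real) \<Rightarrow> real" where
  "bilinear_form K u v =
     (LINT x|lebesgue. LINT y|lebesgue. (u x - u y) * (v x - v y) * K (x - y))"

end

theory Submission
  imports Defs "HOL-Probability.Probability"
begin

text \<open>Write \<open>b(h) = \<rho>(h) h / |h|\<^sup>2\<close>, so that \<open>D\<^sub>\<rho> f(x) = \<integral> (f(x) - f(x - h)) b(h) dh\<close>. By Fourier inversion, the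
  distribution \<open>K\<^sub>\<rho>\<close> acts on test functions as
  \<open>L f = \<integral>\<integral> (f(0) - f(h) - f(k) + f(h + k)) b(h) \<bullet> b(k) dh dk\<close>, and Fubini gives
  \<open>\<parallel>D\<^sub>\<rho> f\<parallel>\<^sup>2 = - L A\<close> for the autocorrelation \<open>A\<close> of \<open>f\<close>. Cutting \<open>A(0) - A\<close> off near \<open>0\<close> and near
  infinity, which costs nothing in the limit, gives \<open>\<parallel>D\<^sub>\<rho> f\<parallel>\<^sup>2 = \<integral> K\<^sub>\<rho> (A(0) - A)\<close>, that is
  \<open>2 \<parallel>D\<^sub>\<rho> f\<parallel>\<^sup>2 = \<langle>f, f\<rangle>\<^sub>\<rho>\<close>. As \<open>K\<^sub>\<rho> \<ge> 0\<close>, taking positive parts and mollifying do not increase this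
  energy, so \<open>\<phi> = (v - u)\<^sup>+\<close> is admissible. Testing with it gives \<open>\<langle>\<phi>, \<phi>\<rangle>\<^sub>\<rho> \<le> 0\<close>; since \<open>K\<^sub>\<rho>\<close> does not
  vanish almost everywhere, \<open>\<phi>\<close> is periodic with some period \<open>h \<noteq> 0\<close>, and it has bounded
  support, so \<open>\<phi> = 0\<close>.\<close>

section \<open>Calculus of test functions\<close>

text \<open>The hypothesis on \<open>K\<close> only sees test functions supported away from the
  origin, whereas the gradient norm is a statement about \<open>A(0) - A\<close> on all of space. A
  part of the distribution concentrated at \<open>0\<close>, or mass lost at infinity, would break
  the identity of energies. Both are excluded by the integrability of
  \<open>min 1 (1/|h|) * \<rho>(h)\<close>: second differences bounded by a multiple of
  \<open>min 1 |h| * min 1 |k|\<close> pair absolutely with \<open>b(h) \<bullet> b(k)\<close>, so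
  \<open>L\<close> passes to the limit along cutoffs that keep such a bound uniformly. Near
  \<open>0\<close> this works because \<open>A\<close> is even, so that \<open>A(0) - A\<close> has
  a zero of second order. The identity of energies is then used in both directions. It gives
  elements of the space finite energy, and it turns an energy bound for a mollified truncation,
  about whose gradient nothing is known directly, back into a gradient bound. Such bounds yield
  bounded rather than Cauchy sequences of test functions; the Hilbert space structure closes that
  gap. Null sets are dealt with once, at the end, by passing to Borel versions.\<close>

definition pd :: "'n::finite \<Rightarrow> (real ^ 'n \<Rightarrow> 'b::real_normed_vector) \<Rightarrow> real ^ 'n \<Rightarrow> 'b" where
  "pd i f = (\<lambda>x. frechet_derivative f (at x) (axis i 1))"

lemma pd_eq: "(f has_derivative f') (at x) \<Longrightarrow> pd i f x = f' (axis i 1)"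
  by (simp add: pd_def frechet_derivative_at[symmetric])

lemma C_k_Suc_iff: "C_k (Suc k) f \<longleftrightarrow> (\<forall>x. f differentiable at x) \<and> (\<forall>i. C_k k (pd i f))"
  by (simp add: differentiable_on_def pd_def)

declare C_k.simps(2)[simp del]

text \<open>The recursion in \<open>C_k\<close> goes through \<open>frechet_derivative\<close>.
  Supplying any explicit derivative, together with the smoothness of its coordinates, keeps that
  operator out of the closure proofs that follow.\<close>

lemma C_k_SucI:
  assumes "\<And>x. (f has_derivative f' x) (at x)" "\<And>i. C_k k (\<lambda>x. f' x (axis i 1))"
  shows "C_k (Suc k) f"
proof -
  have "pd i f = (\<lambda>x. f' x (axis i 1))" for i
    using assms(1) by (auto simp: pd_eq)
  then show ?thesis using assms by (auto simp: C_k_Suc_iff differentiable_def)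
qed

lemma C_k_Suc_has_derivative:
  assumes "C_k (Suc k) f"
  shows "(f has_derivative (\<lambda>h. \<Sum>i\<in>UNIV. (h $ i) *\<^sub>R pd i f x)) (at x)"
proof -
  obtain f' where f': "(f has_derivative f') (at x)"
    using assms by (auto simp: C_k_Suc_iff differentiable_def)
  then have lin: "linear f'" by (rule has_derivative_linear)
  have "f' h = (\<Sum>i\<in>UNIV. (h $ i) *\<^sub>R pd i f x)" for h
  proof -
    have "f' h = f' (\<Sum>i\<in>UNIV. (h $ i) *\<^sub>R axis i 1)"
      using basis_expansion[of h] by (simp add: scalar_mult_eq_scaleR)
    also have "\<dots> = (\<Sum>i\<in>UNIV. (h $ i) *\<^sub>R f' (axis i 1))"
      using lin by (simp add: linear_sum linear_cmul)
    finally show ?thesis using f' by (simp add: pd_eq)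
  qed
  then show ?thesis using f' by (metis (no_types, lifting) ext)
qed

lemma C_k_continuous: "C_k k f \<Longrightarrow> continuous_on UNIV f"
proof (cases k)
  case (Suc m)
  moreover assume "C_k k f"
  ultimately show ?thesis
    by (meson C_k_Suc_iff continuous_at_imp_continuous_on differentiable_imp_continuous_within)
qed auto

lemma C_k_const: "C_k k (\<lambda>x::real^'n::finite. c)"
proof (induction k arbitrary: c)
  case (Suc k)
  show ?case by (rule C_k_SucI[where f'="\<lambda>_ _. 0"]) (auto simp: Suc.IH)
qed auto

lemma C_k_linear:
  assumes "bounded_linear L" "C_k k f"
  shows "C_k k (\<lambda>x. L (f x))"
  using assms(2)
proof (induction k arbitrary: f)
  case 0
  then show ?case
    using bounded_linear.continuous_on[OF assms(1)] by auto
next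
  case (Suc k)
  have "C_k k (pd i f)" for i using Suc.prems by (simp add: C_k_Suc_iff)
  moreover have "((\<lambda>x. L (f x)) has_derivative (\<lambda>h. L (\<Sum>i\<in>UNIV. (h $ i) *\<^sub>R pd i f x))) (at x)" for x
    by (rule bounded_linear.has_derivative[OF assms(1) C_k_Suc_has_derivative[OF Suc.prems]])
  ultimately show ?case
    by (intro C_k_SucI) (auto simp: axis_def if_distrib[where f="\<lambda>c. c *\<^sub>R _"] cong: if_cong intro!: Suc.IH)
qed

lemma sum_axis_scaleR: "(\<Sum>j\<in>UNIV. (axis i 1 $ j) *\<^sub>R g j) = (g i :: 'b::real_vector)"
  by (simp add: axis_def if_distrib[where f="\<lambda>c. c *\<^sub>R _"] cong: if_cong)

lemma C_k_add:
  assumes "C_k k f" "C_k k g"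
  shows "C_k k (\<lambda>x. f x + g x)"
  using assms
proof (induction k arbitrary: f g)
  case 0 then show ?case by (auto intro: continuous_intros)
next
  case (Suc k)
  note D = C_k_Suc_has_derivative[OF Suc.prems(1)] C_k_Suc_has_derivative[OF Suc.prems(2)]
  show ?case
    using Suc.prems by (intro C_k_SucI[OF has_derivative_add[OF D]])
      (simp add: sum_axis_scaleR C_k_Suc_iff Suc.IH)
qed

lemma C_k_uminus: "C_k k f \<Longrightarrow> C_k k (\<lambda>x. - f x)"
  by (rule C_k_linear[OF bounded_linear_minus[OF bounded_linear_ident]])

lemma C_k_diff: "C_k k f \<Longrightarrow> C_k k g \<Longrightarrow> C_k k (\<lambda>x. f x - g x)"
  using C_k_add[OF _ C_k_uminus, of k f g] by simp

lemma C_k_scaleR: "C_k k f \<Longrightarrow> C_k k (\<lambda>x. c *\<^sub>R f x)"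
  by (rule C_k_linear[OF bounded_linear_scaleR_right])

lemma C_k_sum: "finite S \<Longrightarrow> (\<And>i. i \<in> S \<Longrightarrow> C_k k (f i)) \<Longrightarrow> C_k k (\<lambda>x. \<Sum>i\<in>S. f i x)"
  by (induction S rule: finite_induct) (auto intro: C_k_const C_k_add)

lemma C_k_SucD: "C_k (Suc k) f \<Longrightarrow> C_k k f"
proof (induction k arbitrary: f)
  case 0 then show ?case using C_k_continuous by auto
next
  case (Suc k)
  then show ?case using C_k_Suc_iff by blast
qed

lemma C_k_mult:
  fixes f g :: "real^'n::finite \<Rightarrow> 'b::real_normed_algebra"
  assumes "C_k k f" "C_k k g"
  shows "C_k k (\<lambda>x. f x * g x)"
  using assms
proof (induction k arbitrary: f g)
  case 0 then show ?case by (auto intro: continuous_intros)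
next
  case (Suc k)
  note D = C_k_Suc_has_derivative[OF Suc.prems(1)] C_k_Suc_has_derivative[OF Suc.prems(2)]
  \<comment> \<open>The product rule contains \<open>f\<close> and \<open>g\<close>
    undifferentiated, so the induction hypothesis is applied to them at order \<open>k\<close> as
    well.\<close>
  show ?case
    using Suc.prems C_k_SucD[OF Suc.prems(1)] C_k_SucD[OF Suc.prems(2)]
    by (intro C_k_SucI[OF has_derivative_mult[OF D]])
      (simp add: sum_axis_scaleR C_k_Suc_iff Suc.IH C_k_add)
qed

lemma C_k_affine:
  assumes "C_k k f"
  shows "C_k k (\<lambda>x. f (a + c *\<^sub>R x))"
  using assms
proof (induction k arbitrary: f)
  case 0
  then have "continuous_on UNIV f" by simp
  then show ?case
    by (auto intro!: continuous_on_compose2[of UNIV f] continuous_intros)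
next
  case (Suc k)
  have "((\<lambda>x. f (a + c *\<^sub>R x)) has_derivative
      (\<lambda>h. \<Sum>i\<in>UNIV. ((c *\<^sub>R h) $ i) *\<^sub>R pd i f (a + c *\<^sub>R x))) (at x)" for x
    by (rule has_derivative_compose[OF _ C_k_Suc_has_derivative[OF Suc.prems], unfolded o_def])
       (auto intro!: derivative_eq_intros)
  then have D: "((\<lambda>x. f (a + c *\<^sub>R x)) has_derivative
      (\<lambda>h. \<Sum>i\<in>UNIV. (h $ i) *\<^sub>R (c *\<^sub>R pd i f (a + c *\<^sub>R x)))) (at x)" for x
    by (simp add: mult.commute)
  show ?case
    using Suc.prems by (intro C_k_SucI[OF D])
      (simp only: sum_axis_scaleR C_k_Suc_iff, auto intro!: C_k_scaleR Suc.IH)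
qed

lemma C_k_coord: "C_k k (\<lambda>x::real^'n::finite. x $ i)"
proof (cases k)
  case 0 then show ?thesis by (auto intro: continuous_intros)
next
  case (Suc m)
  have "((\<lambda>x::real^'n. x $ i) has_derivative (\<lambda>x. x $ i)) (at x)" for x
    by (auto intro!: derivative_eq_intros bounded_linear_imp_has_derivative bounded_linear_vec_nth)
  then show ?thesis unfolding Suc by (rule C_k_SucI) (rule C_k_const)
qed

lemma C_k_pd: "C_k (Suc k) f \<Longrightarrow> C_k k (pd i f)"
  by (simp add: C_k_Suc_iff)

lemma pd_add:
  "C_k (Suc k) f \<Longrightarrow> C_k (Suc m) g \<Longrightarrow> pd i (\<lambda>x. f x + g x) = (\<lambda>x. pd i f x + pd i g x)"
  by (rule ext, subst pd_eq[OF has_derivative_add[OF C_k_Suc_has_derivative C_k_Suc_has_derivative]])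
     (auto simp: sum_axis_scaleR)

lemma pd_mult:
  fixes f g :: "real^'n::finite \<Rightarrow> 'b::real_normed_algebra"
  shows "C_k (Suc k) f \<Longrightarrow> C_k (Suc m) g \<Longrightarrow>
    pd i (\<lambda>x. f x * g x) = (\<lambda>x. f x * pd i g x + pd i f x * g x)"
  by (rule ext, subst pd_eq[OF has_derivative_mult[OF C_k_Suc_has_derivative C_k_Suc_has_derivative]])
     (auto simp: sum_axis_scaleR)

lemma pd_affine:
  assumes "C_k (Suc k) f"
  shows "pd i (\<lambda>x. f (a + c *\<^sub>R x)) = (\<lambda>x. c *\<^sub>R pd i f (a + c *\<^sub>R x))"
proof
  fix x
  have "((\<lambda>x. f (a + c *\<^sub>R x)) has_derivative
      (\<lambda>h. \<Sum>i\<in>UNIV. ((c *\<^sub>R h) $ i) *\<^sub>R pd i f (a + c *\<^sub>R x))) (at x)"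
    by (rule has_derivative_compose[OF _ C_k_Suc_has_derivative[OF assms], unfolded o_def])
       (auto intro!: derivative_eq_intros)
  then have D: "((\<lambda>x. f (a + c *\<^sub>R x)) has_derivative
      (\<lambda>h. \<Sum>i\<in>UNIV. (h $ i) *\<^sub>R (c *\<^sub>R pd i f (a + c *\<^sub>R x)))) (at x)"
    by (simp add: mult.commute)
  show "pd i (\<lambda>x. f (a + c *\<^sub>R x)) x = c *\<^sub>R pd i f (a + c *\<^sub>R x)"
    by (simp only: pd_eq[OF D] sum_axis_scaleR)
qed

lemma pd_linear:
  assumes "bounded_linear L" "C_k (Suc k) f"
  shows "pd i (\<lambda>x. L (f x)) = (\<lambda>x. L (pd i f x))"
  by (rule ext, subst pd_eq[OF bounded_linear.has_derivative[OF assms(1) C_k_Suc_has_derivative[OF assms(2)]]])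
     (simp add: sum_axis_scaleR)

lemma Cc_infinity_iff:
  "f \<in> Cc_infinity UNIV \<longleftrightarrow> (\<forall>k. C_k k f) \<and> (\<exists>R. \<forall>x. f x \<noteq> 0 \<longrightarrow> norm x \<le> R)"
  by (auto simp: Cc_infinity_def compact_closure bounded_iff)

lemma Cc_infinityI: "(\<And>k. C_k k f) \<Longrightarrow> (\<And>x. norm x > R \<Longrightarrow> f x = 0) \<Longrightarrow> f \<in> Cc_infinity UNIV"
  unfolding Cc_infinity_iff using linorder_not_le by blast

lemma Cc_infinity_punctured:
  assumes "f \<in> Cc_infinity UNIV" "r > 0" "\<And>x. norm x < r \<Longrightarrow> f x = 0"
  shows "f \<in> Cc_infinity (- {0})"
proof -
  have "0 \<notin> closure {x. f x \<noteq> 0}"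
    unfolding closure_approachable using assms(2,3) by (metis (mono_tags) dist_0_norm dist_commute mem_Collect_eq)
  then show ?thesis using assms(1) by (auto simp: Cc_infinity_def)
qed

lemma Cc_infinityD:
  assumes "f \<in> Cc_infinity UNIV"
  obtains R where "R > 0" "\<And>x. norm x > R \<Longrightarrow> f x = 0"
proof -
  obtain R where R: "\<And>x. f x \<noteq> 0 \<Longrightarrow> norm x \<le> R" using assms by (auto simp: Cc_infinity_iff)
  show ?thesis by (rule that[of "max R 1"]) (use R in force)+
qed

lemma Cc_C_k: "f \<in> Cc_infinity U \<Longrightarrow> C_k k f"
  by (simp add: Cc_infinity_def)

lemma Cc_mono: "f \<in> Cc_infinity U \<Longrightarrow> f \<in> Cc_infinity UNIV"
  by (simp add: Cc_infinity_def)

lemma pd_eq_0: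
  assumes "open S" "x \<in> S" "\<And>y. y \<in> S \<Longrightarrow> f y = 0"
  shows "pd i f x = 0"
proof -
  have "(f has_derivative (\<lambda>_. 0)) (at x)"
    by (rule has_derivative_transform_within_open[OF has_derivative_const assms(1,2)]) (simp add: assms)
  then show ?thesis by (simp add: pd_eq)
qed

lemma pd_Cc:
  assumes "f \<in> Cc_infinity UNIV" shows "pd i f \<in> Cc_infinity UNIV"
proof -
  obtain R where R: "\<And>x. norm x > R \<Longrightarrow> f x = 0" using Cc_infinityD[OF assms] by blast
  show ?thesis
  proof (rule Cc_infinityI)
    show "C_k k (pd i f)" for k by (rule C_k_pd) (rule Cc_C_k[OF assms])
    have "open {x::real^'a. norm x > R}" by (intro open_Collect_less continuous_intros)
    then show "norm x > R \<Longrightarrow> pd i f x = 0" for x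
      using R by (intro pd_eq_0[where S="{x. norm x > R}"]) auto
  qed
qed

lemma Cc_add: "f \<in> Cc_infinity UNIV \<Longrightarrow> g \<in> Cc_infinity UNIV \<Longrightarrow> (\<lambda>x. f x + g x) \<in> Cc_infinity UNIV"
proof -
  assume *: "f \<in> Cc_infinity UNIV" "g \<in> Cc_infinity UNIV"
  obtain R where "\<And>x. norm x > R \<Longrightarrow> f x = 0" using Cc_infinityD[OF *(1)] by blast
  moreover obtain S where "\<And>x. norm x > S \<Longrightarrow> g x = 0" using Cc_infinityD[OF *(2)] by blast
  ultimately show ?thesis
    by (intro Cc_infinityI[where R="max R S"] C_k_add Cc_C_k[OF *(1)] Cc_C_k[OF *(2)]) simp
qed

lemma Cc_linear:
  assumes "bounded_linear L" "f \<in> Cc_infinity UNIV" shows "(\<lambda>x. L (f x)) \<in> Cc_infinity UNIV"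
proof -
  interpret L: bounded_linear L by fact
  obtain R where "\<And>x. norm x > R \<Longrightarrow> f x = 0" using Cc_infinityD[OF assms(2)] by blast
  then show ?thesis
    by (intro Cc_infinityI[where R=R] C_k_linear[OF assms(1)] Cc_C_k[OF assms(2)]) (simp add: L.zero)
qed

lemma Cc_uminus: "f \<in> Cc_infinity UNIV \<Longrightarrow> (\<lambda>x. - f x) \<in> Cc_infinity UNIV"
  by (rule Cc_linear[OF bounded_linear_minus[OF bounded_linear_ident]])

lemma Cc_diff: "f \<in> Cc_infinity UNIV \<Longrightarrow> g \<in> Cc_infinity UNIV \<Longrightarrow> (\<lambda>x. f x - g x) \<in> Cc_infinity UNIV"
  using Cc_add[OF _ Cc_uminus, of f g] by simp

lemma Cc_scaleR: "f \<in> Cc_infinity UNIV \<Longrightarrow> (\<lambda>x. c *\<^sub>R f x) \<in> Cc_infinity UNIV"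
  by (rule Cc_linear[OF bounded_linear_scaleR_right])

lemma Cc_mult:
  fixes f g :: "real^'n::finite \<Rightarrow> 'b::real_normed_algebra"
  assumes "f \<in> Cc_infinity UNIV" "\<And>k. C_k k g"
  shows "(\<lambda>x. f x * g x) \<in> Cc_infinity UNIV"
proof -
  obtain R where "\<And>x. norm x > R \<Longrightarrow> f x = 0" using Cc_infinityD[OF assms(1)] by blast
  then show ?thesis
    by (intro Cc_infinityI[where R=R] C_k_mult assms(2) Cc_C_k[OF assms(1)]) simp
qed

lemma Cc_affine:
  assumes "f \<in> Cc_infinity UNIV" "c \<noteq> 0"
  shows "(\<lambda>x. f (a + c *\<^sub>R x)) \<in> Cc_infinity UNIV"
proof -
  obtain R where R: "\<And>x. norm x > R \<Longrightarrow> f x = 0" using Cc_infinityD[OF assms(1)] by blast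
  have *: "norm (a + c *\<^sub>R x) > R" if "norm x > (R + norm a) / \<bar>c\<bar>" for x
  proof -
    have "\<bar>c\<bar> * norm x > R + norm a" using that assms(2) by (simp add: field_simps)
    then show ?thesis using norm_triangle_ineq2[of "c *\<^sub>R x" "-a"] by (simp add: add.commute)
  qed
  show ?thesis
    by (intro Cc_infinityI[where R="(R + norm a) / \<bar>c\<bar>"] C_k_affine Cc_C_k[OF assms(1)] R *)
qed

lemma Cc_continuous: "f \<in> Cc_infinity U \<Longrightarrow> continuous_on UNIV f"
  using C_k_continuous Cc_C_k by blast

lemma Cc_bounded:
  assumes "f \<in> Cc_infinity UNIV"
  obtains B where "B > 0" "\<And>x. norm (f x) \<le> B"
proof -
  obtain R where R: "\<And>x. norm x > R \<Longrightarrow> f x = 0" using Cc_infinityD[OF assms] by blast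
  have "compact (f ` cball 0 R)"
    by (intro compact_continuous_image continuous_on_subset[OF Cc_continuous[OF assms]]) auto
  then obtain B where B: "\<And>x. norm x \<le> R \<Longrightarrow> norm (f x) \<le> B"
    by (meson bounded_iff compact_imp_bounded image_eqI mem_cball_0)
  show ?thesis
  proof (rule that[of "max B 1"])
    show "norm (f x) \<le> max B 1" for x
      using B[of x] R[of x] by (cases "norm x \<le> R") (auto simp: not_le)
  qed simp
qed

text \<open>Mean value inequality. The factor \<open>CARD('n)\<close> comes from bounding each
  coordinate of a vector by its norm when the operator norm of the derivative is estimated.\<close>

lemma norm_pd_lipschitz:
  fixes f :: "real^'n::finite \<Rightarrow> 'b::real_normed_vector"
  assumes "C_k (Suc k) f" "\<And>i x. norm (pd i f x) \<le> M"
  shows "norm (f x - f y) \<le> (real CARD('n) * M) * norm (x - y)"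
proof (rule differentiable_bound[OF convex_UNIV])
  show "(f has_derivative (\<lambda>h. \<Sum>i\<in>UNIV. (h $ i) *\<^sub>R pd i f x)) (at x within UNIV)" for x
    using C_k_Suc_has_derivative[OF assms(1)] by simp
  show "onorm (\<lambda>h. \<Sum>i\<in>UNIV. (h $ i) *\<^sub>R pd i f x) \<le> real CARD('n) * M" for x
  proof (rule onorm_le)
    fix h
    have "norm (\<Sum>i\<in>UNIV. (h $ i) *\<^sub>R pd i f x) \<le> (\<Sum>i::'n\<in>UNIV. norm h * M)"
      by (rule sum_norm_le) (auto intro!: mult_mono assms component_le_norm_cart)
    then show "norm (\<Sum>i\<in>UNIV. (h $ i) *\<^sub>R pd i f x) \<le> real CARD('n) * M * norm h"
      by (simp add: algebra_simps)
  qed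
qed auto

lemma Cc_lipschitz:
  assumes "f \<in> Cc_infinity UNIV"
  obtains M where "M > 0" "\<And>x y. norm (f x - f y) \<le> M * norm (x - y)"
proof -
  have "\<forall>i. \<exists>B. \<forall>x. norm (pd i f x) \<le> B" using Cc_bounded[OF pd_Cc[OF assms]] by metis
  then obtain B where B: "\<And>i x. norm (pd i f x) \<le> B i" by metis
  define M where "M = Max (range B)"
  have "norm (pd i f x) \<le> M" for i x
    using B[of i x] by (auto simp: M_def intro!: order_trans[OF _ Max_ge])
  note * = norm_pd_lipschitz[OF Cc_C_k[OF assms] this]
  show ?thesis
  proof (rule that[of "max 1 (real CARD('a) * M)"])
    show "norm (f x - f y) \<le> max 1 (real CARD('a) * M) * norm (x - y)" for x y
      by (rule order_trans[OF *]) (auto intro: mult_right_mono)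
  qed auto
qed

text \<open>The mean value inequality is used twice: the partial derivatives of the increment
  \<open>g\<close> are increments of partial derivatives of \<open>f\<close>, hence of size
  \<open>norm l\<close>, and the second difference is an increment of \<open>g\<close>.\<close>

lemma second_difference_bound:
  fixes f :: "real^'n::finite \<Rightarrow> 'b::real_normed_vector"
  assumes "C_k (Suc (Suc k)) f" "\<And>i j x. norm (pd j (pd i f) x) \<le> M"
  shows "norm (f x - f (x + h) - f (x + l) + f (x + h + l)) \<le> (real CARD('n))\<^sup>2 * M * norm h * norm l"
proof -
  define g where "g x = f (x + l) - f x" for x
  have A: "C_k (Suc k) (\<lambda>x. f (x + l))" 
    using C_k_affine[OF C_k_SucD[OF assms(1)], of l 1] by (simp add: add.commute)
  have A2: "C_k (Suc k) (\<lambda>x. - f x)" by (rule C_k_uminus[OF C_k_SucD[OF assms(1)]])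
  have geq: "g = (\<lambda>x. f (x + l) + - f x)" by (auto simp: g_def)
  have gk: "C_k (Suc k) g" unfolding geq by (rule C_k_add[OF A A2])
  have pdg: "pd i g = (\<lambda>x. pd i f (x + l) - pd i f x)" for i
    unfolding geq pd_add[OF A A2] pd_linear[OF bounded_linear_minus[OF bounded_linear_ident] C_k_SucD[OF assms(1)]]
    using pd_affine[OF C_k_SucD[OF assms(1)], of i l 1] by (simp add: add.commute)
  have "norm (pd i g x) \<le> real CARD('n) * M * norm l" for i x
    unfolding pdg using norm_pd_lipschitz[OF C_k_pd[OF assms(1)] assms(2), of i "x + l" x] by simp
  from norm_pd_lipschitz[OF gk this, of "x + h" x]
  show ?thesis by (simp add: g_def algebra_simps power2_eq_square)
qed

lemma Cc_second_difference:
  fixes f :: "real^'n::finite \<Rightarrow> 'b::real_normed_vector"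
  assumes "f \<in> Cc_infinity UNIV"
  obtains M where "M > 0" "\<And>i j x. norm (pd j (pd i f) x) \<le> M"
    "\<And>x h l. norm (f x - f (x + h) - f (x + l) + f (x + h + l)) \<le> M * norm h * norm l"
proof -
  have "\<forall>i j. \<exists>B. \<forall>x. norm (pd j (pd i f) x) \<le> B" using Cc_bounded[OF pd_Cc[OF pd_Cc[OF assms]]] by metis
  then obtain B where B: "\<And>i j x. norm (pd j (pd i f) x) \<le> B i j" by metis
  define M where "M = Max (range (\<lambda>(i,j). B i j))"
  have M: "norm (pd j (pd i f) x) \<le> M" for i j x
    using B[of j i x] by (auto simp: M_def intro!: order_trans[OF _ Max_ge])
  show ?thesis
  proof (rule that[of "max 1 (max M ((real CARD('n))\<^sup>2 * M))"])
    show "norm (f x - f (x + h) - f (x + l) + f (x + h + l)) \<le> max 1 (max M ((real CARD('n))\<^sup>2 * M)) * norm h * norm l" for x h l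
      by (rule order_trans[OF second_difference_bound[OF Cc_C_k[OF assms] M]])
         (auto intro!: mult_right_mono)
    show "norm (pd j (pd i f) x) \<le> max 1 (max M ((real CARD('n))\<^sup>2 * M))" for i j x
      using M[of j i x] by simp
  qed auto
qed

section \<open>Convolution, mollifiers and cutoffs\<close>

lemma integrable_continuous_bounded_support:
  fixes F :: "'a::euclidean_space \<Rightarrow> 'b::{banach, second_countable_topology}"
  assumes "continuous_on UNIV F" "\<And>x. norm x > R \<Longrightarrow> F x = 0"
  shows "integrable lborel F"
proof -
  have "integrable lborel (\<lambda>x. indicator (cball 0 R) x *\<^sub>R F x)"
    by (intro borel_integrable_compact continuous_on_subset[OF assms(1)]) auto
  also have "(\<lambda>x. indicator (cball 0 R) x *\<^sub>R F x) = F"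
    using assms(2) by (force simp: indicator_def)
  finally show ?thesis .
qed

lemma Cc_integrable:
  fixes f :: "real^'n::finite \<Rightarrow> 'b::{banach, second_countable_topology}"
  shows "f \<in> Cc_infinity UNIV \<Longrightarrow> integrable lborel f"
  by (metis Cc_infinityD Cc_continuous integrable_continuous_bounded_support)

text \<open>The partial derivatives are test functions again, hence Lipschitz. Along the segment
  from \<open>x\<close> to \<open>x + h\<close> the derivative therefore differs from its value at
  \<open>x\<close> by at most \<open>M * norm h\<close>.\<close>

lemma Cc_Taylor:
  fixes f :: "real^'n::finite \<Rightarrow> 'b::real_normed_vector"
  assumes "f \<in> Cc_infinity UNIV"
  obtains M where "M > 0"
    "\<And>x h. norm (f (x + h) - f x - (\<Sum>i\<in>UNIV. (h $ i) *\<^sub>R pd i f x)) \<le> M * (norm h)\<^sup>2"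
proof -
  have "\<forall>i. \<exists>L. L > 0 \<and> (\<forall>x y. norm (pd i f x - pd i f y) \<le> L * norm (x - y))"
    using Cc_lipschitz[OF pd_Cc[OF assms]] by metis
  then obtain L where L: "\<And>i. L i > 0" "\<And>i x y. norm (pd i f x - pd i f y) \<le> L i * norm (x - y)" by metis
  define M where "M = (\<Sum>i\<in>UNIV. L i)"
  show ?thesis
  proof (rule that[of M])
    show "M > 0" unfolding M_def using L by (intro sum_pos) auto
    fix x h
    have "norm (f (x + h) - f x - (\<Sum>i\<in>UNIV. ((x + h - x) $ i) *\<^sub>R pd i f x)) \<le> norm (x + h - x) * (M * norm h)"
    proof (rule differentiable_bound_linearization[where S="closed_segment x (x + h)"])
      show "x + t *\<^sub>R (x + h - x) \<in> closed_segment x (x + h)" if "t \<in> {0..1}" for t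
        using that by (auto simp: in_segment algebra_simps intro!: exI[of _ t])
      show "(f has_derivative (\<lambda>h. \<Sum>i\<in>UNIV. (h $ i) *\<^sub>R pd i f y)) (at y within closed_segment x (x + h))" for y
        by (rule has_derivative_at_withinI[OF C_k_Suc_has_derivative[OF Cc_C_k[OF assms]]])
      fix y assume y: "y \<in> closed_segment x (x + h)"
      then have yx: "norm (y - x) \<le> norm h"
        by (metis add_diff_cancel_left' segment_bound(1))
      show "onorm ((\<lambda>h. \<Sum>i\<in>UNIV. (h $ i) *\<^sub>R pd i f y) - (\<lambda>h. \<Sum>i\<in>UNIV. (h $ i) *\<^sub>R pd i f x)) \<le> M * norm h"
      proof (rule onorm_le)
        fix v :: "real^'n"
        have "norm (\<Sum>i\<in>UNIV. (v $ i) *\<^sub>R (pd i f y - pd i f x)) \<le> (\<Sum>i\<in>UNIV. norm v * (L i * norm h))"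
        proof (rule sum_norm_le)
          fix i
          have "norm (pd i f y - pd i f x) \<le> L i * norm h"
            using L(2)[of i y x] mult_left_mono[OF yx, of "L i"] L(1)[of i] by linarith
          then show "norm ((v $ i) *\<^sub>R (pd i f y - pd i f x)) \<le> norm v * (L i * norm h)"
            using component_le_norm_cart[of v i] by (auto intro!: mult_mono)
        qed
        also have "\<dots> = M * norm h * norm v" by (simp add: M_def sum_distrib_left sum_distrib_right algebra_simps)
        finally show "norm (((\<lambda>h. \<Sum>i\<in>UNIV. (h $ i) *\<^sub>R pd i f y) - (\<lambda>h. \<Sum>i\<in>UNIV. (h $ i) *\<^sub>R pd i f x)) v) \<le> M * norm h * norm v"
          by (simp add: scaleR_diff_right sum_subtractf)
      qed
    qed auto
    then show "norm (f (x + h) - f x - (\<Sum>i\<in>UNIV. (h $ i) *\<^sub>R pd i f x)) \<le> M * (norm h)\<^sup>2"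
      by (simp add: power2_eq_square algebra_simps)
  qed
qed

section \<open>Convolution with a test function\<close>

definition conv :: "(real^'n::finite \<Rightarrow> 'b::{banach, second_countable_topology}) \<Rightarrow> (real^'n \<Rightarrow> real) \<Rightarrow> real^'n \<Rightarrow> 'b" where
  "conv f \<eta> x = (LINT y|lborel. \<eta> (x - y) *\<^sub>R f y)"

lemma conv_integrable:
  fixes f :: "real^'n::finite \<Rightarrow> 'b::{banach, second_countable_topology}"
  assumes "continuous_on UNIV f" "\<eta> \<in> Cc_infinity UNIV"
  shows "integrable lborel (\<lambda>y. \<eta> (x - y) *\<^sub>R f y)"
proof -
  obtain R where R: "\<And>x. norm x > R \<Longrightarrow> \<eta> x = 0" using Cc_infinityD[OF assms(2)] by blast
  show ?thesis
  proof (rule integrable_continuous_bounded_support[where R="R + norm x"])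
    show "continuous_on UNIV (\<lambda>y. \<eta> (x - y) *\<^sub>R f y)"
      by (intro continuous_intros assms continuous_on_compose2[OF Cc_continuous[OF assms(2)]]) auto
    show "\<eta> (x - y) *\<^sub>R f y = 0" if "norm y > R + norm x" for y
      using that R[of "x - y"] norm_triangle_ineq2[of y x] by (simp add: norm_minus_commute)
  qed
qed

text \<open>The Taylor remainder of \<open>\<eta>\<close> is quadratic in the increment, uniformly
  in the base point, and is integrated against \<open>norm (f w)\<close> over a fixed ball. Values
  of \<open>f\<close> are in a Banach space because \<open>f\<close> is later also a complex
  character.\<close>

lemma conv_has_derivative:
  fixes f :: "real^'n::finite \<Rightarrow> 'b::{banach, second_countable_topology}"
  assumes "continuous_on UNIV f" "\<eta> \<in> Cc_infinity UNIV"
  shows "(conv f \<eta> has_derivative (\<lambda>h. \<Sum>i\<in>UNIV. (h $ i) *\<^sub>R conv f (pd i \<eta>) x)) (at x)"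
proof -
  obtain R where R: "\<And>x. norm x > R \<Longrightarrow> \<eta> x = 0" using Cc_infinityD[OF assms(2)] by blast
  obtain M where M: "M > 0" "\<And>x h. norm (\<eta> (x + h) - \<eta> x - (\<Sum>i\<in>UNIV. (h $ i) *\<^sub>R pd i \<eta> x)) \<le> M * (norm h)\<^sup>2"
    using Cc_Taylor[OF assms(2)] by blast
  have [measurable]: "f \<in> borel_measurable borel" using borel_measurable_continuous_onI assms(1) by blast
  \<comment> \<open>If \<open>y\<close> is within distance \<open>1\<close> of \<open>x\<close>, the
    Taylor remainder of \<open>\<eta>\<close> vanishes for \<open>w\<close> outside the ball of
    radius \<open>\<bar>R\<bar> + 1\<close> around \<open>x\<close>. The absolute value is taken
    because no sign of \<open>R\<close> has been recorded.\<close>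
  define I where "I y = indicator (cball x (\<bar>R\<bar> + 1)) y *\<^sub>R norm (f y)" for y
  have I: "integrable lborel I" unfolding I_def
    by (intro borel_integrable_compact continuous_intros continuous_on_subset[OF assms(1)]) auto
  have pdo: "pd i \<eta> z = 0" if "norm z > R" for i z
    by (rule pd_eq_0[where S="{z. norm z > R}"]) (auto intro!: open_Collect_less continuous_intros simp: R that)
  note ci = conv_integrable[OF assms(1)]
  have est: "norm (conv f \<eta> y - conv f \<eta> x - (\<Sum>i\<in>UNIV. ((y - x) $ i) *\<^sub>R conv f (pd i \<eta>) x)) \<le> M * (norm (y - x))\<^sup>2 * integral\<^sup>L lborel I"
    if "dist y x < 1" for y
  proof -
    define e where "e w = \<eta> (y - w) - \<eta> (x - w) - (\<Sum>i\<in>UNIV. ((y - x) $ i) * pd i \<eta> (x - w))" for w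
    have eq: "e w *\<^sub>R f w = \<eta> (y - w) *\<^sub>R f w - \<eta> (x - w) *\<^sub>R f w - (\<Sum>i\<in>UNIV. ((y - x) $ i) *\<^sub>R (pd i \<eta> (x - w) *\<^sub>R f w))" for w
      by (simp add: e_def scaleR_diff_left scaleR_sum_left)
    have int: "integrable lborel (\<lambda>w. e w *\<^sub>R f w)" unfolding eq
      by (intro Bochner_Integration.integrable_diff Bochner_Integration.integrable_sum
          Bochner_Integration.integrable_scaleR_right ci pd_Cc assms(2))
    have "conv f \<eta> y - conv f \<eta> x - (\<Sum>i\<in>UNIV. ((y - x) $ i) *\<^sub>R conv f (pd i \<eta>) x) = (LINT w|lborel. e w *\<^sub>R f w)"
      unfolding eq conv_def using ci[OF assms(2)] ci[OF pd_Cc[OF assms(2)]]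
      by (simp del: scaleR_scaleR vector_minus_component)
    also have "norm \<dots> \<le> (LINT w|lborel. norm (e w *\<^sub>R f w))" by (rule integral_norm_bound)
    also have "\<dots> \<le> (LINT w|lborel. (M * (norm (y - x))\<^sup>2) * I w)"
    proof (rule integral_mono)
      show "integrable lborel (\<lambda>w. norm (e w *\<^sub>R f w))" using int by (rule integrable_norm)
      show "integrable lborel (\<lambda>w. (M * (norm (y - x))\<^sup>2) * I w)" using I by simp
      fix w
      have "norm (e w) \<le> M * (norm (y - x))\<^sup>2"
        using M(2)[of "x - w" "y - x"] by (simp add: e_def)
      moreover have "e w = 0" if "w \<notin> cball x (\<bar>R\<bar> + 1)"
      proof -
        have "norm (x - w) > R + 1" using that by (auto simp: dist_norm)
        moreover have "norm (y - w) > R" using calculation \<open>dist y x < 1\<close> norm_triangle_ineq[of "x - y" "y - w"]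
          by (simp add: dist_norm norm_minus_commute)
        ultimately show ?thesis by (simp add: e_def R pdo)
      qed
      ultimately show "norm (e w *\<^sub>R f w) \<le> M * (norm (y - x))\<^sup>2 * I w"
        by (auto simp: I_def indicator_def intro!: mult_right_mono)
    qed
    finally show ?thesis by simp
  qed
  show ?thesis
  proof (rule has_derivativeI_sandwich[where e=1 and H="\<lambda>y. M * norm (y - x) * integral\<^sup>L lborel I"])
    show "bounded_linear (\<lambda>h. \<Sum>i\<in>UNIV. (h $ i) *\<^sub>R conv f (pd i \<eta>) x)"
      by (intro bounded_linear_sum bounded_linear_scaleR_const bounded_linear_vec_nth)
    show "norm (conv f \<eta> y - conv f \<eta> x - (\<Sum>i\<in>UNIV. ((y - x) $ i) *\<^sub>R conv f (pd i \<eta>) x)) / norm (y - x)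
        \<le> M * norm (y - x) * integral\<^sup>L lborel I" if "y \<noteq> x" "dist y x < 1" for y
      using est[OF that(2)] that(1) by (simp add: field_simps power2_eq_square)
    show "((\<lambda>y. M * norm (y - x) * integral\<^sup>L lborel I) \<longlongrightarrow> 0) (at x)"
      by (auto intro!: tendsto_eq_intros)
  qed auto
qed

text \<open>All derivatives fall on the second factor, so the induction runs over the kernel
  \<open>\<eta>\<close> while \<open>f\<close> stays merely continuous.\<close>

lemma conv_C_k:
  assumes "continuous_on UNIV f" "\<eta> \<in> Cc_infinity UNIV"
  shows "C_k k (conv f \<eta>)"
  using assms(2)
proof (induction k arbitrary: \<eta>)
  case 0
  have "continuous_on UNIV (conv f \<eta>)"
    by (meson conv_has_derivative[OF assms(1) 0] has_derivative_continuous continuous_at_imp_continuous_on)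
  then show ?case by simp
next
  case (Suc k)
  show ?case
    by (rule C_k_SucI[OF conv_has_derivative[OF assms(1) Suc.prems]])
       (simp add: sum_axis_scaleR Suc.IH pd_Cc Suc.prems)
qed

lemma pd_conv:
  assumes "continuous_on UNIV f" "\<eta> \<in> Cc_infinity UNIV"
  shows "pd i (conv f \<eta>) = conv f (pd i \<eta>)"
  by (rule ext, subst pd_eq[OF conv_has_derivative[OF assms]]) (simp add: sum_axis_scaleR)

lemma conv_support:
  assumes "\<And>x. norm x \<ge> R \<Longrightarrow> f x = 0" "\<And>x. norm x \<ge> S \<Longrightarrow> \<eta> x = 0" "norm x \<ge> R + S"
  shows "conv f \<eta> x = 0"
proof -
  have "\<eta> (x - y) *\<^sub>R f y = 0" for y
    using assms(1)[of y] assms(2)[of "x - y"] assms(3) norm_triangle_ineq[of y "x - y"] by force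
  then show ?thesis unfolding conv_def by (simp only:) simp
qed

lemma conv_Cc:
  assumes "continuous_on UNIV f" "\<And>x. norm x > R \<Longrightarrow> f x = 0" "\<eta> \<in> Cc_infinity UNIV"
  shows "conv f \<eta> \<in> Cc_infinity UNIV"
proof -
  obtain S where S: "\<And>x. norm x > S \<Longrightarrow> \<eta> x = 0" using Cc_infinityD[OF assms(3)] by blast
  \<comment> \<open>The summands \<open>1\<close> turn the strict support conditions into the
    non-strict ones of \<open>conv_support\<close>, which are stated for mollifiers vanishing on the
    boundary sphere too.\<close>
  show ?thesis
    by (intro Cc_infinityI[where R="(R + 1) + (S + 1)"] conv_C_k assms conv_support[where R="R+1" and S="S+1"] S) auto
qed

section \<open>Smooth bumps, mollifiers\<close>

definition flat_exp :: "nat \<Rightarrow> real \<Rightarrow> real" where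
  "flat_exp m t = (if t \<le> 0 then 0 else exp (- 1 / t) / t ^ m)"

lemma flat_exp_tendsto_0: "(flat_exp m \<longlongrightarrow> 0) (at 0)"
proof -
  have "((\<lambda>t. (inverse t) ^ m / exp (inverse t)) \<longlongrightarrow> (0::real)) (at_right 0)"
    by (rule filterlim_compose[OF tendsto_power_div_exp_0 filterlim_inverse_at_top_right])
  then have "(flat_exp m \<longlongrightarrow> 0) (at_right 0)"
    by (rule Lim_transform_eventually)
       (auto simp: eventually_at_filter flat_exp_def exp_minus field_simps power_inverse)
  moreover have "(flat_exp m \<longlongrightarrow> 0) (at_left 0)"
    by (rule Lim_transform_eventually[OF tendsto_const]) (auto simp: eventually_at_filter flat_exp_def)
  ultimately show ?thesis by (simp add: filterlim_split_at)
qed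

text \<open>The factor \<open>1 / t ^ m\<close> makes the family \<open>flat_exp\<close> closed
  under differentiation up to linear combinations, so that smoothness of
  \<open>exp (- 1 / t)\<close>, extended by \<open>0\<close>, becomes one induction over all
  \<open>m\<close>.\<close>

lemma flat_exp_deriv:
  "(flat_exp m has_real_derivative flat_exp (m + 2) t - m * flat_exp (m + 1) t) (at t)"
proof -
  consider "t < 0" | "t = 0" | "t > 0" by linarith
  then show ?thesis
  proof cases
    case 1
    have "((\<lambda>_. 0::real) has_real_derivative 0) (at t)" by simp
    then have "(flat_exp m has_real_derivative 0) (at t)"
      by (rule DERIV_cong_ev[THEN iffD1, rotated -1])
         (use 1 in \<open>auto simp: flat_exp_def eventually_nhds intro!: exI[of _ "{..<0}"]\<close>)
    then show ?thesis using 1 by (simp add: flat_exp_def)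
  next
    case 2
    \<comment> \<open>The difference quotient at \<open>0\<close> is itself the next member of the
      family, so its limit is already known.\<close>
    have "(\<lambda>h. (flat_exp m (0 + h) - flat_exp m 0) / h) = flat_exp (m + 1)"
      by (auto simp: flat_exp_def fun_eq_iff field_simps)
    then have "(flat_exp m has_real_derivative 0) (at 0)"
      using flat_exp_tendsto_0[of "m + 1"] by (simp add: DERIV_def)
    then show ?thesis using 2 by (simp add: flat_exp_def)
  next
    case 3
    have "((\<lambda>t. exp (- 1 / t) / t ^ m) has_real_derivative flat_exp (m + 2) t - m * flat_exp (m + 1) t) (at t)"
      using 3 by (auto intro!: derivative_eq_intros simp: flat_exp_def field_simps power2_eq_square)
         (cases m; simp add: field_simps)+
    then show ?thesis
      by (rule DERIV_cong_ev[THEN iffD1, rotated -1])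
         (use 3 in \<open>auto simp: flat_exp_def eventually_nhds intro!: exI[of _ "{0<..}"]\<close>)
  qed
qed

lemma C_k_flat_exp:
  fixes q :: "real^'n::finite \<Rightarrow> real"
  assumes q: "\<And>k. C_k k q"
  shows "C_k k (\<lambda>x. flat_exp m (q x))"
proof (induction k arbitrary: m)
  case 0
  have "continuous_on UNIV (flat_exp m)"
    by (meson DERIV_continuous_on flat_exp_deriv)
  then have "continuous_on UNIV (\<lambda>x. flat_exp m (q x))"
    using C_k_continuous[OF q] by (auto intro: continuous_on_compose2)
  then show ?case by simp
next
  case (Suc k)
  have D: "((\<lambda>x. flat_exp m (q x)) has_derivative
      (\<lambda>h. (flat_exp (m + 2) (q x) - m * flat_exp (m + 1) (q x)) * (\<Sum>i\<in>UNIV. (h $ i) *\<^sub>R pd i q x))) (at x)" for x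
    using has_derivative_compose[OF C_k_Suc_has_derivative[OF q], OF flat_exp_deriv[unfolded has_field_derivative_def]] .
  have "C_k k (\<lambda>x. (flat_exp (m + 2) (q x) + - (m *\<^sub>R flat_exp (m + 1) (q x))) * pd i q x)" for i
    by (intro C_k_mult C_k_add C_k_uminus C_k_scaleR Suc.IH C_k_pd q)
  then show ?case
    by (intro C_k_SucI[OF D]) (simp only: sum_axis_scaleR, simp)
qed

lemma mollifier_exists:
  fixes \<delta> :: real
  assumes "\<delta> > 0"
  obtains \<eta> :: "real^'n::finite \<Rightarrow> real" where "\<eta> \<in> Cc_infinity UNIV" "\<And>x. \<eta> x \<ge> 0"
    "\<And>x. norm x \<ge> \<delta> \<Longrightarrow> \<eta> x = 0" "(LINT x|lborel. \<eta> x) = 1"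
proof -
  \<comment> \<open>The bump is \<open>exp (- 1 / (\<delta>^2 - |x|^2))\<close> inside the ball.
    Writing the square of the norm as a polynomial in the coordinates makes its smoothness a closure
    property.\<close>
  define q where "q x = \<delta>\<^sup>2 - (\<Sum>i\<in>UNIV. x $ i * x $ i)" for x :: "real^'n"
  define b where "b x = flat_exp 0 (q x)" for x
  have qn: "q x = \<delta>\<^sup>2 - (norm x)\<^sup>2" for x
    by (simp only: q_def power2_norm_eq_inner inner_vec_def inner_real_def)
  have "C_k k q" for k
    unfolding q_def by (intro C_k_diff C_k_sum C_k_mult C_k_coord C_k_const) auto
  then have "C_k k b" for k unfolding b_def by (rule C_k_flat_exp)
  moreover have b0: "b x = 0" if "norm x \<ge> \<delta>" for x
    using that assms by (auto simp: b_def qn flat_exp_def intro: power_mono)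
  ultimately have bC: "b \<in> Cc_infinity UNIV" by (intro Cc_infinityI[where R=\<delta>]) auto
  have bnn: "b x \<ge> 0" for x by (simp add: b_def flat_exp_def)
  have b1: "b x > 0" if "norm x < \<delta>" for x
  proof -
    have "(norm x)\<^sup>2 < \<delta>\<^sup>2" using that by (intro power_strict_mono) auto
    then show ?thesis by (simp add: b_def flat_exp_def qn)
  qed
  \<comment> \<open>A vanishing integral would make \<open>b\<close> zero almost everywhere. The
    zero set is closed, and a closed set of full measure is the whole space, contradicting
    \<open>b 0 > 0\<close>.\<close>
  have "(LINT x|lborel. b x) \<noteq> 0"
  proof
    assume "(LINT x|lborel. b x) = 0"
    then have "AE x in lborel. b x = 0"
      using integral_nonneg_eq_0_iff_AE[OF Cc_integrable[OF bC]] bnn by auto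
    then have "AE x in lebesgue. x \<in> {x. b x = 0}" by (auto intro: AE_completion)
    moreover have "closed {x. b x = 0}"
      by (intro closed_Collect_eq Cc_continuous[OF bC] continuous_intros)
    ultimately have "0 \<in> {x. b x = 0}" by (intro mem_closed_if_AE_lebesgue) auto
    then show False using b1[of 0] assms by simp
  qed
  moreover have "(LINT x|lborel. b x) \<ge> 0" using bnn by simp
  ultimately have c: "(LINT x|lborel. b x) > 0" by simp
  show ?thesis
  proof (rule that[of "\<lambda>x. inverse (LINT x|lborel. b x) *\<^sub>R b x"])
    show "(\<lambda>x. inverse (LINT x|lborel. b x) *\<^sub>R b x) \<in> Cc_infinity UNIV" by (rule Cc_scaleR[OF bC])
  qed (use c bnn b0 in auto)
qed

section \<open>Affine substitutions, radial cutoffs\<close>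

lemma lborel_integral_affine:
  fixes f :: "'a::euclidean_space \<Rightarrow> 'b::{banach, second_countable_topology}"
  assumes "c \<noteq> 0"
  shows "(LINT x|lborel. f (t + c *\<^sub>R x)) = (1 / \<bar>c\<bar> ^ DIM('a)) *\<^sub>R (LINT x|lborel. f x)"
proof (cases "f \<in> borel_measurable borel")
  case True
  note [measurable] = True
  have "(LINT x|lborel. f x) = \<bar>c\<bar> ^ DIM('a) *\<^sub>R (LINT x|lborel. f (t + c *\<^sub>R x))"
    by (subst lborel_affine[OF assms, of t]) (simp add: integral_density integral_distr)
  then show ?thesis using assms by simp
next
  \<comment> \<open>For a non-measurable \<open>f\<close> both integrals have the default value
    \<open>0\<close>. Covering this case lets the substitution rules rewrite without side
    conditions.\<close>
  case False
  have "(\<lambda>x. f (t + c *\<^sub>R x)) \<notin> borel_measurable borel"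
  proof
    assume [measurable]: "(\<lambda>x. f (t + c *\<^sub>R x)) \<in> borel_measurable borel"
    have "(\<lambda>y. (\<lambda>x. f (t + c *\<^sub>R x)) (inverse c *\<^sub>R (y - t))) \<in> borel_measurable borel" by measurable
    then show False using False assms by simp
  qed
  then have "\<not> integrable lborel (\<lambda>x. f (t + c *\<^sub>R x))" "\<not> integrable lborel f" using False
    using borel_measurable_integrable by (auto simp: measurable_lborel1)
  then show ?thesis by (simp add: not_integrable_integral_eq)
qed

lemma lborel_integrable_affine:
  fixes f :: "'a::euclidean_space \<Rightarrow> 'b::{banach, second_countable_topology}"
  assumes "integrable lborel f" "c \<noteq> 0"
  shows "integrable lborel (\<lambda>x. f (t + c *\<^sub>R x))"
proof -
  have [measurable]: "f \<in> borel_measurable borel" using assms(1) by auto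
  have "integrable (density (distr lborel borel (\<lambda>x. t + c *\<^sub>R x)) (\<lambda>_. ennreal (\<bar>c\<bar> ^ DIM('a)))) f"
    using assms(1) lborel_affine[OF assms(2), of t] by (simp add: ennreal_power)
  then have "integrable (distr lborel borel (\<lambda>x. t + c *\<^sub>R x)) (\<lambda>x. (\<bar>c\<bar> ^ DIM('a)) *\<^sub>R f x)"
    by (subst (asm) integrable_density) auto
  then have "integrable lborel (\<lambda>x. (\<bar>c\<bar> ^ DIM('a)) *\<^sub>R f (t + c *\<^sub>R x))"
    by (subst (asm) integrable_distr_eq) auto
  then have "integrable lborel (\<lambda>x. (1 / \<bar>c\<bar> ^ DIM('a)) *\<^sub>R ((\<bar>c\<bar> ^ DIM('a)) *\<^sub>R f (t + c *\<^sub>R x)))"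
    by (rule Bochner_Integration.integrable_scaleR_right)
  then show ?thesis using assms(2) by (simp only: scaleR_scaleR) simp
qed

lemma nn_integral_lborel_affine:
  fixes f :: "'a::euclidean_space \<Rightarrow> ennreal"
  assumes [measurable]: "f \<in> borel_measurable borel" and "c \<noteq> 0"
  shows "(\<integral>\<^sup>+x. f x \<partial>lborel) = ennreal (\<bar>c\<bar> ^ DIM('a)) * (\<integral>\<^sup>+x. f (t + c *\<^sub>R x) \<partial>lborel)"
  by (subst lborel_affine[OF assms(2), of t])
     (simp add: nn_integral_density nn_integral_distr nn_integral_cmult)

lemma nn_integral_lborel_shift:
  fixes f :: "'a::euclidean_space \<Rightarrow> ennreal"
  assumes "f \<in> borel_measurable borel"
  shows "(\<integral>\<^sup>+x. f (t + x) \<partial>lborel) = (\<integral>\<^sup>+x. f x \<partial>lborel)"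
    and "(\<integral>\<^sup>+x. f (x - t) \<partial>lborel) = (\<integral>\<^sup>+x. f x \<partial>lborel)"
    and "(\<integral>\<^sup>+x. f (t - x) \<partial>lborel) = (\<integral>\<^sup>+x. f x \<partial>lborel)"
  using nn_integral_lborel_affine[OF assms, of 1 t] nn_integral_lborel_affine[OF assms, of 1 "-t"]
    nn_integral_lborel_affine[OF assms, of "-1" t] by (simp_all add: add.commute)

lemma lborel_integral_shift:
  fixes f :: "'a::euclidean_space \<Rightarrow> 'b::{banach, second_countable_topology}"
  shows "(LINT x|lborel. f (t + x)) = (LINT x|lborel. f x)"
    and "(LINT x|lborel. f (x - t)) = (LINT x|lborel. f x)"
    and "(LINT x|lborel. f (t - x)) = (LINT x|lborel. f x)"
  using lborel_integral_affine[of 1 f t] lborel_integral_affine[of 1 f "-t"]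
    lborel_integral_affine[of "-1" f t] by (simp_all add: add.commute)

lemma lborel_integral_uminus:
  fixes f :: "'a::euclidean_space \<Rightarrow> 'b::{banach, second_countable_topology}"
  shows "(LINT x|lborel. f (- x)) = (LINT x|lborel. f x)"
  using lborel_integral_shift(3)[of f 0] by simp

lemma cutoff_exists:
  obtains \<theta> :: "real^'n::finite \<Rightarrow> real" where "\<theta> \<in> Cc_infinity UNIV" "\<And>x. 0 \<le> \<theta> x" "\<And>x. \<theta> x \<le> 1"
    "\<And>x. norm x \<le> 1 \<Longrightarrow> \<theta> x = 1" "\<And>x. norm x \<ge> 4 \<Longrightarrow> \<theta> x = 0"
proof -
  obtain \<eta> :: "real^'n \<Rightarrow> real" where \<eta>: "\<eta> \<in> Cc_infinity UNIV" "\<And>x. \<eta> x \<ge> 0"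
    "\<And>x. norm x \<ge> 1 \<Longrightarrow> \<eta> x = 0" "(LINT x|lborel. \<eta> x) = 1" using mollifier_exists[of 1] by auto
  \<comment> \<open>This radial profile is \<open>1\<close> up to radius \<open>2\<close> and
    \<open>0\<close> from radius \<open>3\<close> on. Mollifying at scale \<open>1\<close> leaves
    \<open>1\<close> on the unit ball and \<open>0\<close> from radius \<open>4\<close> on.\<close>
  define f where "f y = max 0 (min 1 (3 - norm y))" for y :: "real^'n"
  have f: "continuous_on UNIV f" unfolding f_def by (intro continuous_intros)
  note ci = conv_integrable[OF f \<eta>(1)]
  have i\<eta>: "integrable lborel (\<lambda>y. \<eta> (x - y))" for x
    using conv_integrable[where f="\<lambda>_. 1::real", OF _ \<eta>(1), of x] by simp
  have one: "(LINT y|lborel. \<eta> (x - y)) = 1" for x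
    using \<eta>(4) lborel_integral_shift(3)[of \<eta> x] by simp
  show ?thesis
  proof (rule that[of "conv f \<eta>"])
    show "conv f \<eta> \<in> Cc_infinity UNIV" by (rule conv_Cc[OF f _ \<eta>(1), where R=3]) (simp add: f_def)
    show "0 \<le> conv f \<eta> x" for x unfolding conv_def
      by (rule integral_nonneg_AE) (auto simp: f_def \<eta>)
    show "conv f \<eta> x \<le> 1" for x unfolding conv_def
      by (subst one[of x, symmetric], rule integral_mono[OF ci i\<eta>]) (auto simp: f_def intro!: mult_left_le \<eta>)
    show "conv f \<eta> x = 1" if "norm x \<le> 1" for x
    proof -
      have "\<eta> (x - y) *\<^sub>R f y = \<eta> (x - y)" for y
        using \<eta>(3)[of "x - y"] norm_triangle_ineq2[of y x] that
        by (cases "norm y \<le> 2") (auto simp: f_def norm_minus_commute)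
      then show ?thesis unfolding conv_def by (simp only: one)
    qed
    show "conv f \<eta> x = 0" if "norm x \<ge> 4" for x
      by (rule conv_support[where R=3 and S=1]) (use that \<eta> in \<open>auto simp: f_def\<close>)
  qed
qed

section \<open>Fourier inversion for test functions\<close>

text \<open>Lebesgue measure is the image of a product measure under coordinates, so integrands that
  factor reduce to one variable. This serves the Gaussian, its Fourier transform and the decay
  weight.\<close>

lemma lborel_prod_Basis:
  fixes f :: "'a::euclidean_space \<Rightarrow> real \<Rightarrow> 'b::{real_normed_field, banach, second_countable_topology}"
  assumes "\<And>b. b \<in> Basis \<Longrightarrow> integrable lborel (f b)"
  shows "integrable lborel (\<lambda>x. \<Prod>b\<in>Basis. f b (x \<bullet> b))"
    and "(LINT x|lborel. (\<Prod>b\<in>Basis. f b (x \<bullet> b))) = (\<Prod>b\<in>Basis. (LINT t|lborel. f b t))"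
proof -
  interpret product_sigma_finite "\<lambda>_::'a. lborel :: real measure" by standard
  have [measurable]: "f b \<in> borel_measurable borel" if "b \<in> Basis" for b
    using borel_measurable_integrable[OF assms[OF that]] by simp
  have m: "(\<lambda>x::'a. \<Prod>b\<in>Basis. f b (x \<bullet> b)) \<in> borel_measurable borel"
    by (intro borel_measurable_prod) measurable
  have d: "(\<lambda>f. \<Sum>b\<in>Basis. f b *\<^sub>R b) \<in> (\<Pi>\<^sub>M b\<in>Basis. lborel :: real measure) \<rightarrow>\<^sub>M (borel :: 'a measure)"
    by measurable
  have eq: "(\<Prod>b\<in>Basis. f b ((\<Sum>b\<in>Basis. (g b :: real) *\<^sub>R b) \<bullet> b)) = (\<Prod>b\<in>Basis. f b (g b))" for g
    by (intro prod.cong) auto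
  have "integrable (\<Pi>\<^sub>M b\<in>Basis. lborel) (\<lambda>g. \<Prod>b\<in>Basis. f b (g b))"
    by (rule product_integrable_prod) (auto intro: assms)
  then show "integrable lborel (\<lambda>x. \<Prod>b\<in>Basis. f b (x \<bullet> b))"
    by (subst lborel_eq, subst integrable_distr_eq[OF d m]) (simp add: eq)
  show "(LINT x|lborel. (\<Prod>b\<in>Basis. f b (x \<bullet> b))) = (\<Prod>b\<in>Basis. (LINT t|lborel. f b t))"
    by (subst lborel_eq, subst integral_distr[OF d m], simp only: eq)
       (rule product_integral_prod; simp add: assms)
qed

lemma norm_sq_Basis: "(norm x)\<^sup>2 = (\<Sum>b\<in>Basis. (x \<bullet> b)\<^sup>2)" for x :: "'a::euclidean_space"
  unfolding power2_norm_eq_inner by (subst euclidean_inner) (simp add: power2_eq_square)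

definition gaussian :: "'a::euclidean_space \<Rightarrow> real" where
  "gaussian x = (\<Prod>b\<in>Basis. std_normal_density (x \<bullet> b))"

lemma gaussian_eq: "gaussian x = (1 / sqrt (2 * pi)) ^ DIM('a) * exp (- (norm x)\<^sup>2 / 2)" for x :: "'a::euclidean_space"
proof -
  have "(\<Prod>b\<in>Basis. exp (- (x \<bullet> b)\<^sup>2 / 2)) = exp (\<Sum>b\<in>Basis. - (x \<bullet> b)\<^sup>2 / 2)"
    by (simp add: exp_sum)
  also have "(\<Sum>b\<in>Basis. - (x \<bullet> b)\<^sup>2 / 2) = - (norm x)\<^sup>2 / 2"
    by (simp add: norm_sq_Basis sum_negf sum_divide_distrib)
  finally show ?thesis
    by (simp only: gaussian_def std_normal_density_def prod.distrib prod_constant)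
qed

lemma gaussian_measurable[measurable]: "gaussian \<in> borel_measurable borel"
  unfolding gaussian_eq[abs_def] by measurable

lemma gaussian_nonneg: "gaussian x \<ge> 0"
  by (simp add: gaussian_eq)

lemma integrable_gaussian: "integrable lborel (gaussian :: 'a::euclidean_space \<Rightarrow> real)"
  unfolding gaussian_def[abs_def] by (rule lborel_prod_Basis) simp

lemma integral_gaussian: "(LINT x|lborel. gaussian (x :: 'a::euclidean_space)) = 1"
  unfolding gaussian_def[abs_def] by (subst lborel_prod_Basis) (simp_all add: integral_normal_density)

lemma cis_measurable[measurable]: "cis \<in> borel_measurable borel"
  by (intro borel_measurable_continuous_onI continuous_intros)

text \<open>In one variable this is the characteristic function of the standard normal distribution;
  the density and the character both factor over the coordinates.\<close>

lemma fourier_gaussian: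
  fixes y :: "'a::euclidean_space"
  shows "(LINT x|lborel. gaussian x *\<^sub>R cis (y \<bullet> x)) = complex_of_real (exp (- (norm y)\<^sup>2 / 2))"
proof -
  have 1: "gaussian x *\<^sub>R cis (y \<bullet> x) = (\<Prod>b\<in>Basis. std_normal_density (x \<bullet> b) *\<^sub>R cis ((y \<bullet> b) * (x \<bullet> b)))" for x
  proof -
    have "cis (y \<bullet> x) = (\<Prod>b\<in>Basis. cis ((y \<bullet> b) * (x \<bullet> b)))"
      by (simp add: euclidean_inner[of y x] cis_conv_exp exp_sum sum_distrib_left)
    then show ?thesis by (simp add: gaussian_def scaleR_conv_of_real prod.distrib)
  qed
  have int: "integrable lborel (\<lambda>t. std_normal_density t *\<^sub>R cis (s * t))" for s
    by (rule Bochner_Integration.integrable_bound[where f=std_normal_density]) auto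
  have ch: "(LINT t|lborel. std_normal_density t *\<^sub>R cis (s * t)) = complex_of_real (exp (- s\<^sup>2 / 2))" for s
  proof -
    have "(LINT t|lborel. std_normal_density t *\<^sub>R cis (s * t)) = char std_normal_distribution s"
      unfolding char_def by (subst integral_density) (auto simp: cis_conv_exp)
    then show ?thesis by (simp add: char_std_normal_distribution)
  qed
  have "(norm y)\<^sup>2 = (\<Sum>b\<in>Basis. (y \<bullet> b)\<^sup>2)" by (simp only: norm_sq_Basis)
  then show ?thesis
    unfolding 1 by (subst lborel_prod_Basis) (auto simp: int ch exp_sum[symmetric] sum_negf sum_divide_distrib simp flip: of_real_prod)
qed

lemma (in pair_sigma_finite) integrable_pair_bound:
  fixes F :: "'a \<times> 'b \<Rightarrow> 'c::{banach, second_countable_topology}"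
  assumes [measurable]: "F \<in> borel_measurable (M1 \<Otimes>\<^sub>M M2)" and f: "integrable M1 f" and g: "integrable M2 g"
    and le: "\<And>x y. norm (F (x, y)) \<le> f x * g y"
  shows "integrable (M1 \<Otimes>\<^sub>M M2) F"
proof (rule Bochner_Integration.integrable_bound[where f="\<lambda>(x,y). f x * g y"])
  note [measurable] = borel_measurable_integrable[OF f] borel_measurable_integrable[OF g]
  show "integrable (M1 \<Otimes>\<^sub>M M2) (\<lambda>(x,y). f x * g y)"
  proof (rule Fubini_integrable)
    show "(\<lambda>(x, y). f x * g y) \<in> borel_measurable (M1 \<Otimes>\<^sub>M M2)" by measurable
  qed (use f g in \<open>auto simp: abs_mult\<close>)
  show "AE x in M1 \<Otimes>\<^sub>M M2. norm (F x) \<le> norm (case x of (x, y) \<Rightarrow> f x * g y)"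
    using le by (auto intro!: AE_I2 order_trans[OF le])
qed simp

lemma (in pair_sigma_finite) integral_pair_mult:
  fixes f :: "'a \<Rightarrow> 'c::{real_normed_field, banach, second_countable_topology}"
  assumes f: "integrable M1 f" and g: "integrable M2 g"
  shows "integrable (M1 \<Otimes>\<^sub>M M2) (\<lambda>p. f (fst p) * g (snd p))"
    and "(\<integral>p. f (fst p) * g (snd p) \<partial>(M1 \<Otimes>\<^sub>M M2)) = (\<integral>x. f x \<partial>M1) * (\<integral>y. g y \<partial>M2)"
proof -
  note [measurable] = borel_measurable_integrable[OF f] borel_measurable_integrable[OF g]
  show *: "integrable (M1 \<Otimes>\<^sub>M M2) (\<lambda>p. f (fst p) * g (snd p))"
    by (rule integrable_pair_bound[where f="\<lambda>x. norm (f x)" and g="\<lambda>y. norm (g y)"])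
       (use f g in \<open>auto simp: norm_mult\<close>)
  have "(\<integral>x. (\<integral>y. f x * g y \<partial>M2) \<partial>M1) = (\<integral>p. f (fst p) * g (snd p) \<partial>(M1 \<Otimes>\<^sub>M M2))"
    using integral_fst'[OF *] by simp
  then show "(\<integral>p. f (fst p) * g (snd p) \<partial>(M1 \<Otimes>\<^sub>M M2)) = (\<integral>x. f x \<partial>M1) * (\<integral>y. g y \<partial>M2)"
    by simp
qed

text \<open>The sign in the exponent is that of the inverse transform, because the distribution is
  evaluated at the inverse transform of the test function. Accordingly the inversion formula below
  carries the minus sign.\<close>

definition hat :: "('a::euclidean_space \<Rightarrow> real) \<Rightarrow> 'a \<Rightarrow> complex" where
  "hat f \<xi> = (LINT x|lborel. f x *\<^sub>R cis (2 * pi * (x \<bullet> \<xi>)))"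

lemma integrable_cis:
  fixes f :: "'a::euclidean_space \<Rightarrow> real"
  assumes "integrable lborel f" "q \<in> borel_measurable borel"
  shows "integrable lborel (\<lambda>x. f x *\<^sub>R cis (q x))"
proof -
  note [measurable] = assms(2)
  have [measurable]: "f \<in> borel_measurable borel" using assms by auto
  show ?thesis by (rule Bochner_Integration.integrable_bound[OF assms(1)]) auto
qed

lemma hat_measurable[measurable]:
  assumes "integrable lborel f" shows "hat f \<in> borel_measurable borel"
proof -
  have [measurable]: "f \<in> borel_measurable borel" using assms by auto
  show ?thesis unfolding hat_def[abs_def] by measurable
qed

lemma hat_bound: "norm (hat f \<xi>) \<le> (LINT x|lborel. \<bar>f x\<bar>)"
  unfolding hat_def by (rule order_trans[OF integral_norm_bound]) simp

text \<open>The convolution of \<open>f\<close> with a character is a multiple of that character; its derivative at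
  \<open>0\<close> is computed in two ways.\<close>

lemma hat_pd:
  fixes f :: "real^'n::finite \<Rightarrow> real"
  assumes "f \<in> Cc_infinity UNIV"
  shows "hat (pd i f) \<xi> = - (2 * pi * (\<xi> $ i)) *\<^sub>R (\<i> * hat f \<xi>)"
proof -
  define g where "g y = cis (- (2 * pi * (y \<bullet> \<xi>)))" for y
  have g: "continuous_on UNIV g" unfolding g_def by (intro continuous_intros)
  have c: "conv g \<eta> x = g x * hat \<eta> \<xi>" for \<eta> x
  proof -
    have "conv g \<eta> x = (LINT z|lborel. \<eta> z *\<^sub>R g (x - z))"
      unfolding conv_def using lborel_integral_shift(3)[of "\<lambda>z. \<eta> z *\<^sub>R g (x - z)" x] by simp
    also have "(\<lambda>z. \<eta> z *\<^sub>R g (x - z)) = (\<lambda>z. g x * (\<eta> z *\<^sub>R cis (2 * pi * (z \<bullet> \<xi>))))"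
      by (auto simp: g_def cis_mult inner_diff_left right_diff_distrib)
    finally show ?thesis unfolding hat_def integral_mult_right_zero .
  qed
  have "((\<lambda>x. g x * hat f \<xi>) has_derivative (\<lambda>h. (- (2 * pi * (h \<bullet> \<xi>)) *\<^sub>R (\<i> * g 0)) * hat f \<xi>)) (at 0)"
    unfolding g_def by (auto intro!: derivative_eq_intros)
  then have "pd i (conv g f) 0 = (- (2 * pi * (axis i 1 \<bullet> \<xi>)) *\<^sub>R (\<i> * g 0)) * hat f \<xi>"
    unfolding c[abs_def] by (rule pd_eq)
  moreover have "pd i (conv g f) 0 = hat (pd i f) \<xi>"
    unfolding pd_conv[OF g assms] c by (simp add: g_def)
  ultimately show ?thesis by (simp add: inner_axis' g_def)
qed

text \<open>Passing from \<open>f\<close> to \<open>f - pd i (pd i f)\<close> multiplies the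
  transform by \<open>1 + (2 * pi * \<xi>_i)^2\<close>. It is done twice for each coordinate: one
  factor makes the bound integrable, the other absorbs the growth \<open>1 + |\<xi>|^2\<close> of
  the symbol.\<close>

lemma hat_decay_aux:
  fixes f :: "real^'n::finite \<Rightarrow> real"
  assumes "f \<in> Cc_infinity UNIV" "finite S"
  shows "\<exists>C. \<forall>\<xi>. norm (hat f \<xi>) * (\<Prod>i\<in>S. (1 + (2 * pi * (\<xi> $ i))\<^sup>2)\<^sup>2) \<le> C"
  using assms(2,1)
proof (induction S arbitrary: f rule: finite_induct)
  case empty
  then show ?case using hat_bound by auto
next
  case (insert i S)
  have *: "\<exists>g \<in> Cc_infinity UNIV. \<forall>\<xi>. hat g \<xi> = (1 + (2 * pi * (\<xi> $ i))\<^sup>2) *\<^sub>R hat f \<xi>" if f: "f \<in> Cc_infinity UNIV" for f :: "real^'n \<Rightarrow> real"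
  proof (intro bexI allI)
    fix \<xi>
    show g: "(\<lambda>x. f x - pd i (pd i f) x) \<in> Cc_infinity UNIV" by (intro Cc_diff pd_Cc f)
    have "hat (\<lambda>x. f x - pd i (pd i f) x) \<xi> = hat f \<xi> - hat (pd i (pd i f)) \<xi>"
      unfolding hat_def scaleR_diff_left
      by (intro Bochner_Integration.integral_diff integrable_cis Cc_integrable pd_Cc f) measurable
    also have "\<dots> = (1 + (2 * pi * (\<xi> $ i))\<^sup>2) *\<^sub>R hat f \<xi>"
      by (simp add: hat_pd pd_Cc f algebra_simps power2_eq_square scaleR_add_left)
    finally show "hat (\<lambda>x. f x - pd i (pd i f) x) \<xi> = (1 + (2 * pi * (\<xi> $ i))\<^sup>2) *\<^sub>R hat f \<xi>" .
  qed
  obtain g where g: "g \<in> Cc_infinity UNIV" "\<And>\<xi>. hat g \<xi> = (1 + (2 * pi * (\<xi> $ i))\<^sup>2) *\<^sub>R hat f \<xi>"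
    using *[OF insert.prems] by blast
  obtain h where h: "h \<in> Cc_infinity UNIV" "\<And>\<xi>. hat h \<xi> = (1 + (2 * pi * (\<xi> $ i))\<^sup>2) *\<^sub>R hat g \<xi>"
    using *[OF g(1)] by blast
  have "norm (hat h \<xi>) = (1 + (2 * pi * (\<xi> $ i))\<^sup>2)\<^sup>2 * norm (hat f \<xi>)" for \<xi>
    by (simp add: h g power2_eq_square)
  then show ?case using insert.IH[OF h(1)] insert.hyps by (simp add: mult_ac)
qed

definition weight :: "real^'n::finite \<Rightarrow> real" where
  "weight \<xi> = (\<Prod>i\<in>UNIV. inverse (1 + (2 * pi * (\<xi> $ i))\<^sup>2))"

lemma Basis_vec_eq: "(Basis :: (real^'n::finite) set) = range (\<lambda>i. axis i 1)"
  by (auto simp: Basis_vec_def)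

lemma integrable_weight: "integrable lborel (weight :: real^'n::finite \<Rightarrow> real)"
proof -
  have "integrable lborel (\<lambda>x. inverse (1 + x\<^sup>2) :: real)"
    using integrable_inverse_1_plus_square by (simp add: set_integrable_def)
  then have "integrable lborel (\<lambda>x. inverse (1 + (2 * pi * x)\<^sup>2) :: real)"
    using lborel_integrable_real_affine[of "\<lambda>x. inverse (1 + x\<^sup>2) :: real" "2 * pi" 0] by simp
  then have "integrable lborel (\<lambda>x::real^'n. \<Prod>b\<in>Basis. inverse (1 + (2 * pi * (x \<bullet> b))\<^sup>2))"
    by (intro lborel_prod_Basis(1)[where f="\<lambda>_ x. inverse (1 + (2 * pi * x)\<^sup>2)"])
  also have "(\<lambda>x::real^'n. \<Prod>b\<in>Basis. inverse (1 + (2 * pi * (x \<bullet> b))\<^sup>2)) = weight"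
    unfolding Basis_vec_eq weight_def
    by (subst prod.reindex) (auto simp: inj_on_def axis_eq_axis inner_axis)
  finally show ?thesis .
qed

text \<open>Expanding the product gives nonnegative terms, among them \<open>1\<close> and all the
  squares; the factor \<open>2 * pi\<close>, being at least \<open>1\<close>, may be
  dropped.\<close>

lemma one_plus_norm_le_prod: "1 + (norm \<xi>)\<^sup>2 \<le> (\<Prod>i\<in>UNIV. 1 + (2 * pi * (\<xi> $ i))\<^sup>2)" for \<xi> :: "real^'n::finite"
proof -
  have "1 + (\<Sum>i\<in>S. (\<xi> $ i)\<^sup>2) \<le> (\<Prod>i\<in>S. 1 + (2 * pi * (\<xi> $ i))\<^sup>2)" if "finite S" for S
    using that
  proof induction
    case (insert i S)
    have "(\<xi> $ i)\<^sup>2 \<le> (2 * pi * (\<xi> $ i))\<^sup>2"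
    proof -
      have "1 \<le> (2 * pi)\<^sup>2" using pi_gt3 by (intro one_le_power) simp
      then show ?thesis
        using mult_right_mono[of 1 "(2 * pi)\<^sup>2" "(\<xi> $ i)\<^sup>2"] by (simp only: power_mult_distrib) simp
    qed
    then have "(1 + (\<xi> $ i)\<^sup>2) * (1 + (\<Sum>i\<in>S. (\<xi> $ i)\<^sup>2)) \<le> (1 + (2 * pi * (\<xi> $ i))\<^sup>2) * (\<Prod>i\<in>S. 1 + (2 * pi * (\<xi> $ i))\<^sup>2)"
      by (intro mult_mono insert.IH) (auto intro!: add_nonneg_nonneg sum_nonneg)
    moreover have "1 + (\<Sum>i\<in>insert i S. (\<xi> $ i)\<^sup>2) \<le> (1 + (\<xi> $ i)\<^sup>2) * (1 + (\<Sum>i\<in>S. (\<xi> $ i)\<^sup>2))"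
      using insert.hyps by (simp add: algebra_simps sum_nonneg)
    ultimately show ?case using insert.hyps by simp
  qed simp
  moreover have "(norm \<xi>)\<^sup>2 = (\<Sum>i\<in>UNIV. (\<xi> $ i)\<^sup>2)"
    unfolding power2_norm_eq_inner inner_vec_def by (simp add: power2_eq_square)
  ultimately show ?thesis by simp
qed

lemma hat_decay:
  fixes f :: "real^'n::finite \<Rightarrow> real"
  assumes "f \<in> Cc_infinity UNIV"
  obtains C where "\<And>\<xi>. norm (hat f \<xi>) * (1 + (norm \<xi>)\<^sup>2) \<le> C * weight \<xi>"
proof -
  obtain C where C: "\<And>\<xi>. norm (hat f \<xi>) * (\<Prod>i\<in>UNIV. (1 + (2 * pi * (\<xi> $ i))\<^sup>2)\<^sup>2) \<le> C"
    using hat_decay_aux[OF assms, of UNIV] by auto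
  show ?thesis
  proof (rule that[of C])
    fix \<xi> :: "real^'n"
    define P where "P = (\<Prod>i\<in>UNIV. 1 + (2 * pi * (\<xi> $ i))\<^sup>2)"
    have P: "P > 0" unfolding P_def by (intro prod_pos) (auto intro: add_pos_nonneg)
    have "norm (hat f \<xi>) * (1 + (norm \<xi>)\<^sup>2) \<le> norm (hat f \<xi>) * P"
      unfolding P_def by (intro mult_left_mono one_plus_norm_le_prod) auto
    also have "\<dots> = norm (hat f \<xi>) * (\<Prod>i\<in>UNIV. (1 + (2 * pi * (\<xi> $ i))\<^sup>2)\<^sup>2) * weight \<xi>"
    proof -
      have "weight \<xi> = inverse P" by (simp add: weight_def P_def prod_inversef[symmetric] o_def)
      moreover have "(\<Prod>i\<in>UNIV. (1 + (2 * pi * (\<xi> $ i))\<^sup>2)\<^sup>2) = P\<^sup>2"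
        unfolding P_def prod_power_distrib ..
      ultimately show ?thesis using P by (simp add: power2_eq_square)
    qed
    also have "\<dots> \<le> C * weight \<xi>"
      by (intro mult_right_mono C) (auto simp: weight_def intro!: prod_nonneg)
    finally show "norm (hat f \<xi>) * (1 + (norm \<xi>)\<^sup>2) \<le> C * weight \<xi>" .
  qed
qed

text \<open>The weight \<open>1 + |\<xi>|^2\<close> is the one needed in \<open>L_fourier\<close>,
  where two factors growing at most linearly in \<open>\<xi>\<close> multiply the transform.\<close>

lemma integrable_hat:
  fixes f :: "real^'n::finite \<Rightarrow> real"
  assumes f: "f \<in> Cc_infinity UNIV"
  shows "integrable lborel (\<lambda>\<xi>. (1 + (norm \<xi>)\<^sup>2) * norm (hat f \<xi>))" "integrable lborel (hat f)"
proof -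
  note [measurable] = hat_measurable[OF Cc_integrable[OF f]]
  obtain C where C: "\<And>\<xi>. norm (hat f \<xi>) * (1 + (norm \<xi>)\<^sup>2) \<le> C * weight \<xi>"
    using hat_decay[OF f] by blast
  show *: "integrable lborel (\<lambda>\<xi>. (1 + (norm \<xi>)\<^sup>2) * norm (hat f \<xi>))"
  proof (rule Bochner_Integration.integrable_bound[where f="\<lambda>\<xi>. C * weight \<xi>"])
    show "integrable lborel (\<lambda>\<xi>. C * weight \<xi>)" by (intro integrable_mult_right integrable_weight)
    show "AE \<xi> in lborel. norm ((1 + (norm \<xi>)\<^sup>2) * norm (hat f \<xi>)) \<le> norm (C * weight \<xi>)"
    proof (rule AE_I2)
      fix \<xi>
      have "norm ((1 + (norm \<xi>)\<^sup>2) * norm (hat f \<xi>)) = norm (hat f \<xi>) * (1 + (norm \<xi>)\<^sup>2)" by (simp add: abs_mult)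
      also note C[of \<xi>]
      also have "C * weight \<xi> \<le> norm (C * weight \<xi>)" by (simp only: real_norm_def abs_ge_self)
      finally show "norm ((1 + (norm \<xi>)\<^sup>2) * norm (hat f \<xi>)) \<le> norm (C * weight \<xi>)" .
    qed
  qed measurable
  show "integrable lborel (hat f)"
    by (rule Bochner_Integration.integrable_bound[OF *]) (auto simp: abs_mult mult_le_cancel_right1)
qed

text \<open>A Gaussian damping factor makes Fubini applicable. The inner integral then is a Gaussian
  of width \<open>a\<close> around \<open>x\<close>, an approximate identity, and both sides
  converge as \<open>a\<close> tends to \<open>0\<close> by dominated convergence.\<close>

theorem fourier_inversion:
  fixes f :: "real^'n::finite \<Rightarrow> real"
  assumes f: "f \<in> Cc_infinity UNIV"
  shows "(LINT \<xi>|lborel. cis (- (2 * pi * (x \<bullet> \<xi>))) * hat f \<xi>) = complex_of_real (f x)"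
proof -
  let ?n = "CARD('n)"
  note fi = Cc_integrable[OF f]
  note [measurable] = hat_measurable[OF fi]
  have [measurable]: "f \<in> borel_measurable borel" using fi by auto
  \<comment> \<open>\<open>N\<close> converts the probability density into
    \<open>exp (- |x|^2 / 2)\<close>. It occurs once for the damping factor and once for its
    transform, and \<open>N * N\<close> cancels the powers of \<open>2 * pi\<close> from the change
    of variables.\<close>
  define N where "N = sqrt (2 * pi) ^ ?n"
  have N: "exp (- (norm x)\<^sup>2 / 2) = N * gaussian x" for x :: "real^'n"
    by (simp add: N_def gaussian_eq power_divide)
  have NN: "N * N = (2 * pi) ^ ?n" unfolding N_def power_mult_distrib[symmetric] by simp
  define E where "E a \<xi> = exp (- (norm ((2 * pi * a) *\<^sub>R \<xi>))\<^sup>2 / 2)" for a and \<xi> :: "real^'n"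
  have [measurable]: "E a \<in> borel_measurable borel" for a unfolding E_def by measurable
  have Eint: "integrable lborel (E a)" if "a > 0" for a
  proof -
    have "integrable lborel (\<lambda>\<xi>::real^'n. N * gaussian (0 + (2 * pi * a) *\<^sub>R \<xi>))"
      using that by (intro integrable_mult_right lborel_integrable_affine integrable_gaussian) auto
    then show ?thesis by (simp only: E_def[abs_def] N add_0)
  qed
  have G: "(LINT \<xi>|lborel. E a \<xi> *\<^sub>R cis (2 * pi * (w \<bullet> \<xi>))) = complex_of_real (inverse (a ^ ?n) * gaussian (w /\<^sub>R a))" if a: "a > 0" for a w
  proof -
    define c where "c = 2 * pi * a"
    have c: "c > 0" using a by (simp add: c_def)
    have "(LINT \<xi>|lborel. E a \<xi> *\<^sub>R cis (2 * pi * (w \<bullet> \<xi>))) = (LINT \<xi>|lborel. (\<lambda>\<eta>. N *\<^sub>R (gaussian \<eta> *\<^sub>R cis ((w /\<^sub>R a) \<bullet> \<eta>))) (0 + c *\<^sub>R \<xi>))"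
    proof (intro Bochner_Integration.integral_cong refl)
      fix \<xi>
      have "(w /\<^sub>R a) \<bullet> (0 + c *\<^sub>R \<xi>) = 2 * pi * (w \<bullet> \<xi>)" using a by (simp add: c_def)
      moreover have "E a \<xi> = N * gaussian (0 + c *\<^sub>R \<xi>)" by (simp only: E_def N c_def add_0)
      ultimately show "E a \<xi> *\<^sub>R cis (2 * pi * (w \<bullet> \<xi>)) = (\<lambda>\<eta>. N *\<^sub>R (gaussian \<eta> *\<^sub>R cis ((w /\<^sub>R a) \<bullet> \<eta>))) (0 + c *\<^sub>R \<xi>)"
        by (simp only: scaleR_scaleR)
    qed
    also have "\<dots> = (1 / c ^ ?n) *\<^sub>R (N *\<^sub>R complex_of_real (exp (- (norm (w /\<^sub>R a))\<^sup>2 / 2)))"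
      using c by (subst lborel_integral_affine) (simp_all only: integral_scaleR_right fourier_gaussian DIM_cart DIM_real, simp_all)
    also have "\<dots> = complex_of_real (N * N / c ^ ?n * gaussian (w /\<^sub>R a))"
      unfolding N by (simp add: scaleR_conv_of_real)
    also have "N * N / c ^ ?n = inverse (a ^ ?n)" using a by (simp add: NN c_def power_mult_distrib field_simps)
    finally show ?thesis .
  qed
  \<comment> \<open>For fixed \<open>a\<close> the damped inversion integral is the average of
    \<open>f\<close> over Gaussian displacements of size \<open>a\<close> from
    \<open>x\<close>.\<close>
  have I: "(LINT \<xi>|lborel. E a \<xi> *\<^sub>R (cis (- (2 * pi * (x \<bullet> \<xi>))) * hat f \<xi>)) = complex_of_real (LINT z|lborel. f (x + a *\<^sub>R z) * gaussian z)"
    if a: "a > 0" for a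
  proof -
    let ?F = "\<lambda>\<xi> y. (E a \<xi> * f y) *\<^sub>R cis (2 * pi * ((y - x) \<bullet> \<xi>))"
    have F: "integrable (lborel \<Otimes>\<^sub>M lborel) (case_prod ?F)"
    proof (rule lborel_pair.integrable_pair_bound[where f="E a" and g="\<lambda>y. \<bar>f y\<bar>"])
      show "case_prod ?F \<in> borel_measurable (lborel \<Otimes>\<^sub>M lborel)" by measurable
      show "integrable lborel (E a)" by (rule Eint[OF a])
    qed (use fi in \<open>auto simp: E_def abs_mult\<close>)
    have "(LINT \<xi>|lborel. E a \<xi> *\<^sub>R (cis (- (2 * pi * (x \<bullet> \<xi>))) * hat f \<xi>)) = (LINT \<xi>|lborel. LINT y|lborel. ?F \<xi> y)"
    proof (intro Bochner_Integration.integral_cong refl)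
      fix \<xi>
      have eq: "?F \<xi> y = E a \<xi> *\<^sub>R (cis (- (2 * pi * (x \<bullet> \<xi>))) * (f y *\<^sub>R cis (2 * pi * (y \<bullet> \<xi>))))" for y
        by (simp add: cis_mult inner_diff_left right_diff_distrib)
      show "E a \<xi> *\<^sub>R (cis (- (2 * pi * (x \<bullet> \<xi>))) * hat f \<xi>) = (LINT y|lborel. ?F \<xi> y)"
        unfolding eq hat_def integral_scaleR_right integral_mult_right_zero ..
    qed
    also have "\<dots> = (LINT y|lborel. LINT \<xi>|lborel. ?F \<xi> y)"
      using lborel_pair.Fubini_integral[OF F] by simp
    also have "\<dots> = (LINT y|lborel. complex_of_real (f y * (inverse (a ^ ?n) * gaussian ((y - x) /\<^sub>R a))))"
    proof (intro Bochner_Integration.integral_cong refl)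
      fix y
      have eq: "?F \<xi> y = f y *\<^sub>R (E a \<xi> *\<^sub>R cis (2 * pi * ((y - x) \<bullet> \<xi>)))" for \<xi> by simp
      show "(LINT \<xi>|lborel. ?F \<xi> y) = complex_of_real (f y * (inverse (a ^ ?n) * gaussian ((y - x) /\<^sub>R a)))"
        unfolding eq integral_scaleR_right G[OF a] by (simp add: scaleR_conv_of_real)
    qed
    also have "\<dots> = complex_of_real (LINT y|lborel. f y * (inverse (a ^ ?n) * gaussian ((y - x) /\<^sub>R a)))"
      by (rule integral_complex_of_real)
    also have "(LINT y|lborel. f y * (inverse (a ^ ?n) * gaussian ((y - x) /\<^sub>R a))) = (LINT z|lborel. f (x + a *\<^sub>R z) * gaussian z)"
    proof -
      have "(LINT z|lborel. f (x + a *\<^sub>R z) * gaussian z) = (LINT z|lborel. (\<lambda>y. f y * gaussian ((y - x) /\<^sub>R a)) (x + a *\<^sub>R z))"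
        using a by simp
      also have "\<dots> = inverse (a ^ ?n) * (LINT y|lborel. f y * gaussian ((y - x) /\<^sub>R a))"
        using a by (subst lborel_integral_affine) (auto simp: field_simps)
      also have "\<dots> = (LINT y|lborel. inverse (a ^ ?n) * (f y * gaussian ((y - x) /\<^sub>R a)))"
        by simp
      finally show ?thesis by (simp add: mult_ac)
    qed
    finally show ?thesis .
  qed
  define a where "a k = inverse (real (Suc k))" for k
  have a: "a k > 0" for k by (simp add: a_def)
  have a0: "a \<longlonglongrightarrow> 0" unfolding a_def by (rule LIMSEQ_inverse_real_of_nat)
  have 1: "(\<lambda>k. LINT \<xi>|lborel. E (a k) \<xi> *\<^sub>R (cis (- (2 * pi * (x \<bullet> \<xi>))) * hat f \<xi>)) \<longlonglongrightarrow> (LINT \<xi>|lborel. cis (- (2 * pi * (x \<bullet> \<xi>))) * hat f \<xi>)"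
  proof (rule integral_dominated_convergence[where w="\<lambda>\<xi>. norm (hat f \<xi>)"])
    show "integrable lborel (\<lambda>\<xi>. norm (hat f \<xi>))" using integrable_hat[OF f] by simp
    have "(\<lambda>k. E (a k) \<xi>) \<longlonglongrightarrow> exp (- (norm ((2 * pi * 0) *\<^sub>R \<xi>))\<^sup>2 / 2)" for \<xi>
      unfolding E_def by (intro tendsto_intros a0) simp
    then have "(\<lambda>k. E (a k) \<xi> *\<^sub>R (cis (- (2 * pi * (x \<bullet> \<xi>))) * hat f \<xi>)) \<longlonglongrightarrow> 1 *\<^sub>R (cis (- (2 * pi * (x \<bullet> \<xi>))) * hat f \<xi>)" for \<xi>
      by (intro tendsto_intros) simp
    then show "AE \<xi> in lborel. (\<lambda>k. E (a k) \<xi> *\<^sub>R (cis (- (2 * pi * (x \<bullet> \<xi>))) * hat f \<xi>)) \<longlonglongrightarrow> cis (- (2 * pi * (x \<bullet> \<xi>))) * hat f \<xi>"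
      by simp
    show "AE \<xi> in lborel. norm (E (a k) \<xi> *\<^sub>R (cis (- (2 * pi * (x \<bullet> \<xi>))) * hat f \<xi>)) \<le> norm (hat f \<xi>)" for k
      by (auto simp: norm_mult E_def mult_left_le_one_le)
  qed measurable
  obtain B where B: "\<And>x. norm (f x) \<le> B" using Cc_bounded[OF f] by blast
  have 2: "(\<lambda>k. LINT z|lborel. f (x + a k *\<^sub>R z) * gaussian z) \<longlonglongrightarrow> (LINT z|lborel. f x * gaussian (z::real^'n))"
  proof (rule integral_dominated_convergence[where w="\<lambda>z::real^'n. B * gaussian z"])
    show "integrable lborel (\<lambda>z::real^'n. B * gaussian z)" by (intro integrable_mult_right integrable_gaussian)
    have "isCont f x" using Cc_continuous[OF f] by (simp add: continuous_on_eq_continuous_at)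
    moreover have "(\<lambda>k. x + a k *\<^sub>R z) \<longlonglongrightarrow> x" for z
      using tendsto_add[OF tendsto_const tendsto_scaleR[OF a0 tendsto_const], of x z] by simp
    ultimately have "(\<lambda>k. f (x + a k *\<^sub>R z)) \<longlonglongrightarrow> f x" for z by (rule isCont_tendsto_compose)
    then show "AE z in lborel. (\<lambda>k. f (x + a k *\<^sub>R z) * gaussian z) \<longlonglongrightarrow> f x * gaussian z"
      by (auto intro!: tendsto_intros)
    show "AE z in lborel. norm (f (x + a k *\<^sub>R z) * gaussian z) \<le> B * gaussian z" for k
      using B by (auto simp: abs_mult gaussian_nonneg intro!: mult_right_mono)
  qed measurable
  then have "(\<lambda>k. complex_of_real (LINT z|lborel. f (x + a k *\<^sub>R z) * gaussian z)) \<longlonglongrightarrow> complex_of_real (f x)"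
    using integral_gaussian[where 'a="real^'n"] by (intro tendsto_of_real) simp
  with 1 show ?thesis unfolding I[OF a] by (rule LIMSEQ_unique)
qed

section \<open>The kernel and its Fourier symbol\<close>

lemma orthogonal_transformation_measurable:
  fixes T :: "'a::euclidean_space \<Rightarrow> 'a"
  assumes "orthogonal_transformation T"
  shows "T \<in> borel_measurable borel"
proof -
  have "bounded_linear T" using orthogonal_transformation_linear[OF assms] by (simp add: linear_conv_bounded_linear)
  then show ?thesis by (intro borel_measurable_continuous_onI linear_continuous_on)
qed

text \<open>Uniqueness of translation invariant measures: exchanging the roles of \<open>f\<close> and the indicator
  of the unit ball in a double integral determines the constant.\<close>

lemma nn_integral_lborel_orthogonal:
  fixes T :: "'a::euclidean_space \<Rightarrow> 'a" and f :: "'a \<Rightarrow> ennreal"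
  assumes T: "orthogonal_transformation T" and [measurable]: "f \<in> borel_measurable borel"
  shows "(\<integral>\<^sup>+x. f (T x) \<partial>lborel) = (\<integral>\<^sup>+x. f x \<partial>lborel)"
proof -
  note [measurable] = orthogonal_transformation_measurable[OF T]
  have lT: "linear T" by (rule orthogonal_transformation_linear[OF T])
  have surj: "T (inv T y) = y" for y using orthogonal_transformation_surj[OF T] by (simp add: surj_f_inv_f)
  define g :: "'a \<Rightarrow> ennreal" where "g = indicator (ball 0 1)"
  have [measurable]: "g \<in> borel_measurable borel"
    unfolding g_def by (intro borel_measurable_indicator borel_open open_ball)
  have "(\<integral>\<^sup>+x. f (T x) \<partial>lborel) * (\<integral>\<^sup>+y. g y \<partial>lborel) = (\<integral>\<^sup>+x. (\<integral>\<^sup>+y. f (T x) * g y \<partial>lborel) \<partial>lborel)"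
    by (simp add: nn_integral_cmult nn_integral_multc)
  also have "\<dots> = (\<integral>\<^sup>+x. (\<integral>\<^sup>+y. f (T x) * g (y - T x) \<partial>lborel) \<partial>lborel)"
  proof (rule nn_integral_cong)
    fix x
    show "(\<integral>\<^sup>+y. f (T x) * g y \<partial>lborel) = (\<integral>\<^sup>+y. f (T x) * g (y - T x) \<partial>lborel)"
      by (rule nn_integral_lborel_shift(2)[symmetric, of "\<lambda>y. f (T x) * g y"]) measurable
  qed
  also have "\<dots> = (\<integral>\<^sup>+y. (\<integral>\<^sup>+x. f (T x) * g (y - T x) \<partial>lborel) \<partial>lborel)"
    by (rule lborel_pair.Fubini') measurable
  \<comment> \<open>The substitution of \<open>inv T y - x\<close> for \<open>x\<close> exchanges
    \<open>T x\<close> and \<open>y - T x\<close>, by linearity of \<open>T\<close>.\<close>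
  also have "\<dots> = (\<integral>\<^sup>+y. (\<integral>\<^sup>+x. f (y - T x) * g (T x) \<partial>lborel) \<partial>lborel)"
  proof (rule nn_integral_cong)
    fix y
    have "(\<integral>\<^sup>+x. f (T x) * g (y - T x) \<partial>lborel) = (\<integral>\<^sup>+x. f (T (inv T y - x)) * g (y - T (inv T y - x)) \<partial>lborel)"
      by (rule nn_integral_lborel_shift(3)[symmetric]) measurable
    then show "(\<integral>\<^sup>+x. f (T x) * g (y - T x) \<partial>lborel) = (\<integral>\<^sup>+x. f (y - T x) * g (T x) \<partial>lborel)"
      by (simp add: linear_diff[OF lT] surj)
  qed
  also have "\<dots> = (\<integral>\<^sup>+x. (\<integral>\<^sup>+y. f (y - T x) * g (T x) \<partial>lborel) \<partial>lborel)"
    by (rule lborel_pair.Fubini'[symmetric]) measurable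
  also have "\<dots> = (\<integral>\<^sup>+x. f x \<partial>lborel) * (\<integral>\<^sup>+x. g (T x) \<partial>lborel)"
    by (simp add: nn_integral_multc nn_integral_lborel_shift(2) nn_integral_cmult)
  also have "(\<lambda>x. g (T x)) = g"
    by (auto simp: g_def indicator_def orthogonal_transformation_norm[OF T] fun_eq_iff)
  finally have eq: "(\<integral>\<^sup>+x. f (T x) \<partial>lborel) * emeasure lborel (ball (0::'a) 1) = (\<integral>\<^sup>+x. f x \<partial>lborel) * emeasure lborel (ball (0::'a) 1)"
    by (simp add: g_def)
  \<comment> \<open>The common factor, the measure of the unit ball, is to be cancelled in extended
    reals, so it has to be nonzero as well as finite. If it were zero, the closed complement would
    have full measure and contain \<open>0\<close>.\<close>
  have *: "\<not> (AE x in lborel. x \<in> - ball (0::'a) 1)"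
  proof
    assume "AE x in lborel. x \<in> - ball (0::'a) 1"
    then have "AE x in lebesgue. x \<in> - ball (0::'a) 1" by (rule AE_completion)
    then have "0 \<in> - ball (0::'a) 1" by (intro mem_closed_if_AE_lebesgue) auto
    then show False by simp
  qed
  have "emeasure lborel (ball (0::'a) 1) \<noteq> 0"
  proof -
    have "{x \<in> space lborel. \<not> x \<in> - ball (0::'a) 1} = ball 0 1" by auto
    then show ?thesis using AE_iff_measurable[of "ball (0::'a) 1" lborel "\<lambda>x. x \<in> - ball 0 1"] * by simp
  qed
  moreover have "emeasure lborel (ball (0::'a) 1) \<noteq> \<infinity>" using emeasure_lborel_ball_finite[of "0::'a" 1] by auto
  ultimately show ?thesis using arg_cong[OF eq, of "\<lambda>z. z / emeasure lborel (ball (0::'a) 1)"]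
    by (simp add: mult_divide_eq_ennreal)
qed

lemma orthogonal_distr_lborel:
  fixes T :: "'a::euclidean_space \<Rightarrow> 'a"
  assumes T: "orthogonal_transformation T"
  shows "distr lborel borel T = lborel"
proof (rule measure_eqI)
  note [measurable] = orthogonal_transformation_measurable[OF T]
  fix A assume "A \<in> sets (distr lborel borel T)"
  then have [measurable]: "A \<in> sets borel" by simp
  have "emeasure (distr lborel borel T) A = (\<integral>\<^sup>+x. indicator A x \<partial>distr lborel borel T)"
    by simp
  also have "\<dots> = (\<integral>\<^sup>+x. indicator A (T x) \<partial>lborel)" by (rule nn_integral_distr) measurable
  also have "\<dots> = (\<integral>\<^sup>+x. indicator A x \<partial>lborel)" by (rule nn_integral_lborel_orthogonal[OF T]) measurable
  finally show "emeasure (distr lborel borel T) A = emeasure lborel A" by simp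
qed simp

lemma norm_one_minus_cis: "norm (1 - cis t) \<le> \<bar>t\<bar>"
proof -
  have "norm (cis t - cis 0) \<le> 1 * norm (t - 0)"
    by (rule differentiable_bound[OF convex_UNIV, where f'="\<lambda>x t. t *\<^sub>R (\<i> * cis x)"])
       (auto intro!: derivative_eq_intros onorm_le simp: norm_mult)
  then show ?thesis by (simp add: norm_minus_commute)
qed

section \<open>Second differences at the origin\<close>

definition D2 :: "('a::real_normed_vector \<Rightarrow> real) \<Rightarrow> 'a \<Rightarrow> 'a \<Rightarrow> real" where
  "D2 f h k = f 0 - f h - f k + f (h + k)"

text \<open>The bounds by \<open>1\<close>, \<open>norm h\<close>, \<open>norm k\<close> and
  \<open>norm h * norm k\<close> are exactly the four cases of the two minima. The constant
  \<open>M\<close> is left free so that it can be shared by a whole family of functions.\<close>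

lemma D2_bound:
  fixes f :: "'a::real_normed_vector \<Rightarrow> real"
  assumes "\<And>x. \<bar>f x\<bar> \<le> A" "\<And>x y. \<bar>f x - f y\<bar> \<le> B * norm (x - y)" "\<bar>D2 f h k\<bar> \<le> C * norm h * norm k"
    and "4 * A \<le> M" "2 * B \<le> M" "C \<le> M"
  shows "\<bar>D2 f h k\<bar> \<le> M * min 1 (norm h) * min 1 (norm k)"
proof -
  have 1: "\<bar>D2 f h k\<bar> \<le> M"
    using assms(1)[of 0] assms(1)[of h] assms(1)[of k] assms(1)[of "h + k"] assms(4) by (simp add: D2_def)
  have 2: "\<bar>D2 f h k\<bar> \<le> M * norm h"
    using assms(2)[of 0 h] assms(2)[of "h + k" k] mult_right_mono[OF assms(5), of "norm h"] by (simp add: D2_def)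
  have 3: "\<bar>D2 f h k\<bar> \<le> M * norm k"
    using assms(2)[of 0 k] assms(2)[of "h + k" h] mult_right_mono[OF assms(5), of "norm k"] by (simp add: D2_def)
  have 4: "\<bar>D2 f h k\<bar> \<le> M * norm h * norm k"
    using assms(3) mult_right_mono[OF assms(6), of "norm h * norm k"] by (simp add: mult.assoc)
  show ?thesis using 1 2 3 4 by (auto simp: min_def)
qed

lemma Cc_D2:
  fixes f :: "real^'n::finite \<Rightarrow> real"
  assumes "f \<in> Cc_infinity UNIV"
  obtains M where "\<And>h k. \<bar>D2 f h k\<bar> \<le> M * min 1 (norm h) * min 1 (norm k)"
proof -
  obtain A where A: "\<And>x. \<bar>f x\<bar> \<le> A" using Cc_bounded[OF assms] by (metis real_norm_def)
  obtain B where B: "\<And>x y. \<bar>f x - f y\<bar> \<le> B * norm (x - y)" using Cc_lipschitz[OF assms] by (metis real_norm_def)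
  obtain C where C: "\<And>x h k. norm (f x - f (x + h) - f (x + k) + f (x + h + k)) \<le> C * norm h * norm k"
    using Cc_second_difference[OF assms] by metis
  show ?thesis
  proof (rule that)
    show "\<bar>D2 f h k\<bar> \<le> max (4 * A) (max (2 * B) C) * min 1 (norm h) * min 1 (norm k)" for h k
      by (rule D2_bound[OF A B, where C=C]) (use C[of 0 h k] in \<open>auto simp: D2_def\<close>)
  qed
qed

text \<open>Describes a Borel version of a radial kernel. Sign and evenness can be arranged at every
  point, but rotation invariance survives only almost everywhere, with a null set that may depend on
  the rotation.\<close>

locale even_kernel =
  fixes r :: "real^'n::finite \<Rightarrow> real"
  assumes r_measurable[measurable]: "r \<in> borel_measurable borel"
    and r_nonneg: "r h \<ge> 0"
    and r_even: "r (- h) = r h"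
    and r_rot: "orthogonal_transformation (T :: real^'n \<Rightarrow> real^'n) \<Longrightarrow> AE h in lborel. r (T h) = r h"
    and integrable_kappa: "integrable lborel (\<lambda>h. min 1 (inverse (norm h)) * r h)"
begin

definition kappa :: "real^'n \<Rightarrow> real" where "kappa h = min 1 (inverse (norm h)) * r h"

definition b :: "real^'n \<Rightarrow> real^'n" where "b h = (r h / (norm h)\<^sup>2) *\<^sub>R h"

lemma kappa_integrable: "integrable lborel kappa"
  using integrable_kappa by (simp add: kappa_def[abs_def])

lemma kappa_nonneg: "kappa h \<ge> 0" by (simp add: kappa_def r_nonneg)

lemma b_measurable[measurable]: "b \<in> borel_measurable borel"
  unfolding b_def[abs_def] by measurable

lemma b_nth_measurable[measurable]: "(\<lambda>h. b h $ j) \<in> borel_measurable borel"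
proof -
  have "(\<lambda>h. b h $ j) = (\<lambda>h. b h \<bullet> axis j 1)" by (simp add: cart_eq_inner_axis)
  then show ?thesis by simp
qed

lemma b_odd: "b (- h) = - b h" by (simp add: b_def r_even)

text \<open>This identity is why the integrability hypothesis on the kernel is the natural one: a
  factor \<open>min 1 (norm h)\<close> from an increment turns the singular field \<open>b\<close>
  into the integrable \<open>kappa\<close>. At \<open>h = 0\<close> both sides are \<open>0\<close>,
  since \<open>inverse 0 = 0\<close>.\<close>

lemma b_bound: "min 1 (norm h) * norm (b h) = kappa h"
proof (cases "h = 0")
  case False
  have "norm (b h) = r h / norm h" using False by (simp add: b_def r_nonneg power2_eq_square)
  then show ?thesis using False r_nonneg[of h]
    by (auto simp: kappa_def min_def field_simps)
qed (auto simp: b_def kappa_def)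

lemma b_boundI:
  assumes "c \<le> M * min 1 (norm h)"
  shows "c * norm (b h) \<le> M * kappa h"
  using mult_right_mono[OF assms, of "norm (b h)"] by (simp add: b_bound[symmetric] mult.assoc)

lemma integrable_b:
  fixes f :: "real^'n \<Rightarrow> 'c::{real_normed_field, banach, second_countable_topology}"
  assumes [measurable]: "f \<in> borel_measurable borel" and "\<And>h. norm (f h) \<le> M * min 1 (norm h)"
  shows "integrable lborel (\<lambda>h. f h * of_real (b h $ j))"
proof (rule Bochner_Integration.integrable_bound[where f="\<lambda>h. M * kappa h"])
  show "integrable lborel (\<lambda>h. M * kappa h)" by (intro integrable_mult_right kappa_integrable)
  show "AE h in lborel. norm (f h * of_real (b h $ j)) \<le> norm (M * kappa h)"
  proof (rule AE_I2)
    fix h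
    have "norm (f h * of_real (b h $ j)) \<le> norm (f h) * norm (b h)"
      by (auto simp: norm_mult intro!: mult_left_mono component_le_norm_cart)
    also have "\<dots> \<le> M * kappa h" by (rule b_boundI[OF assms(2)])
    finally show "norm (f h * of_real (b h $ j)) \<le> norm (M * kappa h)" by simp
  qed
qed measurable

lemma integrable_scaleR_b:
  assumes [measurable]: "f \<in> borel_measurable borel" and "\<And>h. \<bar>f h\<bar> \<le> M * min 1 (norm h)"
  shows "integrable lborel (\<lambda>h. f h *\<^sub>R b h)"
proof (rule Bochner_Integration.integrable_bound[where f="\<lambda>h. M * kappa h"])
  show "integrable lborel (\<lambda>h. M * kappa h)" by (intro integrable_mult_right kappa_integrable)
  show "AE h in lborel. norm (f h *\<^sub>R b h) \<le> norm (M * kappa h)"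
    using b_boundI[OF assms(2)] by (auto intro!: AE_I2 intro: order_trans[OF _ abs_ge_self])
qed measurable

text \<open>\<open>L f\<close> is the pairing of \<open>K\<^sub>\<rho>\<close> with \<open>f\<close>, written without the Fourier transform; see \<open>L_fourier\<close>.\<close>

definition L :: "(real^'n \<Rightarrow> real) \<Rightarrow> real" where
  "L f = (\<integral>p. D2 f (fst p) (snd p) * (b (fst p) \<bullet> b (snd p)) \<partial>(lborel \<Otimes>\<^sub>M lborel))"

lemma L_integrand_bound:
  assumes "\<And>h k. \<bar>D2 f h k\<bar> \<le> M * min 1 (norm h) * min 1 (norm k)"
  shows "norm (D2 f h k * (b h \<bullet> b k)) \<le> M * (kappa h * kappa k)"
proof -
  have "norm (D2 f h k * (b h \<bullet> b k)) \<le> (M * min 1 (norm h) * min 1 (norm k)) * (norm (b h) * norm (b k))"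
    unfolding real_norm_def abs_mult
    by (intro mult_mono assms Cauchy_Schwarz_ineq2) (auto intro: order_trans[OF abs_ge_zero assms])
  also have "\<dots> = M * (kappa h * kappa k)" by (simp add: b_bound[symmetric] mult_ac)
  finally show ?thesis .
qed

lemma integrable_kappa_prod: "integrable (lborel \<Otimes>\<^sub>M lborel) (\<lambda>p. kappa (fst p) * kappa (snd p))"
  by (rule lborel_pair.integral_pair_mult(1)[OF kappa_integrable kappa_integrable])

lemma D2_measurable[measurable]:
  assumes [measurable]: "f \<in> borel_measurable borel"
  shows "(\<lambda>p. D2 f (fst p) (snd p)) \<in> borel_measurable (borel \<Otimes>\<^sub>M (borel :: (real^'n) measure))"
  unfolding D2_def by measurable

lemma L_integrable:
  assumes [measurable]: "f \<in> borel_measurable borel"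
    and "\<And>h k. \<bar>D2 f h k\<bar> \<le> M * min 1 (norm h) * min 1 (norm k)"
  shows "integrable (lborel \<Otimes>\<^sub>M lborel) (\<lambda>p. D2 f (fst p) (snd p) * (b (fst p) \<bullet> b (snd p)))"
proof (rule Bochner_Integration.integrable_bound[where f="\<lambda>p. M * (kappa (fst p) * kappa (snd p))"])
  show "integrable (lborel \<Otimes>\<^sub>M lborel) (\<lambda>p. M * (kappa (fst p) * kappa (snd p)))"
    by (intro integrable_mult_right integrable_kappa_prod)
  show "AE p in lborel \<Otimes>\<^sub>M lborel. norm (D2 f (fst p) (snd p) * (b (fst p) \<bullet> b (snd p))) \<le> norm (M * (kappa (fst p) * kappa (snd p)))"
    by (intro AE_I2 order_trans[OF L_integrand_bound[OF assms(2)]]) simp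
qed measurable

lemma L_Cc_integrable:
  assumes "f \<in> Cc_infinity UNIV"
  shows "integrable (lborel \<Otimes>\<^sub>M lborel) (\<lambda>p. D2 f (fst p) (snd p) * (b (fst p) \<bullet> b (snd p)))"
proof -
  obtain M where "\<And>h k. \<bar>D2 f h k\<bar> \<le> M * min 1 (norm h) * min 1 (norm k)" using Cc_D2[OF assms] by blast
  moreover have "f \<in> borel_measurable borel" using Cc_integrable[OF assms] by auto
  ultimately show ?thesis by (intro L_integrable)
qed

lemma L_lincomb:
  assumes "f \<in> Cc_infinity UNIV" "g \<in> Cc_infinity UNIV"
  shows "L (\<lambda>x. c * f x - g x) = c * L f - L g"
proof -
  have "D2 (\<lambda>x. c * f x - g x) h k * (b h \<bullet> b k) = c * (D2 f h k * (b h \<bullet> b k)) - D2 g h k * (b h \<bullet> b k)" for h k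
    by (simp add: D2_def algebra_simps)
  then show ?thesis unfolding L_def using assms[THEN L_Cc_integrable] by simp
qed

text \<open>Dominated convergence with majorant \<open>M * kappa h * kappa k\<close>. Both cutoff
  errors, at the origin and at infinity, are discarded in this way.\<close>

lemma L_tendsto_0:
  assumes [measurable]: "\<And>m. f m \<in> borel_measurable borel"
    and M: "\<And>m h k. \<bar>D2 (f m) h k\<bar> \<le> M * min 1 (norm h) * min 1 (norm k)"
    and lim: "\<And>h k. (\<lambda>m. D2 (f m) h k) \<longlonglongrightarrow> 0"
  shows "(\<lambda>m. L (f m)) \<longlonglongrightarrow> 0"
proof -
  have "(\<lambda>m. L (f m)) \<longlonglongrightarrow> (\<integral>p. 0 \<partial>((lborel :: (real^'n) measure) \<Otimes>\<^sub>M (lborel :: (real^'n) measure)))"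
    unfolding L_def
  proof (rule integral_dominated_convergence[where w="\<lambda>p. M * (kappa (fst p) * kappa (snd p))"])
    show "integrable (lborel \<Otimes>\<^sub>M lborel) (\<lambda>p. M * (kappa (fst p) * kappa (snd p)))"
      by (intro integrable_mult_right integrable_kappa_prod)
    show "AE p in lborel \<Otimes>\<^sub>M lborel. norm (D2 (f m) (fst p) (snd p) * (b (fst p) \<bullet> b (snd p))) \<le> M * (kappa (fst p) * kappa (snd p))" for m
      by (intro AE_I2 L_integrand_bound[OF M])
    show "AE p in lborel \<Otimes>\<^sub>M lborel. (\<lambda>m. D2 (f m) (fst p) (snd p) * (b (fst p) \<bullet> b (snd p))) \<longlonglongrightarrow> 0"
      by (intro AE_I2 tendsto_mult_left_zero lim)
  qed measurable
  then show ?thesis by simp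
qed

text \<open>\<open>\<i> * Lam\<close> is the Fourier symbol of the nonlocal gradient, as
  \<open>integral_one_minus_cis_b\<close> shows. Keeping the real vector avoids complex vectors
  until the comparison with \<open>lambda_symbol\<close>.\<close>

definition Lam :: "real^'n \<Rightarrow> real^'n" where
  "Lam \<xi> = (LINT h|lborel. sin (2 * pi * (h \<bullet> \<xi>)) *\<^sub>R b h)"

lemma Lam_measurable[measurable]: "Lam \<in> borel_measurable borel"
  unfolding Lam_def[abs_def] by measurable

text \<open>For \<open>norm h \<le> 1\<close> the Lipschitz bound of \<open>cis\<close> gives a
  factor \<open>norm h\<close>; otherwise the trivial bound \<open>2\<close> is below
  \<open>2 * pi\<close>.\<close>

lemma one_minus_cis_bound: "norm (1 - cis (- (2 * pi * (h \<bullet> \<xi>)))) \<le> (2 * pi * (1 + norm \<xi>)) * min 1 (norm h)"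
proof (cases "norm h \<le> 1")
  case True
  have "norm (1 - cis (- (2 * pi * (h \<bullet> \<xi>)))) \<le> 2 * pi * \<bar>h \<bullet> \<xi>\<bar>"
    using norm_one_minus_cis[of "- (2 * pi * (h \<bullet> \<xi>))"] by (simp add: abs_mult)
  also have "\<dots> \<le> 2 * pi * (norm h * norm \<xi>)" by (intro mult_left_mono Cauchy_Schwarz_ineq2) auto
  also have "\<dots> \<le> (2 * pi * (1 + norm \<xi>)) * norm h" by (simp add: algebra_simps)
  finally show ?thesis using True by (simp add: min_def)
next
  case False
  have "norm (1 - cis (- (2 * pi * (h \<bullet> \<xi>)))) \<le> 1 + 1"
    by (rule order_trans[OF norm_triangle_ineq4]) simp
  also have "\<dots> \<le> 2 * pi * 1" using pi_gt3 by simp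
  also have "\<dots> \<le> 2 * pi * (1 + norm \<xi>)" by (intro mult_left_mono) auto
  finally show ?thesis using False by (simp add: min_def)
qed

lemma sin_bound: "\<bar>sin (2 * pi * (h \<bullet> \<xi>))\<bar> \<le> (2 * pi * (1 + norm \<xi>)) * min 1 (norm h)"
proof -
  have "\<bar>Im (1 - cis (- (2 * pi * (h \<bullet> \<xi>))))\<bar> \<le> norm (1 - cis (- (2 * pi * (h \<bullet> \<xi>))))" by (rule abs_Im_le_cmod)
  then show ?thesis using one_minus_cis_bound[of h \<xi>] by (simp add: cis.sel)
qed

lemma cos_bound: "\<bar>1 - cos (2 * pi * (h \<bullet> \<xi>))\<bar> \<le> (2 * pi * (1 + norm \<xi>)) * min 1 (norm h)"
proof -
  have "\<bar>Re (1 - cis (- (2 * pi * (h \<bullet> \<xi>))))\<bar> \<le> norm (1 - cis (- (2 * pi * (h \<bullet> \<xi>))))" by (rule abs_Re_le_cmod)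
  then show ?thesis using one_minus_cis_bound[of h \<xi>] by (simp add: cis.sel)
qed

lemma Lam_nth: "Lam \<xi> $ j = (LINT h|lborel. sin (2 * pi * (h \<bullet> \<xi>)) * (b h $ j))"
proof -
  have "(LINT h|lborel. (sin (2 * pi * (h \<bullet> \<xi>)) *\<^sub>R b h) $ j) = Lam \<xi> $ j"
    unfolding Lam_def
    by (rule integral_bounded_linear[OF bounded_linear_vec_nth integrable_scaleR_b[OF _ sin_bound]]) measurable
  then show ?thesis by simp
qed

lemma integral_one_minus_cis_b:
  "(LINT h|lborel. (1 - cis (- (2 * pi * (h \<bullet> \<xi>)))) * of_real (b h $ j)) = \<i> * of_real (Lam \<xi> $ j)"
proof -
  have c: "integrable lborel (\<lambda>h. (1 - cos (2 * pi * (h \<bullet> \<xi>))) * (b h $ j))"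
    using integrable_b[where f="\<lambda>h. 1 - cos (2 * pi * (h \<bullet> \<xi>))" and j=j, OF _ cos_bound[unfolded real_norm_def[symmetric]]] by simp
  have s: "integrable lborel (\<lambda>h. sin (2 * pi * (h \<bullet> \<xi>)) * (b h $ j))"
    using integrable_b[where f="\<lambda>h. sin (2 * pi * (h \<bullet> \<xi>))" and j=j, OF _ sin_bound[unfolded real_norm_def[symmetric]]] by simp
  \<comment> \<open>The cosine part is even and \<open>b\<close> is odd, so the integral equals its
    own negative.\<close>
  have "(LINT h|lborel. (1 - cos (2 * pi * (h \<bullet> \<xi>))) * (b h $ j)) = (LINT h|lborel. - ((1 - cos (2 * pi * (h \<bullet> \<xi>))) * (b h $ j)))"
    by (subst lborel_integral_uminus[symmetric]) (simp add: b_odd)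
  then have c0: "(LINT h|lborel. (1 - cos (2 * pi * (h \<bullet> \<xi>))) * (b h $ j)) = 0" by simp
  have eq: "(1 - cis (- (2 * pi * (h \<bullet> \<xi>)))) * of_real (b h $ j) =
      complex_of_real ((1 - cos (2 * pi * (h \<bullet> \<xi>))) * (b h $ j)) + \<i> * complex_of_real (sin (2 * pi * (h \<bullet> \<xi>)) * (b h $ j))" for h
    by (simp add: complex_eq_iff)
  have "(LINT h|lborel. (1 - cis (- (2 * pi * (h \<bullet> \<xi>)))) * of_real (b h $ j)) =
     (LINT h|lborel. complex_of_real ((1 - cos (2 * pi * (h \<bullet> \<xi>))) * (b h $ j))) + (LINT h|lborel. \<i> * complex_of_real (sin (2 * pi * (h \<bullet> \<xi>)) * (b h $ j)))"
    unfolding eq by (intro Bochner_Integration.integral_add integrable_mult_right integrable_of_real c s)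
  then show ?thesis by (simp only: integral_complex_of_real c0 integral_mult_right_zero Lam_nth) simp
qed

text \<open>One triple integral is computed in two orders. Integrating first in
  \<open>(h, k)\<close> the product of the two factors \<open>1 - cis\<close> splits and gives the
  square of \<open>\<i> * Lam\<close>, coordinate by coordinate; integrating first in
  \<open>\<xi>\<close>, the four terms of that product become values of \<open>f\<close> by Fourier
  inversion and form the second difference.\<close>

theorem L_fourier:
  assumes f: "f \<in> Cc_infinity UNIV"
  shows "(LINT \<xi>|lborel. (- (norm (Lam \<xi>))\<^sup>2) *\<^sub>R hat f \<xi>) = complex_of_real (L f)"
proof -
  note fi = Cc_integrable[OF f]
  note [measurable] = hat_measurable[OF fi]
  let ?e = "\<lambda>h \<xi>. 1 - cis (- (2 * pi * (h \<bullet> \<xi>)))"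
  let ?F = "\<lambda>\<xi> p. hat f \<xi> * (?e (fst p) \<xi> * ?e (snd p) \<xi> * of_real (b (fst p) \<bullet> b (snd p)))"
  interpret P: pair_sigma_finite "lborel :: (real^'n) measure" "lborel \<Otimes>\<^sub>M (lborel :: (real^'n) measure)"
    unfolding lborel_prod ..
  have F: "integrable (lborel \<Otimes>\<^sub>M (lborel \<Otimes>\<^sub>M lborel)) (case_prod ?F)"
  proof (rule P.integrable_pair_bound[where f="\<lambda>\<xi>. (8 * pi\<^sup>2) * ((1 + (norm \<xi>)\<^sup>2) * norm (hat f \<xi>))" and g="\<lambda>p. kappa (fst p) * kappa (snd p)"])
    show "case_prod ?F \<in> borel_measurable (lborel \<Otimes>\<^sub>M (lborel \<Otimes>\<^sub>M lborel))" by measurable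
    show "integrable lborel (\<lambda>\<xi>. (8 * pi\<^sup>2) * ((1 + (norm \<xi>)\<^sup>2) * norm (hat f \<xi>)))"
      by (intro integrable_mult_right integrable_hat(1)[OF f])
    show "integrable (lborel \<Otimes>\<^sub>M lborel) (\<lambda>p. kappa (fst p) * kappa (snd p))" by (rule integrable_kappa_prod)
    fix \<xi> :: "real^'n" and p :: "(real^'n) \<times> (real^'n)"
    let ?c = "2 * pi * (1 + norm \<xi>)"
    have "norm (?F \<xi> p) = norm (hat f \<xi>) * (norm (?e (fst p) \<xi>) * norm (?e (snd p) \<xi>) * \<bar>b (fst p) \<bullet> b (snd p)\<bar>)"
      by (simp add: norm_mult)
    also have "\<dots> \<le> norm (hat f \<xi>) * (norm (?e (fst p) \<xi>) * norm (?e (snd p) \<xi>) * (norm (b (fst p)) * norm (b (snd p))))"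
      by (intro mult_left_mono Cauchy_Schwarz_ineq2) auto
    also have "\<dots> = norm (hat f \<xi>) * ((norm (?e (fst p) \<xi>) * norm (b (fst p))) * (norm (?e (snd p) \<xi>) * norm (b (snd p))))"
      by simp
    also have "\<dots> \<le> norm (hat f \<xi>) * ((?c * kappa (fst p)) * (?c * kappa (snd p)))"
      by (intro mult_left_mono mult_mono b_boundI one_minus_cis_bound) (auto simp: kappa_nonneg)
    also have "\<dots> = (4 * pi\<^sup>2 * (1 + norm \<xi>)\<^sup>2) * norm (hat f \<xi>) * (kappa (fst p) * kappa (snd p))"
      by (simp add: power2_eq_square algebra_simps)
    \<comment> \<open>From \<open>(1 + t)^2 \<le> 2 * (1 + t^2)\<close>; this produces the constant
      \<open>8 * pi^2\<close> of the majorant.\<close>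
    also have "\<dots> \<le> (4 * pi\<^sup>2 * (2 * (1 + (norm \<xi>)\<^sup>2))) * norm (hat f \<xi>) * (kappa (fst p) * kappa (snd p))"
    proof (intro mult_right_mono mult_left_mono)
      show "(1 + norm \<xi>)\<^sup>2 \<le> 2 * (1 + (norm \<xi>)\<^sup>2)"
        using zero_le_power2[of "1 - norm \<xi>"] by (simp add: power2_eq_square algebra_simps)
    qed (auto simp: kappa_nonneg)
    also have "\<dots> = (8 * pi\<^sup>2) * ((1 + (norm \<xi>)\<^sup>2) * norm (hat f \<xi>)) * (kappa (fst p) * kappa (snd p))"
      by (simp add: algebra_simps)
    finally show "norm (case (\<xi>, p) of (\<xi>, p) \<Rightarrow> ?F \<xi> p) \<le> (8 * pi\<^sup>2) * ((1 + (norm \<xi>)\<^sup>2) * norm (hat f \<xi>)) * (kappa (fst p) * kappa (snd p))"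
      by simp
  qed
  have ie: "integrable lborel (\<lambda>h. ?e h \<xi> * of_real (b h $ j))" for \<xi> j
    by (rule integrable_b[OF _ one_minus_cis_bound]) measurable
  have "(\<integral>p. ?F \<xi> p \<partial>(lborel \<Otimes>\<^sub>M lborel)) = (- (norm (Lam \<xi>))\<^sup>2) *\<^sub>R hat f \<xi>" for \<xi>
  proof -
    have eq: "?F \<xi> p = hat f \<xi> * (\<Sum>j\<in>UNIV. (?e (fst p) \<xi> * of_real (b (fst p) $ j)) * (?e (snd p) \<xi> * of_real (b (snd p) $ j)))" for p
    proof -
      have "complex_of_real (v \<bullet> w) = (\<Sum>j\<in>UNIV. of_real (v $ j) * of_real (w $ j))" for v w :: "real^'n"
        by (simp add: inner_vec_def)
      then show ?thesis by (simp only: sum_distrib_left mult_ac)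
    qed
    have "(\<integral>p. ?F \<xi> p \<partial>(lborel \<Otimes>\<^sub>M lborel)) = hat f \<xi> * (\<Sum>j\<in>UNIV. (\<i> * of_real (Lam \<xi> $ j)) * (\<i> * of_real (Lam \<xi> $ j)))"
      unfolding eq integral_mult_right_zero
      by (subst Bochner_Integration.integral_sum[OF lborel_pair.integral_pair_mult(1)[OF ie ie]])
         (simp only: lborel_pair.integral_pair_mult(2)[OF ie ie] integral_one_minus_cis_b)
    also have "(\<Sum>j\<in>UNIV. (\<i> * of_real (Lam \<xi> $ j)) * (\<i> * of_real (Lam \<xi> $ j))) = complex_of_real (- (norm (Lam \<xi>))\<^sup>2)"
    proof -
      have "(norm (Lam \<xi>))\<^sup>2 = (\<Sum>j\<in>UNIV. (Lam \<xi> $ j) * (Lam \<xi> $ j))"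
        unfolding power2_norm_eq_inner inner_vec_def by simp
      moreover have "(\<i> * complex_of_real (Lam \<xi> $ j)) * (\<i> * of_real (Lam \<xi> $ j)) = complex_of_real (- ((Lam \<xi> $ j) * (Lam \<xi> $ j)))" for j
        by (simp add: complex_eq_iff)
      ultimately show ?thesis by (simp only: of_real_sum[symmetric] sum_negf)
    qed
    finally show ?thesis by (simp only: scaleR_conv_of_real mult.commute)
  qed
  then have "(LINT \<xi>|lborel. (- (norm (Lam \<xi>))\<^sup>2) *\<^sub>R hat f \<xi>) = (LINT \<xi>|lborel. (\<integral>p. ?F \<xi> p \<partial>(lborel \<Otimes>\<^sub>M lborel)))"
    by simp
  also have "\<dots> = (\<integral>p. (LINT \<xi>|lborel. ?F \<xi> p) \<partial>(lborel \<Otimes>\<^sub>M lborel))"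
    using P.Fubini_integral[OF F] by simp
  also have "\<dots> = (\<integral>p. complex_of_real (D2 f (fst p) (snd p) * (b (fst p) \<bullet> b (snd p))) \<partial>(lborel \<Otimes>\<^sub>M lborel))"
  proof (intro Bochner_Integration.integral_cong refl)
    fix p :: "(real^'n) \<times> (real^'n)"
    let ?h = "fst p" and ?k = "snd p"
    let ?c = "\<lambda>x \<xi>. cis (- (2 * pi * (x \<bullet> \<xi>))) * hat f \<xi>"
    have ic: "integrable lborel (?c x)" for x
      by (rule Bochner_Integration.integrable_bound[OF integrable_hat(2)[OF f]]) (auto simp: norm_mult)
    have "?F \<xi> p = (?c 0 \<xi> - ?c ?h \<xi> - ?c ?k \<xi> + ?c (?h + ?k) \<xi>) * of_real (b ?h \<bullet> b ?k)" for \<xi>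
    proof -
      have "cis (- (2 * pi * ((?h + ?k) \<bullet> \<xi>))) = cis (- (2 * pi * (?h \<bullet> \<xi>))) * cis (- (2 * pi * (?k \<bullet> \<xi>)))"
        by (simp add: cis_mult inner_add_left algebra_simps)
      then show ?thesis by (simp add: algebra_simps)
    qed
    then have "(LINT \<xi>|lborel. ?F \<xi> p) = (LINT \<xi>|lborel. ?c 0 \<xi> - ?c ?h \<xi> - ?c ?k \<xi> + ?c (?h + ?k) \<xi>) * of_real (b ?h \<bullet> b ?k)"
      by (simp only: integral_mult_left_zero)
    also have "(LINT \<xi>|lborel. ?c 0 \<xi> - ?c ?h \<xi> - ?c ?k \<xi> + ?c (?h + ?k) \<xi>) = of_real (f 0) - of_real (f ?h) - of_real (f ?k) + of_real (f (?h + ?k))"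
      unfolding fourier_inversion[OF f, symmetric]
      by (simp only: Bochner_Integration.integral_add Bochner_Integration.integral_diff Bochner_Integration.integrable_diff ic)
    finally show "(LINT \<xi>|lborel. ?F \<xi> p) = complex_of_real (D2 f ?h ?k * (b ?h \<bullet> b ?k))"
      by (simp add: D2_def)
  qed
  also have "\<dots> = complex_of_real (L f)" by (simp only: integral_complex_of_real L_def)
  finally show ?thesis .
qed

lemma lborel_integral_orthogonal:
  fixes g :: "real^'n \<Rightarrow> 'c::{banach, second_countable_topology}" and T :: "real^'n \<Rightarrow> real^'n"
  assumes "orthogonal_transformation T" and [measurable]: "g \<in> borel_measurable borel"
  shows "(LINT h|lborel. g (T h)) = (LINT h|lborel. g h)"
proof -
  note [measurable] = orthogonal_transformation_measurable[OF assms(1)]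
  have "(LINT h|lborel. g h) = (LINT h|distr lborel borel T. g h)" by (simp add: orthogonal_distr_lborel[OF assms(1)])
  also have "\<dots> = (LINT h|lborel. g (T h))" by (rule integral_distr) measurable
  finally show ?thesis ..
qed

text \<open>By symmetry of the kernel under a reflection fixing \<open>\<xi>\<close>, the vector
  \<open>Lam \<xi>\<close> is parallel to \<open>\<xi>\<close>. Its component along
  \<open>\<xi>\<close> is then moved to a coordinate axis by a rotation and becomes the integral in
  \<open>Q_hat\<close>. Norms are compared because only they enter the distribution.\<close>

lemma norm_Lam: "norm (Lam \<xi>) = norm (lambda_symbol r \<xi>)"
proof (cases "\<xi> = 0")
  case True
  then show ?thesis by (simp add: Lam_def lambda_symbol_def norm_vec_def L2_set_def)
next
  case False
  define e where "e = \<xi> /\<^sub>R norm \<xi>"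
  have e1: "norm e = 1" and \<xi>e: "\<xi> = norm \<xi> *\<^sub>R e" using False by (auto simp: e_def)
  have ee: "e \<bullet> e = 1" using e1 by (simp add: norm_eq_1)
  \<comment> \<open>\<open>R\<close> fixes the direction \<open>e\<close> of \<open>\<xi>\<close>
    and acts as \<open>-1\<close> on its orthogonal complement, so a vector fixed by
    \<open>R\<close> is a multiple of \<open>e\<close>.\<close>
  define R where "R h = (2 * (h \<bullet> e)) *\<^sub>R e - h" for h
  have lR: "linear R" unfolding R_def[abs_def]
    by (intro linearI) (simp_all add: inner_add_left algebra_simps)
  have RR: "R v \<bullet> R w = v \<bullet> w" for v w
    by (simp add: R_def inner_diff_left inner_diff_right ee inner_commute algebra_simps)
  have oR: "orthogonal_transformation R" using lR RR by (simp add: orthogonal_transformation_def)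
  have blR: "bounded_linear R" using lR by (simp add: linear_conv_bounded_linear)
  have [measurable]: "R \<in> borel_measurable borel"
    by (intro borel_measurable_continuous_onI linear_continuous_on blR)
  have Re: "R h \<bullet> \<xi> = h \<bullet> \<xi>" for h unfolding R_def by (subst (1 2) \<xi>e) (simp add: inner_diff_left ee algebra_simps)
  have "Lam \<xi> = (LINT h|lborel. sin (2 * pi * (R h \<bullet> \<xi>)) *\<^sub>R b (R h))"
    unfolding Lam_def by (rule lborel_integral_orthogonal[OF oR, symmetric]) measurable
  also have "\<dots> = (LINT h|lborel. R (sin (2 * pi * (h \<bullet> \<xi>)) *\<^sub>R b h))"
  proof (intro integral_cong_AE)
    show "AE h in lborel. sin (2 * pi * (R h \<bullet> \<xi>)) *\<^sub>R b (R h) = R (sin (2 * pi * (h \<bullet> \<xi>)) *\<^sub>R b h)"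
      using r_rot[OF oR] by eventually_elim
        (simp add: Re b_def linear_cmul[OF lR] orthogonal_transformation_norm[OF oR])
  qed measurable
  also have "\<dots> = R (Lam \<xi>)" unfolding Lam_def
    by (rule integral_bounded_linear[OF blR integrable_scaleR_b[OF _ sin_bound]]) measurable
  finally have "2 *\<^sub>R Lam \<xi> = (2 * (Lam \<xi> \<bullet> e)) *\<^sub>R e" by (simp add: R_def scaleR_2 algebra_simps)
  then have "2 *\<^sub>R Lam \<xi> = 2 *\<^sub>R ((Lam \<xi> \<bullet> e) *\<^sub>R e)" by simp
  then have "Lam \<xi> = (Lam \<xi> \<bullet> e) *\<^sub>R e" by (simp only: scaleR_cancel_left) simp
  then have nL: "norm (Lam \<xi>) = \<bar>Lam \<xi> \<bullet> e\<bar>" using e1 by (metis mult.right_neutral norm_scaleR)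
  \<comment> \<open>This is the same arbitrary coordinate that \<open>Q_hat\<close> selects.\<close>
  define i :: 'n where "i = (SOME i. True)"
  obtain T :: "real^'n \<Rightarrow> real^'n" where T: "orthogonal_transformation T" "T (axis i 1) = e"
    using orthogonal_transformation_exists_1[OF norm_axis_1 e1] by blast
  have lT: "linear T" by (rule orthogonal_transformation_linear[OF T(1)])
  note [measurable] = orthogonal_transformation_measurable[OF T(1)]
  have Te: "T h \<bullet> e = h $ i" for h
    using T by (metis cart_eq_inner_axis orthogonal_transformation_def)
  have T\<xi>: "T h \<bullet> \<xi> = norm \<xi> * h $ i" for h by (subst \<xi>e) (simp add: Te)
  have "Lam \<xi> \<bullet> e = (LINT h|lborel. (sin (2 * pi * (h \<bullet> \<xi>)) *\<^sub>R b h) \<bullet> e)"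
    unfolding Lam_def
    by (rule integral_bounded_linear[symmetric, OF bounded_linear_inner_left integrable_scaleR_b[OF _ sin_bound]]) measurable
  also have "\<dots> = (LINT h|lborel. (sin (2 * pi * (T h \<bullet> \<xi>)) *\<^sub>R b (T h)) \<bullet> e)"
    by (rule lborel_integral_orthogonal[OF T(1), symmetric]) measurable
  also have "\<dots> = (LINT h|lborel. r h * h $ i / (norm h)\<^sup>2 * sin (2 * pi * norm \<xi> * h $ i))"
  proof (intro integral_cong_AE)
    show "AE h in lborel. (sin (2 * pi * (T h \<bullet> \<xi>)) *\<^sub>R b (T h)) \<bullet> e = r h * h $ i / (norm h)\<^sup>2 * sin (2 * pi * norm \<xi> * h $ i)"
      using r_rot[OF T(1)] by eventually_elim
        (simp add: T\<xi> b_def Te orthogonal_transformation_norm[OF T(1)] mult_ac)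
  qed measurable
  also have "\<dots> = (LINT h|lebesgue. r h * h $ i / (norm h)\<^sup>2 * sin (2 * pi * norm \<xi> * h $ i))"
    by (rule integral_completion[symmetric]) measurable
  also have "\<dots> = 2 * pi * norm \<xi> * Q_hat r \<xi>"
    using False by (simp add: Q_hat_def Let_def i_def[symmetric])
  finally have "norm (Lam \<xi>) = 2 * pi * norm \<xi> * \<bar>Q_hat r \<xi>\<bar>" by (simp add: nL abs_mult)
  moreover have "norm (lambda_symbol r \<xi>) = 2 * pi * norm \<xi> * \<bar>Q_hat r \<xi>\<bar>"
  proof -
    have "norm (lambda_symbol r \<xi>) = L2_set (\<lambda>j. \<bar>2 * pi * Q_hat r \<xi>\<bar> * \<bar>\<xi> $ j\<bar>) UNIV"
      by (simp add: norm_vec_def lambda_symbol_def norm_mult abs_mult mult_ac)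
    also have "\<dots> = \<bar>2 * pi * Q_hat r \<xi>\<bar> * L2_set (\<lambda>j. \<bar>\<xi> $ j\<bar>) UNIV"
      by (rule L2_set_right_distrib[symmetric]) simp
    finally show ?thesis by (simp add: norm_vec_def abs_mult)
  qed
  ultimately show ?thesis by simp
qed

theorem K_distribution_eq_L:
  assumes f: "f \<in> Cc_infinity UNIV"
  shows "K_distribution r (\<lambda>x. complex_of_real (f x)) = complex_of_real (L f)"
proof -
  note fi = Cc_integrable[OF f]
  note [measurable] = hat_measurable[OF fi]
  have [measurable]: "f \<in> borel_measurable borel" using fi by auto
  have "inverse_fourier (\<lambda>x. complex_of_real (f x)) \<xi> = hat f \<xi>" for \<xi>
  proof -
    have "complex_of_real (f x) * exp (2 * complex_of_real pi * \<i> * complex_of_real (\<xi> \<bullet> x)) = f x *\<^sub>R cis (2 * pi * (x \<bullet> \<xi>))" for x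
      by (simp add: cis_conv_exp scaleR_conv_of_real inner_commute mult_ac)
    then show ?thesis unfolding inverse_fourier_def hat_def by (simp add: integral_completion)
  qed
  then have "K_distribution r (\<lambda>x. complex_of_real (f x)) = (LINT \<xi>|lebesgue. (- (norm (Lam \<xi>))\<^sup>2) *\<^sub>R hat f \<xi>)"
    by (simp add: K_distribution_def inverse_fourier_distribution_def regular_distribution_def norm_Lam scaleR_conv_of_real)
  also have "\<dots> = (LINT \<xi>|lborel. (- (norm (Lam \<xi>))\<^sup>2) *\<^sub>R hat f \<xi>)" by (rule integral_completion) measurable
  finally show ?thesis by (simp only: L_fourier[OF f])
qed

end

section \<open>The energy of a test function\<close>

definition autocorr :: "(real^'n::finite \<Rightarrow> real) \<Rightarrow> real^'n \<Rightarrow> real" where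
  "autocorr f h = (LINT x|lborel. f (x + h) * f x)"

lemma autocorr_conv: "autocorr f = conv (\<lambda>y. f (- y)) f"
proof
  fix h
  have "conv (\<lambda>y. f (- y)) f h = (LINT y|lborel. (\<lambda>y. f (h - y) *\<^sub>R f (- y)) (- y))"
    unfolding conv_def by (rule lborel_integral_uminus[symmetric])
  then show "autocorr f h = conv (\<lambda>y. f (- y)) f h" by (simp add: autocorr_def add.commute)
qed

lemma autocorr_Cc:
  assumes "f \<in> Cc_infinity UNIV"
  shows "autocorr f \<in> Cc_infinity UNIV"
proof -
  obtain R where R: "\<And>x. norm x > R \<Longrightarrow> f x = 0" using Cc_infinityD[OF assms] by blast
  show ?thesis unfolding autocorr_conv
    by (rule conv_Cc[where R=R]) (auto intro!: continuous_on_compose2[OF Cc_continuous[OF assms]] continuous_intros assms R)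
qed

lemma autocorr_even: "autocorr f (- h) = autocorr f h"
  using lborel_integral_shift(2)[of "\<lambda>x. f (x + h) * f x" h]
  by (simp add: autocorr_def mult.commute)

lemma Cc_shift: "f \<in> Cc_infinity UNIV \<Longrightarrow> (\<lambda>x. f (x - h)) \<in> Cc_infinity UNIV"
  using Cc_affine[of f 1 "- h"] by simp

lemma Cc_times:
  fixes f g :: "real^'n::finite \<Rightarrow> 'b::real_normed_algebra"
  assumes "f \<in> Cc_infinity UNIV" "g \<in> Cc_infinity UNIV"
  shows "(\<lambda>x. f x * g x) \<in> Cc_infinity UNIV"
  by (rule Cc_mult[OF assms(1) Cc_C_k[OF assms(2)]])

lemma Cc_increment_bound:
  fixes f :: "real^'n::finite \<Rightarrow> real"
  assumes "f \<in> Cc_infinity UNIV"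
  obtains M where "M > 0" "\<And>x h. \<bar>f x - f (x - h)\<bar> \<le> M * min 1 (norm h)"
proof -
  obtain A where A: "A > 0" "\<And>x. \<bar>f x\<bar> \<le> A" using Cc_bounded[OF assms] by (metis real_norm_def)
  obtain B where B: "B > 0" "\<And>x y. \<bar>f x - f y\<bar> \<le> B * norm (x - y)" using Cc_lipschitz[OF assms] by (metis real_norm_def)
  show ?thesis
  proof (rule that[of "2 * A + B"])
    fix x h
    have "\<bar>f x - f (x - h)\<bar> \<le> 2 * A" using A(2)[of x] A(2)[of "x - h"] by linarith
    moreover have "\<bar>f x - f (x - h)\<bar> \<le> B * norm h" using B(2)[of x "x - h"] by simp
    moreover have "B * norm h \<le> (2 * A + B) * norm h" using A(1) by (intro mult_right_mono) auto
    ultimately show "\<bar>f x - f (x - h)\<bar> \<le> (2 * A + B) * min 1 (norm h)"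
      using B(1) by (simp add: min_def)
  qed (use A B in auto)
qed

text \<open>For \<open>norm h \<le> 1\<close> the increment is of size \<open>norm h\<close> and
  supported in a fixed ball; for larger \<open>h\<close> its integral is at most twice that of
  \<open>\<bar>f\<bar>\<close>. The bound is used for one of two increments in a product, the other
  being bounded uniformly in \<open>x\<close>.\<close>

lemma Cc_increment_L1:
  fixes f :: "real^'n::finite \<Rightarrow> real"
  assumes "f \<in> Cc_infinity UNIV"
  obtains M where "\<And>h. (LINT x|lborel. \<bar>f x - f (x - h)\<bar>) \<le> M * min 1 (norm h)"
proof -
  obtain R where R: "R > 0" "\<And>x. norm x > R \<Longrightarrow> f x = 0" using Cc_infinityD[OF assms] by blast
  obtain B where B: "B > 0" "\<And>x h. \<bar>f x - f (x - h)\<bar> \<le> B * min 1 (norm h)" using Cc_increment_bound[OF assms] by blast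
  define V where "V = measure lborel (cball (0::real^'n) (R + 1))"
  define I where "I = (LINT x|lborel. \<bar>f x\<bar>)"
  have V: "V \<ge> 0" and I: "I \<ge> 0" by (auto simp: V_def I_def)
  have fi: "integrable lborel f" and fi': "integrable lborel (\<lambda>x. f (x - h))" for h
    by (auto intro!: Cc_integrable Cc_shift assms)
  have di: "integrable lborel (\<lambda>x. \<bar>f x - f (x - h)\<bar>)" for h
    using fi fi' by (intro integrable_abs Bochner_Integration.integrable_diff)
  show ?thesis
  proof (rule that[of "B * V + 2 * I"])
    fix h
    show "(LINT x|lborel. \<bar>f x - f (x - h)\<bar>) \<le> (B * V + 2 * I) * min 1 (norm h)"
    proof (cases "norm h \<le> 1")
      case True
      have ic: "integrable lborel (indicat_real (cball (0::real^'n) (R + 1)))"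
        using emeasure_lborel_cball_finite[of "0::real^'n" "R + 1"] by (simp add: integrable_indicator_iff)
      have "(LINT x|lborel. \<bar>f x - f (x - h)\<bar>) \<le> (LINT x|lborel. (B * norm h) * indicat_real (cball (0::real^'n) (R + 1)) x)"
      proof (rule integral_mono)
        show "integrable lborel (\<lambda>x. \<bar>f x - f (x - h)\<bar>)" by (rule di)
        show "integrable lborel (\<lambda>x. (B * norm h) * indicat_real (cball (0::real^'n) (R + 1)) x)"
          by (rule integrable_mult_right[OF ic])
        fix x
        have "f x - f (x - h) = 0" if "norm x > R + 1"
          using that R(2)[of x] R(2)[of "x - h"] norm_triangle_ineq2[of x h] True by simp
        then show "\<bar>f x - f (x - h)\<bar> \<le> (B * norm h) * indicat_real (cball 0 (R + 1)) x"
          using B(2)[of x h] True by (auto simp: indicator_def min_def)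
      qed
      also have "\<dots> = B * norm h * V" by (simp add: V_def)
      also have "\<dots> \<le> (B * V + 2 * I) * min 1 (norm h)" using True I by (simp add: min_def algebra_simps)
      finally show ?thesis .
    next
      case False
      have "(LINT x|lborel. \<bar>f x - f (x - h)\<bar>) \<le> (LINT x|lborel. \<bar>f x\<bar> + \<bar>f (x - h)\<bar>)"
        by (rule integral_mono[OF di]) (use fi fi' in auto)
      also have "\<dots> = I + (LINT x|lborel. \<bar>f (x - h)\<bar>)" unfolding I_def
        using fi fi' by (intro Bochner_Integration.integral_add integrable_abs)
      also have "(LINT x|lborel. \<bar>f (x - h)\<bar>) = I" unfolding I_def
        by (rule lborel_integral_shift(2)[of "\<lambda>x. \<bar>f x\<bar>"])
      finally have "(LINT x|lborel. \<bar>f x - f (x - h)\<bar>) \<le> 2 * I" by simp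
      moreover have "0 \<le> B * V" using V B(1) by simp
      ultimately show ?thesis using False by (simp add: min_def)
    qed
  qed
qed

lemma autocorr_increments:
  fixes f :: "real^'n::finite \<Rightarrow> real"
  assumes f: "f \<in> Cc_infinity UNIV"
  shows "(LINT x|lborel. (f x - f (x - h)) * (f x - f (x - k))) = autocorr f 0 - autocorr f h - autocorr f k + autocorr f (h - k)"
proof -
  note fs = Cc_shift[OF f]
  have ip: "integrable lborel (\<lambda>x. g x * g' x)" if "g \<in> Cc_infinity UNIV" "g' \<in> Cc_infinity UNIV" for g g' :: "real^'n \<Rightarrow> real"
    using that by (intro Cc_integrable Cc_times)
  have eq: "(f x - f (x - h)) * (f x - f (x - k)) = f x * f x - f (x - h) * f x - f (x - k) * f x + f (x - h) * f (x - k)" for x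
    by (simp add: algebra_simps)
  have a: "(LINT x|lborel. f (x - h) * f x) = autocorr f h" for h
    using autocorr_even[of f h] by (simp add: autocorr_def)
  have "(LINT x|lborel. f (x - h) * f (x - k)) = autocorr f (h - k)"
    using lborel_integral_shift(2)[of "\<lambda>x. f (x + (k - h)) * f x" k] autocorr_even[of f "h - k"]
    by (simp add: autocorr_def)
  moreover have "(LINT x|lborel. f x * f x) = autocorr f 0" by (simp add: autocorr_def)
  ultimately show ?thesis unfolding eq
    using ip[OF f f] ip[OF fs f] ip[OF fs fs] by (simp add: a)
qed

lemma autocorr_square:
  fixes f :: "real^'n::finite \<Rightarrow> real"
  assumes f: "f \<in> Cc_infinity UNIV"
  shows "(LINT x|lborel. (f x - f (x - h))\<^sup>2) = 2 * (autocorr f 0 - autocorr f h)"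
  using autocorr_increments[OF f, of h h] by (simp add: power2_eq_square)

lemma autocorr_le: "f \<in> Cc_infinity UNIV \<Longrightarrow> autocorr f h \<le> autocorr f 0"
  using autocorr_square[of f h] integral_nonneg_AE[of "\<lambda>x. (f x - f (x - h))\<^sup>2" lborel] by simp

section \<open>The gradient norm as a value of \<open>L\<close>\<close>

context even_kernel
begin

definition Dn :: "(real^'n \<Rightarrow> real) \<Rightarrow> real^'n \<Rightarrow> real^'n" where
  "Dn u x = (LINT h|lborel. (u x - u (x - h)) *\<^sub>R b h)"

lemma Dn_measurable[measurable]:
  assumes [measurable]: "u \<in> borel_measurable borel" shows "Dn u \<in> borel_measurable borel"
  unfolding Dn_def[abs_def] by measurable

lemma nonlocal_gradient_eq_Dn:
  assumes [measurable]: "u \<in> borel_measurable borel"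
  shows "nonlocal_gradient r u x = Dn u x"
proof -
  have "nonlocal_gradient r u x = (LINT y|lebesgue. (u x - u y) *\<^sub>R b (x - y))"
    unfolding nonlocal_gradient_def b_def by (simp add: power2_eq_square divide_inverse mult_ac)
  also have "\<dots> = (LINT y|lborel. (u x - u y) *\<^sub>R b (x - y))" by (rule integral_completion) measurable
  also have "\<dots> = Dn u x" unfolding Dn_def
    using lborel_integral_shift(3)[of "\<lambda>h. (u x - u (x - h)) *\<^sub>R b h" x] by simp
  finally show ?thesis .
qed

lemma Dn_integrable:
  assumes f: "f \<in> Cc_infinity UNIV"
  shows "integrable lborel (\<lambda>h. (f x - f (x - h)) *\<^sub>R b h)"
proof -
  have [measurable]: "f \<in> borel_measurable borel" using Cc_integrable[OF f] by auto
  obtain B where "B > 0" and B: "\<And>x h. \<bar>f x - f (x - h)\<bar> \<le> B * min 1 (norm h)" using Cc_increment_bound[OF f] by metis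
  show ?thesis by (rule integrable_scaleR_b[OF _ B]) measurable
qed

lemma Dn_lincomb:
  assumes f: "f \<in> Cc_infinity UNIV" and g: "g \<in> Cc_infinity UNIV"
  shows "Dn (\<lambda>x. c * f x + d * g x) x = c *\<^sub>R Dn f x + d *\<^sub>R Dn g x"
proof -
  have "((c * f x + d * g x) - (c * f (x - h) + d * g (x - h))) *\<^sub>R b h
     = c *\<^sub>R ((f x - f (x - h)) *\<^sub>R b h) + d *\<^sub>R ((g x - g (x - h)) *\<^sub>R b h)" for h
    by (simp add: algebra_simps)
  then show ?thesis unfolding Dn_def using Dn_integrable[OF f, of x] Dn_integrable[OF g, of x]
    by (simp only: Bochner_Integration.integral_add Bochner_Integration.integrable_scaleR_right integral_scaleR_right)
qed

text \<open>The square of the vector integral is a double integral in \<open>(h, k)\<close>, and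
  integrating the product of the two increments over \<open>x\<close> leaves a second difference of
  the autocorrelation in the directions \<open>h\<close> and \<open>-k\<close>.\<close>

theorem Dn_norm_eq_L:
  assumes f: "f \<in> Cc_infinity UNIV"
  shows "integrable lborel (\<lambda>x. (norm (Dn f x))\<^sup>2)"
    and "(LINT x|lborel. (norm (Dn f x))\<^sup>2) = - L (autocorr f)"
proof -
  let ?A = "autocorr f"
  have [measurable]: "f \<in> borel_measurable borel" using Cc_integrable[OF f] by auto
  obtain B where B: "B > 0" "\<And>x h. \<bar>f x - f (x - h)\<bar> \<le> B * min 1 (norm h)" using Cc_increment_bound[OF f] by metis
  obtain C where C: "\<And>h. (LINT x|lborel. \<bar>f x - f (x - h)\<bar>) \<le> C * min 1 (norm h)" using Cc_increment_L1[OF f] by blast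
  let ?F = "\<lambda>p x. ((f x - f (x - fst p)) * (f x - f (x - snd p))) * (b (fst p) \<bullet> b (snd p))"
  interpret P: pair_sigma_finite "(lborel :: (real^'n) measure) \<Otimes>\<^sub>M (lborel :: (real^'n) measure)" "lborel :: (real^'n) measure"
    unfolding lborel_prod ..
  have fi: "integrable lborel (\<lambda>x. (f x - f (x - h)) * (f x - f (x - k)))" for h k
    by (intro Cc_integrable Cc_times Cc_diff Cc_shift f)
  have F: "integrable ((lborel \<Otimes>\<^sub>M lborel) \<Otimes>\<^sub>M lborel) (case_prod ?F)"
  proof (rule P.Fubini_integrable)
    show [measurable]: "case_prod ?F \<in> borel_measurable ((lborel \<Otimes>\<^sub>M lborel) \<Otimes>\<^sub>M lborel)" by measurable
    show "AE p in lborel \<Otimes>\<^sub>M lborel. integrable lborel (\<lambda>x. (case_prod ?F) (p, x))"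
      using fi by auto
    show "integrable (lborel \<Otimes>\<^sub>M lborel) (\<lambda>p. LINT x|lborel. norm ((case_prod ?F) (p, x)))"
    proof (rule Bochner_Integration.integrable_bound[where f="\<lambda>p. (B * C) * (kappa (fst p) * kappa (snd p))"])
      show "integrable (lborel \<Otimes>\<^sub>M lborel) (\<lambda>p. (B * C) * (kappa (fst p) * kappa (snd p)))"
        by (intro integrable_mult_right integrable_kappa_prod)
      show "(\<lambda>p. LINT x|lborel. norm ((case_prod ?F) (p, x))) \<in> borel_measurable (lborel \<Otimes>\<^sub>M lborel)" by measurable
      show "AE p in lborel \<Otimes>\<^sub>M lborel. norm (LINT x|lborel. norm ((case_prod ?F) (p, x))) \<le> norm ((B * C) * (kappa (fst p) * kappa (snd p)))"
      proof (rule AE_I2)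
        fix p :: "(real^'n) \<times> (real^'n)"
        let ?h = "fst p" and ?k = "snd p"
        have "norm (LINT x|lborel. norm ((case_prod ?F) (p, x))) = (LINT x|lborel. (\<bar>f x - f (x - ?h)\<bar> * \<bar>f x - f (x - ?k)\<bar>) * \<bar>b ?h \<bullet> b ?k\<bar>)"
          by (simp add: abs_mult)
        also have "\<dots> = (LINT x|lborel. \<bar>f x - f (x - ?h)\<bar> * \<bar>f x - f (x - ?k)\<bar>) * \<bar>b ?h \<bullet> b ?k\<bar>"
          by simp
        \<comment> \<open>The increment in \<open>h\<close> is estimated in the mean over
          \<open>x\<close>, the one in \<open>k\<close> uniformly. Estimating both uniformly would
          leave nothing integrable in \<open>x\<close>.\<close>
        also have "\<dots> \<le> (C * min 1 (norm ?h) * (B * min 1 (norm ?k))) * (norm (b ?h) * norm (b ?k))"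
        proof (rule mult_mono[OF _ Cauchy_Schwarz_ineq2])
          have "integrable lborel (\<lambda>x. \<bar>f x - f (x - ?h)\<bar> * \<bar>f x - f (x - ?k)\<bar>)"
            using integrable_abs[OF fi] by (simp add: abs_mult)
          moreover have "integrable lborel (\<lambda>x. \<bar>f x - f (x - ?h)\<bar> * (B * min 1 (norm ?k)))"
            by (intro integrable_mult_left integrable_abs Cc_integrable Cc_diff Cc_shift f)
          ultimately have "(LINT x|lborel. \<bar>f x - f (x - ?h)\<bar> * \<bar>f x - f (x - ?k)\<bar>) \<le> (LINT x|lborel. \<bar>f x - f (x - ?h)\<bar> * (B * min 1 (norm ?k)))"
            by (rule integral_mono) (auto intro!: mult_left_mono B)
          also have "\<dots> \<le> C * min 1 (norm ?h) * (B * min 1 (norm ?k))"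
            unfolding integral_mult_left_zero by (intro mult_right_mono C) (use B in auto)
          finally show "(LINT x|lborel. \<bar>f x - f (x - ?h)\<bar> * \<bar>f x - f (x - ?k)\<bar>) \<le> C * min 1 (norm ?h) * (B * min 1 (norm ?k))" .
          have "0 \<le> (LINT x|lborel. \<bar>f x - f (x - ?h)\<bar>)" by simp
          then have "0 \<le> C * min 1 (norm ?h)" using C by (rule order_trans)
          then show "0 \<le> C * min 1 (norm ?h) * (B * min 1 (norm ?k))" by (rule mult_nonneg_nonneg) (use B(1) in simp)
        qed simp
        also have "\<dots> = (B * C) * (kappa ?h * kappa ?k)" by (simp add: b_bound[symmetric] mult_ac)
        finally show "norm (LINT x|lborel. norm ((case_prod ?F) (p, x))) \<le> norm ((B * C) * (kappa ?h * kappa ?k))"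
          by (rule order_trans) simp
      qed
    qed
  qed
  have sq: "(norm (Dn f x))\<^sup>2 = (\<integral>p. ?F p x \<partial>(lborel \<Otimes>\<^sub>M lborel))" for x
  proof -
    let ?d = "\<lambda>h. f x - f (x - h)"
    have ie: "integrable lborel (\<lambda>h. ?d h * (b h $ j))" for j
      using integrable_b[where f="?d" and j=j and M=B] B(2) by simp
    have nth: "Dn f x $ j = (LINT h|lborel. ?d h * (b h $ j))" for j
    proof -
      have "(LINT h|lborel. (?d h *\<^sub>R b h) $ j) = Dn f x $ j"
        unfolding Dn_def by (rule integral_bounded_linear[OF bounded_linear_vec_nth Dn_integrable[OF f]])
      then show ?thesis by simp
    qed
    have "?F p x = (\<Sum>j\<in>UNIV. (?d (fst p) * (b (fst p) $ j)) * (?d (snd p) * (b (snd p) $ j)))" for p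
      by (simp only: inner_vec_def sum_distrib_left mult_ac inner_real_def)
    then have "(\<integral>p. ?F p x \<partial>(lborel \<Otimes>\<^sub>M lborel)) = (\<Sum>j\<in>UNIV. (Dn f x $ j) * (Dn f x $ j))"
      by (simp only: Bochner_Integration.integral_sum[OF lborel_pair.integral_pair_mult(1)[OF ie ie]]
          lborel_pair.integral_pair_mult(2)[OF ie ie] nth)
    then show ?thesis unfolding power2_norm_eq_inner inner_vec_def by simp
  qed
  show "integrable lborel (\<lambda>x. (norm (Dn f x))\<^sup>2)"
    unfolding sq using P.integrable_snd[OF F] by simp
  define G where "G h k = (autocorr f 0 - autocorr f h - autocorr f k + autocorr f (h - k)) * (b h \<bullet> b k)" for h k
  have Feq: "(LINT x|lborel. ?F p x) = G (fst p) (snd p)" for p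
    by (simp add: G_def autocorr_increments[OF f])
  have "integrable (lborel \<Otimes>\<^sub>M lborel) (\<lambda>p. LINT x|lborel. ?F p x)" using P.integrable_fst[OF F] by simp
  then have Gi: "integrable (lborel \<Otimes>\<^sub>M lborel) (case_prod G)" by (simp only: Feq case_prod_unfold)
  have "(LINT x|lborel. (norm (Dn f x))\<^sup>2) = (LINT x|lborel. (\<integral>p. ?F p x \<partial>(lborel \<Otimes>\<^sub>M lborel)))"
    by (simp only: sq)
  also have "\<dots> = (\<integral>p. (LINT x|lborel. ?F p x) \<partial>(lborel \<Otimes>\<^sub>M lborel))"
    using P.Fubini_integral[OF F] by simp
  also have "\<dots> = (\<integral>p. case_prod G p \<partial>(lborel \<Otimes>\<^sub>M lborel))" by (simp only: Feq case_prod_unfold)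
  also have "\<dots> = (LINT h|lborel. (LINT k|lborel. G h k))" by (rule lborel_pair.integral_fst[OF Gi, symmetric])
  \<comment> \<open>Reversing \<open>k\<close> turns \<open>A(h - k)\<close> into
    \<open>A(h + k)\<close>; since \<open>b\<close> is odd this is where the minus sign in front of
    \<open>L\<close> arises.\<close>
  also have "\<dots> = (LINT h|lborel. (LINT k|lborel. G h (- k)))" by (subst lborel_integral_uminus) simp
  also have "\<dots> = (LINT h|lborel. (LINT k|lborel. - (D2 ?A h k * (b h \<bullet> b k))))"
    by (simp add: G_def D2_def b_odd autocorr_even)
  also have "\<dots> = - (LINT h|lborel. (LINT k|lborel. D2 ?A h k * (b h \<bullet> b k)))" by simp
  also have "(LINT h|lborel. (LINT k|lborel. D2 ?A h k * (b h \<bullet> b k))) = L ?A"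
    unfolding L_def using lborel_pair.integral_fst'[OF L_Cc_integrable[OF autocorr_Cc[OF f]]] by simp
  finally show "(LINT x|lborel. (norm (Dn f x))\<^sup>2) = - L (autocorr f)" .
qed

end

text \<open>The cutoff \<open>\<theta> (n x)\<close> has derivatives of order \<open>n\<close> and \<open>n\<^sup>2\<close>, which the second order zero of
  \<open>g\<close> compensates.\<close>

lemma vanishing_cutoff_D2:
  fixes \<theta> g :: "real^'n::finite \<Rightarrow> real"
  assumes \<theta>: "\<theta> \<in> Cc_infinity UNIV" "\<And>x. norm x \<ge> 4 \<Longrightarrow> \<theta> x = 0"
    and gk: "\<And>k. C_k k g" and g0: "\<And>x. \<bar>g x\<bar> \<le> C" and g1: "\<And>x. \<bar>g x\<bar> \<le> C * (norm x)\<^sup>2"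
    and pg1: "\<And>i x. \<bar>pd i g x\<bar> \<le> C * norm x" and pg2: "\<And>i j x. \<bar>pd j (pd i g) x\<bar> \<le> C"
  obtains M where "\<And>n h k. n \<ge> 1 \<Longrightarrow> \<bar>D2 (\<lambda>x. \<theta> (n *\<^sub>R x) * g x) h k\<bar> \<le> M * min 1 (norm h) * min 1 (norm k)"
proof -
  obtain B0 where B0: "\<And>x. \<bar>\<theta> x\<bar> \<le> B0" using Cc_bounded[OF \<theta>(1)] by (metis real_norm_def)
  have "\<forall>i. \<exists>B. \<forall>x. norm (pd i \<theta> x) \<le> B" using Cc_bounded[OF pd_Cc[OF \<theta>(1)]] by metis
  then obtain B1 where B1: "\<And>i x. \<bar>pd i \<theta> x\<bar> \<le> B1 i" by (metis real_norm_def)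
  obtain B2 where B2: "\<And>i j x. norm (pd j (pd i \<theta>) x) \<le> B2" using Cc_second_difference[OF \<theta>(1)] by metis
  define B where "B = max B0 (max (Max (range B1)) B2)"
  have b0: "\<bar>\<theta> x\<bar> \<le> B" for x using B0[of x] by (simp add: B_def)
  have b1: "\<bar>pd i \<theta> x\<bar> \<le> B" for i x
  proof -
    have "B1 i \<le> Max (range B1)" by simp
    then have "\<bar>pd i \<theta> x\<bar> \<le> Max (range B1)" using B1[of i x] by linarith
    then show ?thesis unfolding B_def by (intro max.coboundedI2 max.coboundedI1)
  qed
  have b2: "\<bar>pd j (pd i \<theta>) x\<bar> \<le> B" for i j x using B2[of j i x] by (simp add: B_def)
  have Bn: "B \<ge> 0" using b0[of 0] by linarith
  have Cn: "C \<ge> 0" using g0[of 0] by linarith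
  define S where "S = {x::real^'n. norm x > 4}"
  have S: "open S" unfolding S_def by (intro open_Collect_less continuous_intros)
  have z0: "\<theta> y = 0" if "y \<in> S" for y using \<theta>(2) that by (simp add: S_def)
  have z1: "pd i \<theta> y = 0" if "y \<in> S" for i y by (rule pd_eq_0[OF S that]) (rule z0)
  have z2: "pd j (pd i \<theta>) y = 0" if "y \<in> S" for i j y by (rule pd_eq_0[OF S that]) (rule z1)
  let ?N = "real CARD('n)"
  \<comment> \<open>On the support of the cutoff \<open>n * norm x \<le> 4\<close>. The first
    derivatives of the product consist of terms bounded by \<open>4\<close> and \<open>16\<close>
    times \<open>B * C\<close>, the second ones of terms bounded by \<open>1\<close>,
    \<open>4\<close>, \<open>4\<close> and \<open>16\<close> times it; hence \<open>20\<close> and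
    \<open>25\<close>. The remaining factors come from \<open>D2_bound\<close> and the mean value
    inequalities.\<close>
  define M where "M = 4 * (B * C) + 2 * (?N * (20 * (B * C))) + ?N\<^sup>2 * (25 * (B * C))"
  have "\<bar>D2 (\<lambda>x. \<theta> (n *\<^sub>R x) * g x) h k\<bar> \<le> M * min 1 (norm h) * min 1 (norm k)" if n: "n \<ge> 1" for n :: real and h k
  proof -
    define \<theta>n where "\<theta>n x = \<theta> (n *\<^sub>R x)" for x
    have \<theta>nk: "C_k k \<theta>n" for k unfolding \<theta>n_def
      using C_k_affine[OF Cc_C_k[OF \<theta>(1)], of k 0 n] by simp
    have p1: "pd i \<theta>n = (\<lambda>x. n * pd i \<theta> (n *\<^sub>R x))" for i unfolding \<theta>n_def
      using pd_affine[OF Cc_C_k[OF \<theta>(1)], of i 0 n] by simp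
    have p2: "pd j (\<lambda>x. n * pd i \<theta> (n *\<^sub>R x)) = (\<lambda>x. n * (n * pd j (pd i \<theta>) (n *\<^sub>R x)))" for i j
    proof -
      have "C_k (Suc 0) (\<lambda>x. pd i \<theta> (n *\<^sub>R x))"
        using C_k_affine[OF Cc_C_k[OF pd_Cc[OF \<theta>(1)]], of "Suc 0" i 0 n] by simp
      from pd_linear[OF bounded_linear_mult_right[of n] this, of j]
      show ?thesis using pd_affine[OF Cc_C_k[OF pd_Cc[OF \<theta>(1)]], of j i 0 n] by simp
    qed
    let ?f = "\<lambda>x. \<theta>n x * g x"
    have fk: "C_k k ?f" for k by (intro C_k_mult \<theta>nk gk)
    have pf: "pd i ?f = (\<lambda>x. \<theta>n x * pd i g x + (n * pd i \<theta> (n *\<^sub>R x)) * g x)" for i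
      unfolding pd_mult[OF \<theta>nk gk] p1 ..
    have k1: "C_k k (\<lambda>x. n * pd i \<theta> (n *\<^sub>R x))" for k i
      using C_k_pd[OF \<theta>nk, of k i] by (simp add: p1)
    note pgk = C_k_pd[OF gk]
    have pff: "pd j (pd i ?f) x = \<theta>n x * pd j (pd i g) x + n * pd j \<theta> (n *\<^sub>R x) * pd i g x
       + (n * pd i \<theta> (n *\<^sub>R x) * pd j g x + n * (n * pd j (pd i \<theta>) (n *\<^sub>R x)) * g x)" for i j x
      unfolding pf pd_add[OF C_k_mult[OF \<theta>nk pgk] C_k_mult[OF k1 gk], of j i i]
        pd_mult[OF \<theta>nk pgk] pd_mult[OF k1 gk] p1 p2 ..
    have x4: "norm x \<le> 4" if "n * norm x \<le> 4" for x :: "real^'n"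
      using that mult_right_mono[OF n, of "norm x"] by simp
    have BC: "B * C \<ge> 0" using Bn Cn by simp
    have small: "\<bar>a * u\<bar> \<le> B * C * c" if "\<bar>a\<bar> \<le> B" "\<bar>u\<bar> \<le> C * c" for a u c
      using mult_mono[OF that] Bn by (simp add: abs_mult mult.assoc)
    have e1: "\<bar>pd i ?f x\<bar> \<le> 20 * (B * C)" for i x
    proof (cases "n *\<^sub>R x \<in> S")
      case True then show ?thesis using BC unfolding pf by (simp add: z0 z1 \<theta>n_def)
    next
      case False
      then have nx: "n * norm x \<le> 4" using n by (simp add: S_def)
      have "\<bar>\<theta>n x * pd i g x\<bar> \<le> B * C * norm x" by (rule small) (auto simp: \<theta>n_def b0 pg1)
      also have "\<dots> \<le> B * C * 4" by (intro mult_left_mono x4[OF nx] BC)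
      finally have t1: "\<bar>\<theta>n x * pd i g x\<bar> \<le> B * C * 4" .
      have "\<bar>pd i \<theta> (n *\<^sub>R x) * (n * g x)\<bar> \<le> B * C * (n * (norm x)\<^sup>2)"
        by (rule small) (use mult_left_mono[OF g1[of x], of n] n in \<open>auto simp: b1 abs_mult mult_ac\<close>)
      also have "\<dots> \<le> B * C * (4 * 4)" 
        using mult_mono[OF nx x4[OF nx]] BC by (intro mult_left_mono) (auto simp: power2_eq_square mult.assoc)
      finally have t2: "\<bar>pd i \<theta> (n *\<^sub>R x) * (n * g x)\<bar> \<le> B * C * (4 * 4)" .
      have "pd i ?f x = \<theta>n x * pd i g x + pd i \<theta> (n *\<^sub>R x) * (n * g x)" by (simp add: pf)
      then show ?thesis using t1 t2 by linarith
    qed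
    have e2: "\<bar>pd j (pd i ?f) x\<bar> \<le> 25 * (B * C)" for i j x
    proof (cases "n *\<^sub>R x \<in> S")
      case True then show ?thesis using BC unfolding pff by (simp add: z0 z1 z2 \<theta>n_def)
    next
      case False
      then have nx: "n * norm x \<le> 4" using n by (simp add: S_def)
      have t1: "\<bar>\<theta>n x * pd j (pd i g) x\<bar> \<le> B * C * 1" by (rule small) (auto simp: \<theta>n_def b0 pg2)
      have t2: "\<bar>pd j \<theta> (n *\<^sub>R x) * (n * pd i g x)\<bar> \<le> B * C * 4" for i j
      proof -
        have "\<bar>pd j \<theta> (n *\<^sub>R x) * (n * pd i g x)\<bar> \<le> B * C * (n * norm x)"
          by (rule small) (use mult_left_mono[OF pg1[of i x], of n] n in \<open>auto simp: b1 abs_mult mult_ac\<close>)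
        also have "\<dots> \<le> B * C * 4" by (intro mult_left_mono nx BC)
        finally show ?thesis .
      qed
      have "\<bar>pd j (pd i \<theta>) (n *\<^sub>R x) * (n * n * g x)\<bar> \<le> B * C * (n * n * (norm x)\<^sup>2)"
        by (rule small) (use mult_left_mono[OF g1[of x], of "n * n"] n in \<open>auto simp: b2 abs_mult mult_ac\<close>)
      also have "\<dots> \<le> B * C * (4 * 4)"
        using mult_mono[OF nx nx] BC n by (intro mult_left_mono) (auto simp: power2_eq_square mult_ac)
      finally have t3: "\<bar>pd j (pd i \<theta>) (n *\<^sub>R x) * (n * n * g x)\<bar> \<le> B * C * (4 * 4)" .
      have "pd j (pd i ?f) x = \<theta>n x * pd j (pd i g) x + pd j \<theta> (n *\<^sub>R x) * (n * pd i g x)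
         + (pd i \<theta> (n *\<^sub>R x) * (n * pd j g x) + pd j (pd i \<theta>) (n *\<^sub>R x) * (n * n * g x))"
        by (simp add: pff mult_ac)
      then show ?thesis using t1 t2[of j i] t2[of i j] t3 by linarith
    qed
    have "\<bar>D2 ?f h k\<bar> \<le> M * min 1 (norm h) * min 1 (norm k)"
    proof (rule D2_bound)
      show "\<bar>?f x\<bar> \<le> B * C" for x using small[OF b0[of "n *\<^sub>R x"], of "g x" 1] g0[of x] by (simp add: \<theta>n_def)
      show "\<bar>?f x - ?f y\<bar> \<le> (?N * (20 * (B * C))) * norm (x - y)" for x y
        using norm_pd_lipschitz[OF fk, of "20 * (B * C)"] e1 by simp
      show "\<bar>D2 ?f h k\<bar> \<le> (?N\<^sup>2 * (25 * (B * C))) * norm h * norm k"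
        using second_difference_bound[OF fk, of "25 * (B * C)" 0 h k] e2 by (simp add: D2_def)
      have nn: "?N * (20 * (B * C)) \<ge> 0" "?N\<^sup>2 * (25 * (B * C)) \<ge> 0" using BC by (auto intro!: mult_nonneg_nonneg)
      show "4 * (B * C) \<le> M" "2 * (?N * (20 * (B * C))) \<le> M" "?N\<^sup>2 * (25 * (B * C)) \<le> M"
        unfolding M_def using nn BC by linarith+
    qed
    then show ?thesis by (simp add: \<theta>n_def)
  qed
  then show ?thesis by (rule that)
qed

text \<open>Integrability is listed separately because the Bochner integral of a non-integrable
  function is \<open>0\<close>; it is what allows the passage to nonnegative integrals, where
  Fatou's lemma applies.\<close>

locale even_kernel_K = even_kernel r for r :: "real^'n::finite \<Rightarrow> real" +
  fixes K :: "real^'n \<Rightarrow> real"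
  assumes K_measurable[measurable]: "K \<in> borel_measurable borel"
    and K_nonneg: "K h \<ge> 0"
    and K_repr: "f \<in> Cc_infinity (- {0}) \<Longrightarrow> integrable lborel (\<lambda>x. K x * f x)"
      "f \<in> Cc_infinity (- {0}) \<Longrightarrow> (LINT x|lborel. K x * f x) = L f"
begin

text \<open>\<open>K_repr\<close> only applies away from \<open>0\<close>, so \<open>g = A(0) - A\<close> is tested through
  \<open>\<theta>(x / n) (1 - \<theta>(n x)) g(x)\<close>; Fatou and monotonicity give the two inequalities.\<close>

theorem K_autocorr:
  assumes f: "f \<in> Cc_infinity UNIV"
  shows "(\<integral>\<^sup>+h. ennreal (K h * (autocorr f 0 - autocorr f h)) \<partial>lborel) = ennreal (- L (autocorr f))"
proof -
  let ?A = "autocorr f"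
  note AC = autocorr_Cc[OF f]
  have [measurable]: "?A \<in> borel_measurable borel" using Cc_integrable[OF AC] by auto
  define g where "g x = ?A 0 - ?A x" for x
  have [measurable]: "g \<in> borel_measurable borel" unfolding g_def by measurable
  have gk: "C_k k g" for k unfolding g_def by (intro C_k_diff C_k_const Cc_C_k[OF AC])
  have gnn: "g x \<ge> 0" for x using autocorr_le[OF f, of x] by (simp add: g_def)
  have pg: "pd i g = (\<lambda>x. - pd i ?A x)" for i
  proof
    fix x
    have "(g has_derivative (\<lambda>h. 0 - (\<Sum>j\<in>UNIV. (h $ j) *\<^sub>R pd j ?A x))) (at x)"
      unfolding g_def by (intro has_derivative_diff has_derivative_const C_k_Suc_has_derivative[OF Cc_C_k[OF AC]])
    from pd_eq[OF this] show "pd i g x = - pd i ?A x" by (simp only: sum_axis_scaleR diff_0)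
  qed
  \<comment> \<open>Evenness kills the gradient of the autocorrelation at the origin. Together with
    the Taylor bound this is the second order zero of \<open>g\<close>.\<close>
  have pA0: "pd i ?A 0 = 0" for i
  proof -
    have "(\<lambda>x. ?A (0 + (-1) *\<^sub>R x)) = ?A" by (simp add: autocorr_even)
    then have "pd i ?A = (\<lambda>x. (-1) *\<^sub>R pd i ?A (0 + (-1) *\<^sub>R x))" using pd_affine[OF Cc_C_k[OF AC], of i 0 "-1"] by metis
    from fun_cong[OF this, of 0] show ?thesis by simp
  qed
  obtain C0 where C0: "\<And>x. norm (?A x) \<le> C0" using Cc_bounded[OF AC] by blast
  obtain C1 where "C1 > 0" and C1: "\<And>x h. norm (?A (x + h) - ?A x - (\<Sum>i\<in>UNIV. (h $ i) *\<^sub>R pd i ?A x)) \<le> C1 * (norm h)\<^sup>2"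
    using Cc_Taylor[OF AC] by metis
  have "\<exists>L. \<forall>x y. norm (pd i ?A x - pd i ?A y) \<le> L * norm (x - y)" for i
    by (rule Cc_lipschitz[OF pd_Cc[OF AC], of i]) blast
  then obtain C2 where C2: "\<And>i x y. norm (pd i ?A x - pd i ?A y) \<le> C2 i * norm (x - y)" by metis
  obtain C3 where C3: "\<And>i j x. norm (pd j (pd i ?A) x) \<le> C3" using Cc_second_difference[OF AC] by metis
  define C where "C = max (2 * C0) (max C1 (max (Max (range C2)) C3))"
  have g0: "\<bar>g x\<bar> \<le> C" for x using C0[of 0] C0[of x] by (simp add: g_def C_def)
  have g1: "\<bar>g x\<bar> \<le> C * (norm x)\<^sup>2" for x
  proof -
    have "\<bar>g x\<bar> \<le> C1 * (norm x)\<^sup>2" using C1[of 0 x] by (simp add: pA0 g_def abs_minus_commute)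
    also have "\<dots> \<le> C * (norm x)\<^sup>2" by (intro mult_right_mono) (auto simp: C_def)
    finally show ?thesis .
  qed
  have pg1: "\<bar>pd i g x\<bar> \<le> C * norm x" for i x
  proof -
    have "\<bar>pd i g x\<bar> \<le> C2 i * norm x" using C2[of i x 0] by (simp add: pA0 pg)
    also have "\<dots> \<le> C * norm x"
    proof (rule mult_right_mono)
      have "C2 i \<le> Max (range C2)" by simp
      then show "C2 i \<le> C" unfolding C_def by (simp only: le_max_iff_disj simp_thms)
    qed simp
    finally show ?thesis .
  qed
  have pg2: "\<bar>pd j (pd i g) x\<bar> \<le> C" for i j x
  proof -
    have "pd j (pd i g) x = - pd j (pd i ?A) x" unfolding pg
      using pd_linear[OF bounded_linear_minus[OF bounded_linear_ident] Cc_C_k[OF pd_Cc[OF AC]]] by metis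
    then show ?thesis using C3[of j i x] by (simp add: C_def)
  qed
  obtain \<theta> :: "real^'n \<Rightarrow> real" where \<theta>: "\<theta> \<in> Cc_infinity UNIV" "\<And>x. 0 \<le> \<theta> x" "\<And>x. \<theta> x \<le> 1"
    "\<And>x. norm x \<le> 1 \<Longrightarrow> \<theta> x = 1" "\<And>x. norm x \<ge> 4 \<Longrightarrow> \<theta> x = 0" using cutoff_exists by blast
  have [measurable]: "\<theta> \<in> borel_measurable borel" using Cc_integrable[OF \<theta>(1)] by auto
  \<comment> \<open>With \<open>n m \<ge> 2\<close> the inner cutoff, which vanishes beyond
    \<open>4 / n m\<close>, is supported where the outer one is still \<open>1\<close>, since
    \<open>4 / n m \<le> n m\<close>.\<close>
  define n where "n m = real (m + 2)" for m :: nat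
  have n: "n m \<ge> 2" for m by (simp add: n_def)
  have n_top: "eventually (\<lambda>m. n m \<ge> c) sequentially" for c
  proof (rule eventually_sequentiallyI)
    fix m assume "nat \<lceil>c\<rceil> \<le> m"
    then have "c \<le> real m" by linarith
    then show "c \<le> n m" by (simp add: n_def)
  qed
  define big where "big m x = \<theta> ((1 / n m) *\<^sub>R x)" for m x
  define small where "small m x = \<theta> (n m *\<^sub>R x)" for m x
  have bigC: "big m \<in> Cc_infinity UNIV" for m
    unfolding big_def[abs_def] using Cc_affine[OF \<theta>(1), of "1 / n m" 0] n[of m] by simp
  have smallC: "small m \<in> Cc_infinity UNIV" for m
    unfolding small_def[abs_def] using Cc_affine[OF \<theta>(1), of "n m" 0] n[of m] by simp
  have [measurable]: "big m \<in> borel_measurable borel" "small m \<in> borel_measurable borel" for m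
    unfolding big_def small_def by measurable
  have big1: "big m x = 1" if "norm x \<le> n m" for m x
    using that n[of m] by (auto simp: big_def intro!: \<theta>(4))
  have big0: "big m 0 = 1" for m using big1[of 0 m] n[of m] by simp
  have small0: "small m x = 0" if "n m * norm x \<ge> 4" for m x
    using that n[of m] by (auto simp: small_def intro!: \<theta>(5))
  have Lbig: "(\<lambda>m. L (big m)) \<longlonglongrightarrow> 0"
  proof -
    obtain M where M: "\<And>h k. \<bar>D2 \<theta> h k\<bar> \<le> M * min 1 (norm h) * min 1 (norm k)" using Cc_D2[OF \<theta>(1)] by blast
    have "\<bar>D2 \<theta> (axis undefined 1) (axis undefined 1)\<bar> \<le> M" using M[of "axis undefined 1" "axis undefined 1"] by simp
    then have M0: "M \<ge> 0" using abs_ge_zero order_trans by blast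
    show ?thesis
    proof (rule L_tendsto_0)
      fix m h k
      have "D2 (big m) h k = D2 \<theta> ((1 / n m) *\<^sub>R h) ((1 / n m) *\<^sub>R k)" by (simp add: D2_def big_def scaleR_add_right)
      also have "\<bar>\<dots>\<bar> \<le> M * min 1 (norm ((1 / n m) *\<^sub>R h)) * min 1 (norm ((1 / n m) *\<^sub>R k))" by (rule M)
      also have "\<dots> \<le> M * min 1 (norm h) * min 1 (norm k)"
      proof -
        have "norm ((1 / n m) *\<^sub>R v) \<le> norm v" for v :: "real^'n"
          using n[of m] mult_right_mono[of 1 "n m" "norm v"] by (simp add: field_simps)
        then have "min 1 (norm ((1 / n m) *\<^sub>R v)) \<le> min 1 (norm v)" for v :: "real^'n"
          by (meson min.mono order_refl)
        then show ?thesis using M0 by (intro mult_mono) (auto simp: mult_nonneg_nonneg)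
      qed
      finally show "\<bar>D2 (big m) h k\<bar> \<le> M * min 1 (norm h) * min 1 (norm k)" .
      \<comment> \<open>Once \<open>n m\<close> exceeds \<open>norm h + norm k\<close>, all four
        points of the second difference lie where the outer cutoff is \<open>1\<close>, and the
        values cancel.\<close>
      have "eventually (\<lambda>m. D2 (big m) h k = 0) sequentially"
        using n_top[of "norm h + norm k"]
        by eventually_elim (simp add: D2_def big0 big1 order_trans[OF norm_triangle_ineq] add_increasing add_increasing2
           order_trans[of "norm h" "norm h + norm k"] order_trans[of "norm k" "norm h + norm k"])
      then show "(\<lambda>m. D2 (big m) h k) \<longlonglongrightarrow> 0" by (rule tendsto_eventually)
    qed measurable
  qed
  have Lsmall: "(\<lambda>m. L (\<lambda>x. small m x * g x)) \<longlonglongrightarrow> 0"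
  proof -
    obtain M where M: "\<And>n h k. n \<ge> 1 \<Longrightarrow> \<bar>D2 (\<lambda>x. \<theta> (n *\<^sub>R x) * g x) h k\<bar> \<le> M * min 1 (norm h) * min 1 (norm k)"
      using vanishing_cutoff_D2[OF \<theta>(1,5) gk g0 g1 pg1 pg2] by blast
    show ?thesis
    proof (rule L_tendsto_0)
      show "\<bar>D2 (\<lambda>x. small m x * g x) h k\<bar> \<le> M * min 1 (norm h) * min 1 (norm k)" for m h k
        unfolding small_def using n[of m] by (intro M) simp
      have sg: "(\<lambda>m. small m x * g x) \<longlonglongrightarrow> 0" for x
      proof (cases "x = 0")
        case True then show ?thesis by (simp add: g_def)
      next
        case False
        have "eventually (\<lambda>m. small m x * g x = 0) sequentially"
          using n_top[of "4 / norm x"] by eventually_elim (use False in \<open>simp add: small0 field_simps\<close>)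
        then show ?thesis by (rule tendsto_eventually)
      qed
      have "(\<lambda>m. D2 (\<lambda>x. small m x * g x) h k) \<longlonglongrightarrow> 0 - 0 - 0 + 0" for h k
        unfolding D2_def by (intro tendsto_intros sg)
      then show "(\<lambda>m. D2 (\<lambda>x. small m x * g x) h k) \<longlonglongrightarrow> 0" for h k by simp
    qed measurable
  qed
  obtain R where R: "\<And>x. norm x > R \<Longrightarrow> ?A x = 0" using Cc_infinityD[OF AC] by blast
  define tst where "tst m x = big m x * (1 - small m x) * g x" for m x
  have [measurable]: "tst m \<in> borel_measurable borel" for m unfolding tst_def by measurable
  have tstC: "tst m \<in> Cc_infinity (- {0})" for m
  proof (rule Cc_infinity_punctured[where r="1 / n m"])
    show "tst m \<in> Cc_infinity UNIV" unfolding tst_def mult.assoc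
      by (intro Cc_mult bigC C_k_mult C_k_diff C_k_const gk Cc_C_k[OF smallC])
    show "1 / n m > 0" using n[of m] by simp
    show "tst m x = 0" if "norm x < 1 / n m" for x
      using that n[of m] \<theta>(4)[of "n m *\<^sub>R x"] by (simp add: tst_def small_def field_simps)
  qed
  have tstnn: "tst m x \<ge> 0" for m x
    unfolding tst_def by (intro mult_nonneg_nonneg gnn) (auto simp: big_def small_def \<theta>)
  have tstle: "tst m x \<le> g x" for m x
  proof -
    have "big m x * (1 - small m x) \<le> 1" by (rule mult_le_one) (auto simp: big_def small_def \<theta>)
    then show ?thesis unfolding tst_def using mult_right_mono[OF _ gnn[of x]] by fastforce
  qed
  have tstlim: "(\<lambda>m. tst m x) \<longlonglongrightarrow> g x" for x
  proof (cases "x = 0")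
    case True then show ?thesis by (simp add: g_def tst_def)
  next
    case False
    have "eventually (\<lambda>m. tst m x = g x) sequentially"
      using n_top[of "4 / norm x"] n_top[of "norm x"] by eventually_elim (use False in \<open>simp add: small0 big1 field_simps tst_def\<close>)
    then show ?thesis by (rule tendsto_eventually)
  qed
  \<comment> \<open>As soon as the outer cutoff equals \<open>1\<close> on the support of
    \<open>A\<close>, the truncated function is \<open>A(0)\<close> times the outer cutoff, minus
    \<open>A\<close>, minus the inner cutoff times \<open>g\<close>. The first and last terms
    contribute nothing in the limit.\<close>
  have "eventually (\<lambda>m. L (tst m) = (?A 0 * L (big m) - L ?A) - L (\<lambda>x. small m x * g x)) sequentially"
    using n_top[of R]
  proof eventually_elim
    case (elim m)
    have "tst m x = 1 * (?A 0 * big m x - ?A x) - small m x * g x" for x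
    proof (cases "norm x \<le> n m")
      case True then show ?thesis by (simp add: tst_def big1 g_def algebra_simps)
    next
      case False
      then have "norm x > n m" by simp
      moreover have "4 \<le> n m * norm x" using mult_mono[OF n[of m] n[of m]] calculation n[of m] 
        by (smt (verit) mult_left_mono)
      ultimately show ?thesis using R[of x] elim by (simp add: tst_def small0 g_def)
    qed
    then have "tst m = (\<lambda>x. 1 * (?A 0 * big m x - ?A x) - small m x * g x)" by auto
    moreover have "(\<lambda>x. ?A 0 * big m x - ?A x) \<in> Cc_infinity UNIV"
      using Cc_diff[OF Cc_scaleR[OF bigC, of "?A 0" m] AC] by simp
    ultimately show ?case
      using L_lincomb[OF _ Cc_mult[OF smallC gk], of "\<lambda>x. ?A 0 * big m x - ?A x" 1 m] L_lincomb[OF bigC AC, of "?A 0" m] by simp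
  qed
  moreover have "(\<lambda>m. (?A 0 * L (big m) - L ?A) - L (\<lambda>x. small m x * g x)) \<longlonglongrightarrow> (?A 0 * 0 - L ?A) - 0"
    by (intro tendsto_intros Lbig Lsmall)
  ultimately have lim: "(\<lambda>m. L (tst m)) \<longlonglongrightarrow> - L ?A"
    by (subst (asm) tendsto_cong[symmetric, of "\<lambda>m. L (tst m)"]) simp_all
  have I: "(\<integral>\<^sup>+x. ennreal (K x * tst m x) \<partial>lborel) = ennreal (L (tst m))" for m
    using nn_integral_eq_integral[OF K_repr(1)[OF tstC[of m]]] K_repr(2)[OF tstC[of m]] by (simp add: K_nonneg tstnn)
  have limE: "(\<lambda>m. ennreal (L (tst m))) \<longlonglongrightarrow> ennreal (- L ?A)" by (rule tendsto_ennrealI[OF lim])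
  show ?thesis
  proof (rule antisym)
    have "(\<integral>\<^sup>+x. ennreal (K x * g x) \<partial>lborel) = (\<integral>\<^sup>+x. liminf (\<lambda>m. ennreal (K x * tst m x)) \<partial>lborel)"
    proof (rule nn_integral_cong)
      fix x
      have "(\<lambda>m. ennreal (K x * tst m x)) \<longlonglongrightarrow> ennreal (K x * g x)"
        by (intro tendsto_ennrealI tendsto_intros tstlim)
      then show "ennreal (K x * g x) = liminf (\<lambda>m. ennreal (K x * tst m x))" by (simp add: lim_imp_Liminf)
    qed
    also have "\<dots> \<le> liminf (\<lambda>m. \<integral>\<^sup>+x. ennreal (K x * tst m x) \<partial>lborel)" by (rule nn_integral_liminf) measurable
    also have "\<dots> = ennreal (- L ?A)" unfolding I using limE by (simp add: lim_imp_Liminf)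
    finally show "(\<integral>\<^sup>+h. ennreal (K h * (?A 0 - ?A h)) \<partial>lborel) \<le> ennreal (- L ?A)" by (simp add: g_def)
    show "ennreal (- L ?A) \<le> (\<integral>\<^sup>+h. ennreal (K h * (?A 0 - ?A h)) \<partial>lborel)"
    proof (rule LIMSEQ_le_const2[OF limE], intro exI allI impI)
      fix m
      show "ennreal (L (tst m)) \<le> (\<integral>\<^sup>+h. ennreal (K h * (?A 0 - ?A h)) \<partial>lborel)"
        unfolding I[symmetric] by (intro nn_integral_mono ennreal_leI mult_left_mono K_nonneg) (use tstle in \<open>simp add: g_def\<close>)
    qed
  qed
qed

text \<open>The quadratic form of \<open>bilinear_form K\<close>, in the shifted variable \<open>h = x - y\<close>.\<close>

definition energy :: "(real^'n \<Rightarrow> real) \<Rightarrow> ennreal" where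
  "energy u = (\<integral>\<^sup>+h. ennreal (K h) * (\<integral>\<^sup>+x. ennreal ((u x - u (x - h))\<^sup>2) \<partial>lborel) \<partial>lborel)"

text \<open>The factor \<open>2\<close> is that of \<open>autocorr_square\<close>: the squared norm
  of the increment by \<open>h\<close> is twice \<open>A(0) - A(h)\<close>.\<close>

theorem energy_Cc:
  assumes f: "f \<in> Cc_infinity UNIV"
  shows "energy f = ennreal (2 * (LINT x|lborel. (norm (Dn f x))\<^sup>2))"
proof -
  have [measurable]: "autocorr f \<in> borel_measurable borel" using Cc_integrable[OF autocorr_Cc[OF f]] by auto
  have "(\<integral>\<^sup>+x. ennreal ((f x - f (x - h))\<^sup>2) \<partial>lborel) = ennreal (2 * (autocorr f 0 - autocorr f h))" for h
  proof -
    have "integrable lborel (\<lambda>x. (f x - f (x - h))\<^sup>2)" unfolding power2_eq_square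
      by (intro Cc_integrable Cc_times Cc_diff Cc_shift f)
    then show ?thesis by (subst nn_integral_eq_integral) (auto simp: autocorr_square[OF f])
  qed
  note incr = this
  have "energy f = (\<integral>\<^sup>+h. ennreal 2 * ennreal (K h * (autocorr f 0 - autocorr f h)) \<partial>lborel)"
    unfolding energy_def
  proof (intro nn_integral_cong)
    fix h
    have "0 \<le> autocorr f 0 - autocorr f h" using autocorr_le[OF f, of h] by simp
    then have "ennreal (K h) * ennreal (2 * (autocorr f 0 - autocorr f h)) = ennreal 2 * ennreal (K h * (autocorr f 0 - autocorr f h))"
      by (simp only: ennreal_mult[symmetric] K_nonneg mult_nonneg_nonneg zero_le_numeral) (simp only: mult_ac)
    then show "ennreal (K h) * (\<integral>\<^sup>+x. ennreal ((f x - f (x - h))\<^sup>2) \<partial>lborel) = ennreal 2 * ennreal (K h * (autocorr f 0 - autocorr f h))"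
      by (simp only: incr)
  qed
  also have "\<dots> = ennreal 2 * ennreal (- L (autocorr f))"
    unfolding K_autocorr[OF f, symmetric] by (rule nn_integral_cmult) measurable
  also have "\<dots> = ennreal (2 * (LINT x|lborel. (norm (Dn f x))\<^sup>2))"
    unfolding Dn_norm_eq_L(2)[OF f] by (rule ennreal_mult'[symmetric]) simp
  finally show ?thesis .
qed

end

section \<open>The space as bounded limits of test functions\<close>

text \<open>Squares of norms are kept throughout: the parallelogram identity is then linear in them,
  and the triangle inequality is replaced by its quadratic form with factors
  \<open>2\<close>.\<close>

definition nsq :: "('a::euclidean_space \<Rightarrow> 'b::euclidean_space) \<Rightarrow> real" where
  "nsq f = (LINT x|lborel. (norm (f x))\<^sup>2)"

definition sqint :: "('a::euclidean_space \<Rightarrow> 'b::euclidean_space) \<Rightarrow> bool" where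
  "sqint f \<longleftrightarrow> f \<in> borel_measurable borel \<and> integrable lborel (\<lambda>x. (norm (f x))\<^sup>2)"

lemma sqint_measurable: "sqint f \<Longrightarrow> f \<in> borel_measurable borel"
  and sqint_integrable: "sqint f \<Longrightarrow> integrable lborel (\<lambda>x. (norm (f x))\<^sup>2)"
  by (simp_all add: sqint_def)

lemma nsq_nonneg: "nsq f \<ge> 0" by (simp add: nsq_def)

lemma norm_sq_parallelogram:
  fixes a c :: "'b::euclidean_space"
  shows "(norm (a - c))\<^sup>2 = 2 * (norm a)\<^sup>2 + 2 * (norm c)\<^sup>2 - (norm (a + c))\<^sup>2"
  by (simp add: power2_norm_eq_inner inner_add_left inner_add_right inner_diff_left inner_diff_right inner_commute)

lemma norm_sq_diff_le:
  fixes a c :: "'b::euclidean_space"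
  shows "(norm (a - c))\<^sup>2 \<le> 2 * (norm a)\<^sup>2 + 2 * (norm c)\<^sup>2"
  by (simp add: norm_sq_parallelogram)

lemma sqint_bound:
  assumes "f \<in> borel_measurable borel" "sqint g" "\<And>x. norm (f x) \<le> norm (g x)"
  shows "sqint f"
  unfolding sqint_def
proof
  note [measurable] = assms(1)
  show "integrable lborel (\<lambda>x. (norm (f x))\<^sup>2)"
    by (rule Bochner_Integration.integrable_bound[OF sqint_integrable[OF assms(2)]])
       (auto intro!: AE_I2 power_mono assms(3))
qed (rule assms(1))

lemma sqint_diff:
  assumes "sqint f" "sqint g"
  shows "sqint (\<lambda>x. f x - g x)"
  unfolding sqint_def
proof
  note [measurable] = sqint_measurable[OF assms(1)] sqint_measurable[OF assms(2)]
  show "(\<lambda>x. f x - g x) \<in> borel_measurable borel" by measurable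
  show "integrable lborel (\<lambda>x. (norm (f x - g x))\<^sup>2)"
  proof (rule Bochner_Integration.integrable_bound[where f="\<lambda>x. 2 * (norm (f x))\<^sup>2 + 2 * (norm (g x))\<^sup>2"])
    show "integrable lborel (\<lambda>x. 2 * (norm (f x))\<^sup>2 + 2 * (norm (g x))\<^sup>2)"
      by (intro Bochner_Integration.integrable_add integrable_mult_right sqint_integrable assms)
  qed (auto intro!: AE_I2 norm_sq_diff_le)
qed

lemma sqint_uminus: "sqint f \<Longrightarrow> sqint (\<lambda>x. - f x)"
  by (simp add: sqint_def)

lemma sqint_add: "sqint f \<Longrightarrow> sqint g \<Longrightarrow> sqint (\<lambda>x. f x + g x)"
  using sqint_diff[OF _ sqint_uminus, of f g] by simp

lemma sqint_scaleR: "sqint f \<Longrightarrow> sqint (\<lambda>x. c *\<^sub>R f x)"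
  by (auto simp: sqint_def power_mult_distrib)

lemma nsq_diff_le:
  assumes "sqint f" "sqint g"
  shows "nsq (\<lambda>x. f x - g x) \<le> 2 * nsq f + 2 * nsq g"
proof -
  note i = sqint_integrable[OF assms(1)] sqint_integrable[OF assms(2)]
  have "nsq (\<lambda>x. f x - g x) \<le> (LINT x|lborel. 2 * (norm (f x))\<^sup>2 + 2 * (norm (g x))\<^sup>2)"
    unfolding nsq_def using i sqint_integrable[OF sqint_diff[OF assms]]
    by (intro integral_mono norm_sq_diff_le Bochner_Integration.integrable_add integrable_mult_right)
  also have "\<dots> = 2 * nsq f + 2 * nsq g" using i by (simp add: nsq_def)
  finally show ?thesis .
qed

lemma nsq_triangle:
  assumes "sqint f" "sqint g" "sqint h"
  shows "nsq (\<lambda>x. f x - h x) \<le> 2 * nsq (\<lambda>x. f x - g x) + 2 * nsq (\<lambda>x. g x - h x)"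
proof -
  have "nsq (\<lambda>x. (f x - g x) - (h x - g x)) \<le> 2 * nsq (\<lambda>x. f x - g x) + 2 * nsq (\<lambda>x. h x - g x)"
    by (intro nsq_diff_le sqint_diff assms)
  then show ?thesis by (simp add: nsq_def norm_minus_commute)
qed

lemma nsq_parallelogram:
  assumes "sqint f" "sqint g"
  shows "nsq (\<lambda>x. f x - g x) = 2 * nsq f + 2 * nsq g - 4 * nsq (\<lambda>x. (1/2) *\<^sub>R f x + (1/2) *\<^sub>R g x)"
proof -
  note i = sqint_integrable[OF assms(1)] sqint_integrable[OF assms(2)]
  have *: "(norm (f x - g x))\<^sup>2 = 2 * (norm (f x))\<^sup>2 + 2 * (norm (g x))\<^sup>2 - 4 * (norm ((1/2) *\<^sub>R f x + (1/2) *\<^sub>R g x))\<^sup>2" for x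
    unfolding norm_sq_parallelogram scaleR_add_right[symmetric] by (simp add: power_mult_distrib power2_eq_square)
  have "sqint (\<lambda>x. (1/2) *\<^sub>R f x + (1/2) *\<^sub>R g x)" by (intro sqint_add sqint_scaleR assms)
  from sqint_integrable[OF this] i show ?thesis unfolding nsq_def * by simp
qed

lemma Cc_sqint:
  fixes f :: "real^'n::finite \<Rightarrow> real"
  assumes "f \<in> Cc_infinity UNIV" shows "sqint f"
  unfolding sqint_def using Cc_integrable[OF assms] Cc_integrable[OF Cc_times[OF assms assms]]
  by (auto simp: power2_eq_square)

lemma AE_lborel_shift:
  fixes t :: "'a::euclidean_space"
  assumes "AE x in lborel. P x" shows "AE x in lborel. P (x - t)"
proof -
  have "AE x in distr lborel borel ((+) (- t)). P x" using assms by (simp only: lborel_distr_plus)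
  then show ?thesis using AE_distrD[of "(+) (- t)" lborel borel P] by simp
qed

section \<open>Lower semicontinuity and bounded approximation\<close>

context even_kernel_K
begin

lemma energy_alt:
  assumes [measurable]: "u \<in> borel_measurable borel"
  shows "energy u = (\<integral>\<^sup>+h. (\<integral>\<^sup>+x. ennreal (K h * (u x - u (x - h))\<^sup>2) \<partial>lborel) \<partial>lborel)"
  unfolding energy_def
proof (rule nn_integral_cong)
  fix h
  show "ennreal (K h) * (\<integral>\<^sup>+x. ennreal ((u x - u (x - h))\<^sup>2) \<partial>lborel) = (\<integral>\<^sup>+x. ennreal (K h * (u x - u (x - h))\<^sup>2) \<partial>lborel)"
    by (subst nn_integral_cmult[symmetric]) (auto simp: ennreal_mult K_nonneg)
qed

text \<open>Convergence in the mean square gives an almost everywhere convergent subsequence;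
  translating its exceptional set by \<open>h\<close> handles the increments. Fatou's lemma is then
  applied in \<open>x\<close> and again in \<open>h\<close>, which needs
  \<open>K \<ge> 0\<close>.\<close>

lemma energy_lsc:
  assumes u: "\<And>k. sqint (u k)" "sqint v" and lim: "(\<lambda>k. nsq (\<lambda>x. u k x - v x)) \<longlonglongrightarrow> 0"
    and le: "\<And>k. energy (u k) \<le> C"
  shows "energy v \<le> C"
proof -
  note [measurable] = sqint_measurable[OF u(1)] sqint_measurable[OF u(2)]
  obtain s where s: "strict_mono s" "AE x in lborel. (\<lambda>k. (norm (u (s k) x - v x))\<^sup>2) \<longlonglongrightarrow> 0"
    using tendsto_L1_AE_subseq[where u="\<lambda>k x. (norm (u k x - v x))\<^sup>2" and M=lborel] lim
      sqint_integrable[OF sqint_diff[OF u]] by (auto simp: nsq_def)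
  have ae: "AE x in lborel. (\<lambda>k. u (s k) x) \<longlonglongrightarrow> v x"
    using s(2)
  proof eventually_elim
    case (elim x)
    have "(\<lambda>k. sqrt ((norm (u (s k) x - v x))\<^sup>2)) \<longlonglongrightarrow> sqrt 0" by (intro tendsto_intros elim)
    then show ?case by (simp add: tendsto_norm_zero_iff LIM_zero_iff tendsto_rabs_zero_iff)
  qed
  let ?J = "\<lambda>w h. \<integral>\<^sup>+x. ennreal (K h * (w x - w (x - h))\<^sup>2) \<partial>lborel"
  have inner: "?J v h \<le> liminf (\<lambda>k. ?J (u (s k)) h)" for h
  proof -
    have "?J v h = (\<integral>\<^sup>+x. liminf (\<lambda>k. ennreal (K h * (u (s k) x - u (s k) (x - h))\<^sup>2)) \<partial>lborel)"
    proof (rule nn_integral_cong_AE)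
      show "AE x in lborel. ennreal (K h * (v x - v (x - h))\<^sup>2) = liminf (\<lambda>k. ennreal (K h * (u (s k) x - u (s k) (x - h))\<^sup>2))"
        using ae AE_lborel_shift[OF ae, of h]
      proof eventually_elim
        case (elim x)
        have "(\<lambda>k. ennreal (K h * (u (s k) x - u (s k) (x - h))\<^sup>2)) \<longlonglongrightarrow> ennreal (K h * (v x - v (x - h))\<^sup>2)"
          by (intro tendsto_ennrealI tendsto_intros elim)
        then show ?case by (rule lim_imp_Liminf[OF sequentially_bot, symmetric])
      qed
    qed
    also have "\<dots> \<le> liminf (\<lambda>k. ?J (u (s k)) h)" by (rule nn_integral_liminf) measurable
    finally show ?thesis .
  qed
  have "energy v \<le> (\<integral>\<^sup>+h. liminf (\<lambda>k. ?J (u (s k)) h) \<partial>lborel)"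
    unfolding energy_alt[OF sqint_measurable[OF u(2)]] by (rule nn_integral_mono) (rule inner)
  also have "\<dots> \<le> liminf (\<lambda>k. energy (u (s k)))"
    unfolding energy_alt[OF sqint_measurable[OF u(1)]] by (rule nn_integral_liminf) measurable
  also have "\<dots> \<le> liminf (\<lambda>k::nat. C)" by (intro Liminf_mono always_eventually allI le)
  also have "\<dots> = C" by (simp add: Liminf_const)
  finally show ?thesis .
qed

lemma Dn_sqint:
  assumes "f \<in> Cc_infinity UNIV" shows "sqint (Dn f)"
proof -
  have [measurable]: "f \<in> borel_measurable borel" using Cc_integrable[OF assms] by auto
  show ?thesis unfolding sqint_def using Dn_norm_eq_L(1)[OF assms] by simp
qed

lemma energy_Cc_nsq: "f \<in> Cc_infinity UNIV \<Longrightarrow> energy f = ennreal (2 * nsq (Dn f))"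
  by (simp add: energy_Cc nsq_def)

text \<open>The bound \<open>C\<close> does not depend on \<open>\<delta>\<close>. Asking for
  bounded instead of Cauchy gradients makes the property stable under truncation, which controls the
  size of a gradient but not the difference of two.\<close>

definition approximable :: "(real^'n \<Rightarrow> real) \<Rightarrow> bool" where
  "approximable u \<longleftrightarrow> sqint u \<and>
     (\<exists>C. \<forall>\<delta>>0. \<exists>f\<in>Cc_infinity UNIV. nsq (\<lambda>x. f x - u x) \<le> \<delta> \<and> nsq (Dn f) \<le> C)"

lemma approximable_seq:
  assumes "approximable u"
  shows "\<exists>C f. (\<forall>k. f k \<in> Cc_infinity UNIV) \<and> (\<forall>k. nsq (Dn (f k)) \<le> C) \<and> (\<lambda>k. nsq (\<lambda>x. f k x - u x)) \<longlonglongrightarrow> 0"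
proof -
  obtain C where C: "\<And>\<delta>. \<delta> > 0 \<Longrightarrow> \<exists>f\<in>Cc_infinity UNIV. nsq (\<lambda>x. f x - u x) \<le> \<delta> \<and> nsq (Dn f) \<le> C"
    using assms unfolding approximable_def by blast
  have "\<exists>f\<in>Cc_infinity UNIV. nsq (\<lambda>x. f x - u x) \<le> inverse (real (Suc k)) \<and> nsq (Dn f) \<le> C" for k
    by (rule C) simp
  then obtain f where f: "\<And>k. f k \<in> Cc_infinity UNIV" "\<And>k. nsq (\<lambda>x. f k x - u x) \<le> inverse (real (Suc k))" "\<And>k. nsq (Dn (f k)) \<le> C"
    by metis
  have "(\<lambda>k. nsq (\<lambda>x. f k x - u x)) \<longlonglongrightarrow> 0"
    by (intro tendsto_sandwich[OF _ _ tendsto_const LIMSEQ_inverse_real_of_nat] always_eventually allI f(2) nsq_nonneg)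
  then show ?thesis using f(1,3) by (intro exI conjI allI)
qed

lemma approximable_energy:
  assumes "approximable u" shows "energy u < \<infinity>"
proof -
  obtain C f where f': "\<forall>k. f k \<in> Cc_infinity UNIV" "\<forall>k. nsq (Dn (f k)) \<le> C" "(\<lambda>k. nsq (\<lambda>x. f k x - u x)) \<longlonglongrightarrow> 0"
    using approximable_seq[OF assms] by blast
  note f = f'(1)[rule_format] f'(2)[rule_format] f'(3)
  have "energy u \<le> ennreal (2 * C)"
    by (rule energy_lsc[OF Cc_sqint[OF f(1)] _ f(3)]) (use assms f in \<open>auto simp: approximable_def energy_Cc_nsq intro!: ennreal_leI\<close>)
  then show ?thesis unfolding infinity_ennreal_def using le_less_trans ennreal_less_top by blast
qed

lemma approximable_diff:
  assumes "approximable u" "approximable v"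
  shows "approximable (\<lambda>x. u x - v x)"
proof -
  obtain C where C: "\<And>\<delta>. \<delta> > 0 \<Longrightarrow> \<exists>f\<in>Cc_infinity UNIV. nsq (\<lambda>x. f x - u x) \<le> \<delta> \<and> nsq (Dn f) \<le> C"
    using assms(1) unfolding approximable_def by blast
  obtain C' where C': "\<And>\<delta>. \<delta> > 0 \<Longrightarrow> \<exists>f\<in>Cc_infinity UNIV. nsq (\<lambda>x. f x - v x) \<le> \<delta> \<and> nsq (Dn f) \<le> C'"
    using assms(2) unfolding approximable_def by blast
  have u: "sqint u" "sqint v" using assms by (auto simp: approximable_def)
  have "\<exists>f\<in>Cc_infinity UNIV. nsq (\<lambda>x. f x - (u x - v x)) \<le> \<delta> \<and> nsq (Dn f) \<le> 2 * C + 2 * C'" if \<delta>: "\<delta> > 0" for \<delta>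
  proof -
    obtain f where f: "f \<in> Cc_infinity UNIV" "nsq (\<lambda>x. f x - u x) \<le> \<delta> / 4" "nsq (Dn f) \<le> C" using C[of "\<delta> / 4"] \<delta> by auto
    obtain g where g: "g \<in> Cc_infinity UNIV" "nsq (\<lambda>x. g x - v x) \<le> \<delta> / 4" "nsq (Dn g) \<le> C'" using C'[of "\<delta> / 4"] \<delta> by auto
    show ?thesis
    proof (intro bexI conjI)
      show "(\<lambda>x. f x - g x) \<in> Cc_infinity UNIV" by (intro Cc_diff f g)
      have "nsq (\<lambda>x. (f x - u x) - (g x - v x)) \<le> 2 * nsq (\<lambda>x. f x - u x) + 2 * nsq (\<lambda>x. g x - v x)"
        by (intro nsq_diff_le sqint_diff Cc_sqint f g u)
      then show "nsq (\<lambda>x. (f x - g x) - (u x - v x)) \<le> \<delta>" using f(2) g(2) by (simp add: algebra_simps)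
      have "Dn (\<lambda>x. f x - g x) = (\<lambda>x. Dn f x - Dn g x)"
        using Dn_lincomb[OF f(1) g(1), of 1 "-1"] by auto
      then show "nsq (Dn (\<lambda>x. f x - g x)) \<le> 2 * C + 2 * C'"
        using nsq_diff_le[OF Dn_sqint[OF f(1)] Dn_sqint[OF g(1)]] f(3) g(3) by simp
    qed
  qed
  then show ?thesis using sqint_diff[OF u] by (auto simp: approximable_def)
qed

text \<open>Minimising \<open>nsq (Dn f)\<close> over the convex sets of test functions close to \<open>u\<close> turns a bounded
  approximating sequence into a Cauchy one, by the parallelogram identity.\<close>

lemma approximable_Cauchy:
  assumes "approximable u"
  shows "\<exists>f. (\<forall>k. f k \<in> Cc_infinity UNIV) \<and> (\<lambda>k. nsq (\<lambda>x. f k x - u x)) \<longlonglongrightarrow> 0 \<and>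
    (\<forall>e>0. \<exists>N. \<forall>k\<ge>N. \<forall>m\<ge>N. nsq (\<lambda>x. Dn (f k) x - Dn (f m) x) < e)"
proof -
  obtain C where C: "\<And>\<delta>. \<delta> > 0 \<Longrightarrow> \<exists>f\<in>Cc_infinity UNIV. nsq (\<lambda>x. f x - u x) \<le> \<delta> \<and> nsq (Dn f) \<le> C"
    using assms unfolding approximable_def by blast
  have u: "sqint u" using assms by (simp add: approximable_def)
  define \<epsilon> where "\<epsilon> k = inverse (real (Suc k))" for k
  have \<epsilon>: "\<epsilon> k > 0" for k by (simp add: \<epsilon>_def)
  have \<epsilon>0: "\<epsilon> \<longlonglongrightarrow> 0" unfolding \<epsilon>_def by (rule LIMSEQ_inverse_real_of_nat)
  have \<epsilon>mono: "\<epsilon> m \<le> \<epsilon> k" if "k \<le> m" for k m using that by (simp add: \<epsilon>_def field_simps)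
  define S where "S k = {f \<in> Cc_infinity UNIV. nsq (\<lambda>x. f x - u x) \<le> \<epsilon> k}" for k
  define d where "d k = (INF f\<in>S k. nsq (Dn f))" for k
  have bdd: "bdd_below ((\<lambda>f. nsq (Dn f)) ` S k)" for k by (rule bdd_belowI[where m=0]) (auto simp: nsq_nonneg)
  have ne: "\<exists>f\<in>S k. nsq (Dn f) \<le> C" for k using C[OF \<epsilon>[of k]] by (auto simp: S_def)
  have Smono: "S m \<subseteq> S k" if "k \<le> m" for k m using \<epsilon>mono[OF that] by (auto simp: S_def)
  have dle: "d k \<le> nsq (Dn f)" if "f \<in> S k" for f k unfolding d_def by (rule cINF_lower[OF bdd that])
  have dmono: "d k \<le> d m" if "k \<le> m" for k m
    unfolding d_def
  proof (rule cINF_superset_mono)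
    show "S m \<noteq> {}" using ne[of m] by blast
  qed (rule bdd Smono[OF that] order_refl)+
  have dC: "d k \<le> C" for k using ne[of k] dle order_trans by blast
  have "\<exists>f. f \<in> S k \<and> nsq (Dn f) < d k + \<epsilon> k" for k
  proof -
    have "S k \<noteq> {}" using ne[of k] by blast
    then have "\<exists>f\<in>S k. nsq (Dn f) < d k + \<epsilon> k"
      using cINF_less_iff[OF _ bdd[of k], of "d k + \<epsilon> k"] \<epsilon>[of k] unfolding d_def by simp
    then show ?thesis by blast
  qed
  then obtain f where f: "\<And>k. f k \<in> S k" "\<And>k. nsq (Dn (f k)) < d k + \<epsilon> k" by metis
  have fC: "f k \<in> Cc_infinity UNIV" for k using f(1)[of k] by (simp add: S_def)
  have est: "nsq (\<lambda>x. Dn (f k) x - Dn (f m) x) \<le> 2 * (d m - d k) + 4 * \<epsilon> k" if km: "k \<le> m" for k m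
  proof -
    \<comment> \<open>The midpoint is again admissible at level \<open>k\<close> by convexity, so
      its gradient norm is at least \<open>d k\<close>, while those of \<open>f k\<close> and
      \<open>f m\<close> are almost minimal. The parallelogram identity then leaves little room for
      the difference of the gradients.\<close>
    define g where "g x = (1/2) * f k x + (1/2) * f m x" for x
    have fm: "f m \<in> S k" using f(1)[of m] Smono[OF km] by blast
    have "g \<in> S k"
    proof -
      have gC: "g \<in> Cc_infinity UNIV" unfolding g_def using Cc_add[OF Cc_scaleR[OF fC, of "1/2" k] Cc_scaleR[OF fC, of "1/2" m]] by simp
      have "nsq (\<lambda>x. (f k x - u x) - (f m x - u x)) = 2 * nsq (\<lambda>x. f k x - u x) + 2 * nsq (\<lambda>x. f m x - u x)
          - 4 * nsq (\<lambda>x. (1/2) *\<^sub>R (f k x - u x) + (1/2) *\<^sub>R (f m x - u x))"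
        by (intro nsq_parallelogram sqint_diff Cc_sqint fC u)
      moreover have "(\<lambda>x. (1/2) *\<^sub>R (f k x - u x) + (1/2) *\<^sub>R (f m x - u x)) = (\<lambda>x. g x - u x)"
        by (auto simp: g_def algebra_simps)
      moreover have "nsq (\<lambda>x. f k x - u x) \<le> \<epsilon> k" "nsq (\<lambda>x. f m x - u x) \<le> \<epsilon> k"
        using f(1)[of k] fm by (auto simp: S_def)
      ultimately have "nsq (\<lambda>x. g x - u x) \<le> \<epsilon> k" using nsq_nonneg[of "\<lambda>x. (f k x - u x) - (f m x - u x)"] by simp
      with gC show ?thesis by (simp add: S_def)
    qed
    then have "d k \<le> nsq (Dn g)" by (rule dle)
    moreover have "Dn g = (\<lambda>x. (1/2) *\<^sub>R Dn (f k) x + (1/2) *\<^sub>R Dn (f m) x)"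
      unfolding g_def by (rule ext) (rule Dn_lincomb[OF fC fC])
    moreover have "nsq (\<lambda>x. Dn (f k) x - Dn (f m) x) = 2 * nsq (Dn (f k)) + 2 * nsq (Dn (f m)) - 4 * nsq (\<lambda>x. (1/2) *\<^sub>R Dn (f k) x + (1/2) *\<^sub>R Dn (f m) x)"
      by (intro nsq_parallelogram Dn_sqint fC)
    ultimately show ?thesis using f(2)[of k] f(2)[of m] \<epsilon>mono[OF km] by simp
  qed
  \<comment> \<open>The infima increase as the admissible sets shrink, and they are bounded by
    \<open>C\<close>; their convergence makes the differences \<open>d m - d k\<close>
    small.\<close>
  obtain l where l: "d \<longlonglongrightarrow> l"
    by (rule incseq_convergent[of d C]) (auto simp: incseq_def intro: dmono dC)
  have dl: "d k \<le> l" for k by (rule incseq_le[OF _ l]) (simp add: incseq_def dmono)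
  show ?thesis
  proof (intro exI[of _ f] conjI allI impI)
    show "f k \<in> Cc_infinity UNIV" for k by (rule fC)
    show "(\<lambda>k. nsq (\<lambda>x. f k x - u x)) \<longlonglongrightarrow> 0"
      by (rule tendsto_sandwich[OF _ _ tendsto_const \<epsilon>0]) (use f(1) in \<open>auto intro!: always_eventually nsq_nonneg simp: S_def\<close>)
    fix e :: real assume e: "e > 0"
    have "(\<lambda>k. 2 * (l - d k) + 4 * \<epsilon> k) \<longlonglongrightarrow> 2 * (l - l) + 4 * 0" by (intro tendsto_intros l \<epsilon>0)
    then have "eventually (\<lambda>k. 2 * (l - d k) + 4 * \<epsilon> k < e) sequentially"
      using e by (intro order_tendstoD(2)) simp_all
    then obtain N where N: "\<And>k. k \<ge> N \<Longrightarrow> 2 * (l - d k) + 4 * \<epsilon> k < e" by (auto simp: eventually_sequentially)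
    have 1: "nsq (\<lambda>x. Dn (f k) x - Dn (f m) x) < e" if "k \<ge> N" "k \<le> m" for k m
      using est[OF that(2)] N[OF that(1)] dl[of m] by simp
    have "nsq (\<lambda>x. Dn (f k) x - Dn (f m) x) < e" if "k \<ge> N" "m \<ge> N" for k m
    proof (cases "k \<le> m")
      case False
      then show ?thesis using 1[OF that(2), of k] by (simp add: nsq_def norm_minus_commute)
    qed (rule 1[OF that(1)])
    then show "\<exists>N. \<forall>k\<ge>N. \<forall>m\<ge>N. nsq (\<lambda>x. Dn (f k) x - Dn (f m) x) < e" by blast
  qed
qed

section \<open>Identification with the completion, stability under truncation\<close>

lemma sqint_L2_norm:
  fixes f :: "real^'n \<Rightarrow> 'c::euclidean_space"
  assumes [measurable]: "f \<in> borel_measurable borel"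
  shows "L2_norm f = sqrt (nsq f)"
  unfolding L2_norm_def nsq_def by (subst integral_completion) auto

lemma L2_iff_sqint:
  fixes f :: "real^'n \<Rightarrow> 'c::euclidean_space"
  assumes [measurable]: "f \<in> borel_measurable borel"
  shows "f \<in> L2 \<longleftrightarrow> sqint f"
  by (simp add: L2_def sqint_def integrable_completion measurable_completion)

text \<open>A Cauchy sequence has bounded gradients from some index on, which gives one direction;
  the other is \<open>approximable_Cauchy\<close>. In this form membership of the positive part can
  be checked.\<close>

theorem H_rho2_iff_approximable:
  assumes [measurable]: "u \<in> borel_measurable borel"
  shows "u \<in> H_rho2 r \<longleftrightarrow> approximable u"
proof
  assume "u \<in> H_rho2 r"
  then have u: "u \<in> L2" and "\<exists>f. (\<forall>k. f k \<in> Cc_infinity UNIV) \<and> (\<lambda>k. L2_norm (\<lambda>x. f k x - u x)) \<longlonglongrightarrow> 0 \<and>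
     (\<forall>e>0. \<exists>N::nat. \<forall>k\<ge>N. \<forall>m\<ge>N. L2_norm (\<lambda>x. nonlocal_gradient r (f k) x - nonlocal_gradient r (f m) x) < e)"
    by (simp_all add: H_rho2_def)
  from this(2) obtain f where f': "\<forall>k. f k \<in> Cc_infinity UNIV" and lim: "(\<lambda>k. L2_norm (\<lambda>x. f k x - u x)) \<longlonglongrightarrow> 0"
    and cau: "\<forall>e>0. \<exists>N::nat. \<forall>k\<ge>N. \<forall>m\<ge>N. L2_norm (\<lambda>x. nonlocal_gradient r (f k) x - nonlocal_gradient r (f m) x) < e"
    by blast
  note f = f'[rule_format]
  have [measurable]: "f k \<in> borel_measurable borel" for k using sqint_measurable[OF Cc_sqint[OF f]] .
  have su: "sqint u" using u by (simp add: L2_iff_sqint)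
  have lim': "(\<lambda>k. sqrt (nsq (\<lambda>x. f k x - u x))) \<longlonglongrightarrow> 0" using lim by (simp add: sqint_L2_norm)
  obtain N where N: "\<And>k m. k \<ge> N \<Longrightarrow> m \<ge> N \<Longrightarrow> L2_norm (\<lambda>x. Dn (f k) x - Dn (f m) x) < 1"
    using cau[rule_format, of 1] by (auto simp: nonlocal_gradient_eq_Dn)
  have N': "nsq (\<lambda>x. Dn (f k) x - Dn (f N) x) < 1" if "k \<ge> N" for k
    using N[OF that order_refl] by (simp add: sqint_L2_norm)
  have bd: "nsq (Dn (f k)) \<le> 2 + 2 * nsq (Dn (f N))" if "k \<ge> N" for k
  proof -
    have "nsq (\<lambda>x. (Dn (f k) x - Dn (f N) x) - (- Dn (f N) x)) \<le> 2 * nsq (\<lambda>x. Dn (f k) x - Dn (f N) x) + 2 * nsq (\<lambda>x. - Dn (f N) x)"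
      by (intro nsq_diff_le sqint_diff sqint_uminus Dn_sqint f)
    then show ?thesis using N'[OF that] by (simp add: nsq_def)
  qed
  have "\<exists>g\<in>Cc_infinity UNIV. nsq (\<lambda>x. g x - u x) \<le> \<delta> \<and> nsq (Dn g) \<le> 2 + 2 * nsq (Dn (f N))" if "\<delta> > 0" for \<delta>
  proof -
    have "eventually (\<lambda>k. sqrt (nsq (\<lambda>x. f k x - u x)) < sqrt \<delta>) sequentially"
      using that by (intro order_tendstoD(2)[OF lim']) simp
    then have "eventually (\<lambda>k. nsq (\<lambda>x. f k x - u x) < \<delta> \<and> k \<ge> N) sequentially"
      using eventually_ge_at_top[of N] by eventually_elim simp
    then obtain k where "nsq (\<lambda>x. f k x - u x) < \<delta>" "k \<ge> N" using eventually_happens by force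
    then show ?thesis using f[of k] bd[of k] by force
  qed
  then show "approximable u" using su unfolding approximable_def by blast
next
  assume a: "approximable u"
  obtain f where f': "\<forall>k. f k \<in> Cc_infinity UNIV" "(\<lambda>k. nsq (\<lambda>x. f k x - u x)) \<longlonglongrightarrow> 0"
    "\<forall>e>0. \<exists>N. \<forall>k\<ge>N. \<forall>m\<ge>N. nsq (\<lambda>x. Dn (f k) x - Dn (f m) x) < e"
    using approximable_Cauchy[OF a] by blast
  note f = f'(1)[rule_format] f'(2) f'(3)[rule_format]
  have [measurable]: "f k \<in> borel_measurable borel" for k using sqint_measurable[OF Cc_sqint[OF f(1)]] .
  show "u \<in> H_rho2 r" unfolding H_rho2_def
  proof (intro CollectI conjI exI[of _ f] allI impI)
    show "u \<in> L2" using a by (simp add: L2_iff_sqint approximable_def)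
    show "f k \<in> Cc_infinity UNIV" for k by (rule f)
    have "(\<lambda>k. sqrt (nsq (\<lambda>x. f k x - u x))) \<longlonglongrightarrow> sqrt 0" by (intro tendsto_intros f(2))
    then show "(\<lambda>k. L2_norm (\<lambda>x. f k x - u x)) \<longlonglongrightarrow> 0" by (simp add: sqint_L2_norm)
    fix e :: real assume e: "e > 0"
    have eq: "L2_norm (\<lambda>x. nonlocal_gradient r (f k) x - nonlocal_gradient r (f m) x) = sqrt (nsq (\<lambda>x. Dn (f k) x - Dn (f m) x))" for k m
      by (simp add: sqint_L2_norm nonlocal_gradient_eq_Dn)
    obtain N where N: "\<And>k m. k \<ge> N \<Longrightarrow> m \<ge> N \<Longrightarrow> nsq (\<lambda>x. Dn (f k) x - Dn (f m) x) < e\<^sup>2"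
      using f(3)[of "e\<^sup>2"] e by auto
    show "\<exists>N. \<forall>k\<ge>N. \<forall>m\<ge>N. L2_norm (\<lambda>x. nonlocal_gradient r (f k) x - nonlocal_gradient r (f m) x) < e"
      unfolding eq using N real_sqrt_less_mono e by (metis real_sqrt_abs abs_of_pos)
  qed
qed

text \<open>A mollification is an average of translates with the probability density
  \<open>\<eta>\<close>. The energy is translation invariant and, by Jensen's inequality for the
  square, convex along such averages.\<close>

lemma mollification_energy:
  assumes fc: "continuous_on UNIV f" and fs: "\<And>x. norm x > R \<Longrightarrow> f x = 0"
    and \<eta>: "\<eta> \<in> Cc_infinity UNIV" "\<And>x. \<eta> x \<ge> 0" "(LINT x|lborel. \<eta> x) = 1"
  shows "energy (conv f \<eta>) \<le> energy f"
proof -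
  note \<eta>i = Cc_integrable[OF \<eta>(1)]
  have [measurable]: "f \<in> borel_measurable borel" "\<eta> \<in> borel_measurable borel" "conv f \<eta> \<in> borel_measurable borel"
    using fc \<eta>i Cc_integrable[OF conv_Cc[OF fc fs \<eta>(1)]] by (auto intro: borel_measurable_continuous_onI)
  have conv': "conv f \<eta> x = (LINT y|lborel. \<eta> y * f (x - y))" for x
    unfolding conv_def using lborel_integral_shift(3)[of "\<lambda>y. \<eta> y * f (x - y)" x] by simp
  have jensen: "ennreal ((conv f \<eta> x - conv f \<eta> (x - h))\<^sup>2) \<le> (\<integral>\<^sup>+y. ennreal (\<eta> y) * ennreal ((f (x - y) - f (x - y - h))\<^sup>2) \<partial>lborel)" for x h
  proof -
    define G where "G y = f (x - y) - f (x - h - y)" for y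
    have Gc: "continuous_on UNIV G" unfolding G_def
      by (intro continuous_intros continuous_on_compose2[OF fc]) auto
    obtain S where S: "\<And>x. norm x > S \<Longrightarrow> \<eta> x = 0" using Cc_infinityD[OF \<eta>(1)] by blast
    have i: "integrable lborel (\<lambda>y. \<eta> y * f (z - y))" for z
      by (rule integrable_continuous_bounded_support[where R=S])
         (auto intro!: continuous_intros continuous_on_compose2[OF fc] Cc_continuous[OF \<eta>(1)] simp: S)
    have i1: "integrable lborel (\<lambda>y. \<eta> y * G y)"
      by (rule integrable_continuous_bounded_support[where R=S]) (auto intro!: continuous_intros Gc Cc_continuous[OF \<eta>(1)] simp: S)
    have i2: "integrable lborel (\<lambda>y. \<eta> y * (G y)\<^sup>2)"
      by (rule integrable_continuous_bounded_support[where R=S]) (auto intro!: continuous_intros Gc Cc_continuous[OF \<eta>(1)] simp: S)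
    define m where "m = (LINT y|lborel. \<eta> y * G y)"
    have m: "conv f \<eta> x - conv f \<eta> (x - h) = m"
      unfolding conv' m_def G_def right_diff_distrib using i[of x] i[of "x - h"] by simp
    \<comment> \<open>Jensen's inequality in the form that a variance is nonnegative, with
      \<open>m\<close> the mean of \<open>G\<close> under the density \<open>\<eta>\<close>.\<close>
    have "0 \<le> (LINT y|lborel. \<eta> y * (G y - m)\<^sup>2)" by (intro integral_nonneg_AE) (auto simp: \<eta>)
    also have "(\<lambda>y. \<eta> y * (G y - m)\<^sup>2) = (\<lambda>y. \<eta> y * (G y)\<^sup>2 - (2 * m) * (\<eta> y * G y) + m\<^sup>2 * \<eta> y)"
      by (auto simp: power2_eq_square algebra_simps)
    also have "(LINT y|lborel. \<dots> y) = (LINT y|lborel. \<eta> y * (G y)\<^sup>2) - (2 * m) * m + m\<^sup>2 * 1"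
      using i1 i2 \<eta>i by (simp add: m_def[symmetric] \<eta>(3))
    finally have "m\<^sup>2 \<le> (LINT y|lborel. \<eta> y * (G y)\<^sup>2)" by (simp add: power2_eq_square)
    then have "ennreal (m\<^sup>2) \<le> ennreal (LINT y|lborel. \<eta> y * (G y)\<^sup>2)" by (rule ennreal_leI)
    also have "\<dots> = (\<integral>\<^sup>+y. ennreal (\<eta> y * (G y)\<^sup>2) \<partial>lborel)"
      by (rule nn_integral_eq_integral[symmetric, OF i2]) (simp add: \<eta>)
    finally show ?thesis unfolding m by (simp add: G_def ennreal_mult \<eta> algebra_simps)
  qed
  show ?thesis unfolding energy_def
  proof (rule nn_integral_mono, rule mult_left_mono)
    fix h
    let ?I = "\<integral>\<^sup>+x. ennreal ((f x - f (x - h))\<^sup>2) \<partial>lborel"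
    have "(\<integral>\<^sup>+x. ennreal ((conv f \<eta> x - conv f \<eta> (x - h))\<^sup>2) \<partial>lborel) \<le> (\<integral>\<^sup>+x. (\<integral>\<^sup>+y. ennreal (\<eta> y) * ennreal ((f (x - y) - f (x - y - h))\<^sup>2) \<partial>lborel) \<partial>lborel)"
      by (rule nn_integral_mono) (rule jensen)
    also have "\<dots> = (\<integral>\<^sup>+y. (\<integral>\<^sup>+x. ennreal (\<eta> y) * ennreal ((f (x - y) - f (x - y - h))\<^sup>2) \<partial>lborel) \<partial>lborel)"
      by (rule lborel_pair.Fubini') measurable
    also have "\<dots> = (\<integral>\<^sup>+y. ennreal (\<eta> y) * ?I \<partial>lborel)"
    proof (rule nn_integral_cong)
      fix y
      have "(\<integral>\<^sup>+x. ennreal ((f (x - y) - f (x - y - h))\<^sup>2) \<partial>lborel) = ?I"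
        by (rule nn_integral_lborel_shift(2)[of "\<lambda>x. ennreal ((f x - f (x - h))\<^sup>2)"]) measurable
      then show "(\<integral>\<^sup>+x. ennreal (\<eta> y) * ennreal ((f (x - y) - f (x - y - h))\<^sup>2) \<partial>lborel) = ennreal (\<eta> y) * ?I"
        by (subst nn_integral_cmult) auto
    qed
    also have "\<dots> = (\<integral>\<^sup>+y. ennreal (\<eta> y) \<partial>lborel) * ?I" by (rule nn_integral_multc) measurable
    also have "(\<integral>\<^sup>+y. ennreal (\<eta> y) \<partial>lborel) = 1"
      by (subst nn_integral_eq_integral[OF \<eta>i]) (auto simp: \<eta>)
    finally show "(\<integral>\<^sup>+x. ennreal ((conv f \<eta> x - conv f \<eta> (x - h))\<^sup>2) \<partial>lborel) \<le> ?I" by simp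
  qed simp
qed

lemma mollification_approx:
  fixes f :: "real^'n \<Rightarrow> real"
  assumes lip: "\<And>x y. \<bar>f x - f y\<bar> \<le> M * norm (x - y)" and fs: "\<And>x. norm x > R \<Longrightarrow> f x = 0" and e: "e > 0"
  shows "\<exists>\<eta>\<in>Cc_infinity UNIV. (\<forall>x. \<eta> x \<ge> 0) \<and> (LINT x|lborel. \<eta> x) = 1 \<and> nsq (\<lambda>x. conv f \<eta> x - f x) \<le> e"
proof -
  have "0 \<le> M * norm (axis undefined 1 - 0 :: real^'n)" using lip[of "axis undefined 1" 0] abs_ge_zero order_trans by blast
  then have M0: "M \<ge> 0" by simp
  have fc: "continuous_on UNIV f"
    by (rule lipschitz_on_continuous_on[of M]) (use lip M0 in \<open>auto simp: lipschitz_on_def dist_norm\<close>)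
  define V where "V = measure lborel (cball (0::real^'n) (\<bar>R\<bar> + 2))"
  have V: "V \<ge> 0" by (simp add: V_def)
  \<comment> \<open>The scale is chosen so that \<open>(M * c)^2 * V \<le> e\<close>, where
    \<open>M * c\<close> bounds the pointwise error and \<open>V\<close> the measure of its support.
    Adding \<open>1\<close> to \<open>V\<close> and \<open>M\<close> avoids division by zero, and
    \<open>c \<le> 1\<close> keeps the support in the ball of radius
    \<open>\<bar>R\<bar> + 2\<close>.\<close>
  define c where "c = min 1 (sqrt (e / (V + 1)) / (M + 1))"
  have c: "c > 0" "c \<le> 1" using e V M0 by (auto simp: c_def)
  have cM: "(M * c)\<^sup>2 * V \<le> e"
  proof -
    have "c \<le> sqrt (e / (V + 1)) / (M + 1)" by (simp add: c_def)
    then have "(M + 1) * c \<le> sqrt (e / (V + 1))" using M0 by (simp add: field_simps)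
    moreover have "M * c \<le> (M + 1) * c" using c by simp
    ultimately have "M * c \<le> sqrt (e / (V + 1))" by linarith
    then have "(M * c)\<^sup>2 \<le> (sqrt (e / (V + 1)))\<^sup>2" using M0 c by (intro power_mono) auto
    also have "\<dots> = e / (V + 1)" using e V by simp
    finally have "(M * c)\<^sup>2 * V \<le> e / (V + 1) * V" using V by (intro mult_right_mono)
    also have "\<dots> \<le> e" using e V by (simp add: field_simps)
    finally show ?thesis .
  qed
  obtain \<eta> :: "real^'n \<Rightarrow> real" where \<eta>: "\<eta> \<in> Cc_infinity UNIV" "\<And>x. \<eta> x \<ge> 0" "\<And>x. norm x \<ge> c \<Longrightarrow> \<eta> x = 0" "(LINT x|lborel. \<eta> x) = 1"
    using mollifier_exists[OF c(1)] by blast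
  have \<eta>i: "integrable lborel (\<lambda>y. \<eta> (x - y))" for x
    using conv_integrable[where f="\<lambda>_. 1::real", OF _ \<eta>(1), of x] by simp
  have one: "(LINT y|lborel. \<eta> (x - y)) = 1" for x
    using \<eta>(4) lborel_integral_shift(3)[of \<eta> x] by simp
  have fi: "integrable lborel (\<lambda>y. \<eta> (x - y) * f y)" for x using conv_integrable[OF fc \<eta>(1), of x] by simp
  have pt: "\<bar>conv f \<eta> x - f x\<bar> \<le> M * c" for x
  proof -
    have "conv f \<eta> x - f x = (LINT y|lborel. \<eta> (x - y) * f y - f x * \<eta> (x - y))"
      using fi[of x] \<eta>i[of x] one[of x] by (simp add: conv_def)
    also have "\<bar>\<dots>\<bar> \<le> (LINT y|lborel. \<bar>\<eta> (x - y) * f y - f x * \<eta> (x - y)\<bar>)" by (rule integral_abs_bound)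
    also have "\<dots> \<le> (LINT y|lborel. (M * c) * \<eta> (x - y))"
    proof (rule integral_mono)
      show "integrable lborel (\<lambda>y. \<bar>\<eta> (x - y) * f y - f x * \<eta> (x - y)\<bar>)" using fi[of x] \<eta>i[of x] by simp
      show "integrable lborel (\<lambda>y. (M * c) * \<eta> (x - y))" using \<eta>i[of x] by simp
      fix y
      have "\<bar>\<eta> (x - y) * f y - f x * \<eta> (x - y)\<bar> = \<eta> (x - y) * \<bar>f y - f x\<bar>"
      proof -
        have "\<eta> (x - y) * f y - f x * \<eta> (x - y) = \<eta> (x - y) * (f y - f x)" by (simp add: algebra_simps)
        then show ?thesis using \<eta>(2)[of "x - y"] by (simp add: abs_mult)
      qed
      also have "\<dots> \<le> \<eta> (x - y) * (M * c)"
      proof (cases "norm (x - y) \<ge> c")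
        case False
        have "\<bar>f y - f x\<bar> \<le> M * norm (x - y)" using lip[of y x] by (simp add: norm_minus_commute)
        also have "\<dots> \<le> M * c" using False M0 by (intro mult_left_mono) auto
        finally show ?thesis by (intro mult_left_mono \<eta>)
      qed (simp add: \<eta>)
      finally show "\<bar>\<eta> (x - y) * f y - f x * \<eta> (x - y)\<bar> \<le> (M * c) * \<eta> (x - y)" by (simp add: mult.commute)
    qed
    also have "\<dots> = M * c" using one[of x] by simp
    finally show ?thesis .
  qed
  have supp: "conv f \<eta> x - f x = 0" if "norm x > \<bar>R\<bar> + 2" for x
    using conv_support[of "\<bar>R\<bar> + 1" f c \<eta> x] fs \<eta>(3) c that by simp
  have [measurable]: "f \<in> borel_measurable borel" "conv f \<eta> \<in> borel_measurable borel"
    using fc Cc_integrable[OF conv_Cc[OF fc fs \<eta>(1)]] by (auto intro: borel_measurable_continuous_onI)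
  have ic: "integrable lborel (\<lambda>x. (M * c)\<^sup>2 * indicat_real (cball (0::real^'n) (\<bar>R\<bar> + 2)) x)"
    using emeasure_lborel_cball_finite[of "0::real^'n" "\<bar>R\<bar> + 2"] by (intro integrable_mult_right) (simp add: integrable_indicator_iff)
  have le: "(norm (conv f \<eta> x - f x))\<^sup>2 \<le> (M * c)\<^sup>2 * indicat_real (cball 0 (\<bar>R\<bar> + 2)) x" for x
    using supp[of x] power_mono[OF pt[of x], of 2] by (auto simp: indicator_def)
  have "nsq (\<lambda>x. conv f \<eta> x - f x) \<le> (LINT x|lborel. (M * c)\<^sup>2 * indicat_real (cball (0::real^'n) (\<bar>R\<bar> + 2)) x)"
    unfolding nsq_def
  proof (rule integral_mono[OF _ ic le])
    show "integrable lborel (\<lambda>x. (norm (conv f \<eta> x - f x))\<^sup>2)"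
      by (rule Bochner_Integration.integrable_bound[OF ic]) (use le in \<open>auto intro!: AE_I2 order_trans[OF le]\<close>)
  qed
  also have "\<dots> = (M * c)\<^sup>2 * V" by (simp add: V_def)
  also note cM
  finally show ?thesis using \<eta>(1,2,4) by blast
qed

text \<open>The positive part of a test function is only Lipschitz, so it is mollified. Neither
  operation increases the energy, and the energy of the resulting test function is twice its squared
  gradient norm; hence the bound \<open>C\<close> is kept unchanged.\<close>

theorem approximable_pos_part:
  assumes "approximable u"
  shows "approximable (\<lambda>x. max 0 (u x))"
proof -
  obtain C where C: "\<And>\<delta>. \<delta> > 0 \<Longrightarrow> \<exists>f\<in>Cc_infinity UNIV. nsq (\<lambda>x. f x - u x) \<le> \<delta> \<and> nsq (Dn f) \<le> C"
    using assms unfolding approximable_def by blast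
  have u: "sqint u" using assms by (simp add: approximable_def)
  note [measurable] = sqint_measurable[OF u]
  have up: "sqint (\<lambda>x. max 0 (u x))" by (rule sqint_bound[OF _ u]) auto
  have lip: "\<bar>max 0 a - max 0 c\<bar> \<le> \<bar>a - c\<bar>" for a c :: real by (auto simp: max_def)
  have "\<exists>f\<in>Cc_infinity UNIV. nsq (\<lambda>x. f x - max 0 (u x)) \<le> \<delta> \<and> nsq (Dn f) \<le> C" if \<delta>: "\<delta> > 0" for \<delta>
  proof -
    \<comment> \<open>The quarter is used up by the two factors \<open>2\<close> in
      \<open>nsq_triangle\<close>: truncation and mollification each contribute
      \<open>\<delta> / 4\<close>.\<close>
    obtain f where f: "f \<in> Cc_infinity UNIV" "nsq (\<lambda>x. f x - u x) \<le> \<delta> / 4" "nsq (Dn f) \<le> C" using C[of "\<delta> / 4"] \<delta> by auto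
    define g where "g x = max 0 (f x)" for x
    have [measurable]: "f \<in> borel_measurable borel" using sqint_measurable[OF Cc_sqint[OF f(1)]] .
    have gc: "continuous_on UNIV g" unfolding g_def by (intro continuous_intros Cc_continuous[OF f(1)])
    obtain R where R: "\<And>x. norm x > R \<Longrightarrow> f x = 0" using Cc_infinityD[OF f(1)] by blast
    have gR: "g x = 0" if "norm x > R" for x using R[OF that] by (simp add: g_def)
    obtain M where M: "\<And>x y. norm (f x - f y) \<le> M * norm (x - y)" using Cc_lipschitz[OF f(1)] by metis
    have gM: "\<bar>g x - g y\<bar> \<le> M * norm (x - y)" for x y
      using lip[of "f x" "f y"] M[of x y] by (simp add: g_def)
    have gs: "sqint g" unfolding g_def by (rule sqint_bound[OF _ Cc_sqint[OF f(1)]]) auto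
    have "\<delta> / 4 > 0" using \<delta> by simp
    from mollification_approx[OF gM gR this] obtain \<eta> where \<eta>': "\<eta> \<in> Cc_infinity UNIV" "\<forall>x. \<eta> x \<ge> 0" "(LINT x|lborel. \<eta> x) = 1" "nsq (\<lambda>x. conv g \<eta> x - g x) \<le> \<delta> / 4"
      by blast
    note \<eta> = \<eta>'(1) \<eta>'(2)[rule_format] \<eta>'(3,4)
    have cC: "conv g \<eta> \<in> Cc_infinity UNIV" by (rule conv_Cc[OF gc gR \<eta>(1)])
    show ?thesis
    proof (intro bexI conjI)
      show "conv g \<eta> \<in> Cc_infinity UNIV" by (rule cC)
      have "nsq (\<lambda>x. g x - max 0 (u x)) \<le> nsq (\<lambda>x. f x - u x)"
        unfolding nsq_def
        by (intro integral_mono sqint_integrable sqint_diff gs up u Cc_sqint f(1) power_mono) (auto simp: g_def lip)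
      then show "nsq (\<lambda>x. conv g \<eta> x - max 0 (u x)) \<le> \<delta>"
        using nsq_triangle[OF Cc_sqint[OF cC] gs up] f(2) \<eta>(4) by simp
      have "ennreal (2 * nsq (Dn (conv g \<eta>))) \<le> energy g"
        unfolding energy_Cc_nsq[OF cC, symmetric] by (rule mollification_energy[OF gc gR \<eta>(1-3)])
      also have "\<dots> \<le> energy f" unfolding energy_def
      proof (intro nn_integral_mono mult_left_mono ennreal_leI)
        fix x h
        show "(g x - g (x - h))\<^sup>2 \<le> (f x - f (x - h))\<^sup>2"
          using lip[of "f x" "f (x - h)"] by (simp add: g_def abs_le_square_iff)
      qed simp
      also have "\<dots> = ennreal (2 * nsq (Dn f))" by (rule energy_Cc_nsq[OF f(1)])
      finally have "2 * nsq (Dn (conv g \<eta>)) \<le> 2 * nsq (Dn f)" by (simp add: ennreal_le_iff nsq_nonneg)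
      then show "nsq (Dn (conv g \<eta>)) \<le> C" using f(3) by simp
    qed
  qed
  then show ?thesis using up by (auto simp: approximable_def)
qed

text \<open>If \<open>K\<close> vanished, every test function would have zero gradient norm. For a
  small bump at the origin, however, the gradient at a point \<open>x\<close> outside its support
  has a strictly negative component along \<open>x\<close>: the integral only involves
  \<open>h\<close> near \<open>x\<close>, where \<open>b h\<close> points in the direction of
  \<open>h\<close> and the kernel is positive.\<close>

lemma K_not_AE_zero:
  assumes \<epsilon>: "\<epsilon> > 0" and pos: "AE h in lborel. norm h < \<epsilon> \<longrightarrow> r h > 0"
  shows "\<not> (AE h in lborel. K h = 0)"
proof
  assume K0: "AE h in lborel. K h = 0"
  obtain \<eta> :: "real^'n \<Rightarrow> real" where \<eta>: "\<eta> \<in> Cc_infinity UNIV" "\<And>x. \<eta> x \<ge> 0" "\<And>x. norm x \<ge> \<epsilon> / 8 \<Longrightarrow> \<eta> x = 0" "(LINT x|lborel. \<eta> x) = 1"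
    using mollifier_exists[of "\<epsilon> / 8"] \<epsilon> by auto
  have [measurable]: "\<eta> \<in> borel_measurable borel" using sqint_measurable[OF Cc_sqint[OF \<eta>(1)]] .
  have "energy \<eta> = (\<integral>\<^sup>+(h::real^'n). 0 \<partial>lborel)" unfolding energy_def
  proof (rule nn_integral_cong_AE)
    show "AE h in lborel. ennreal (K h) * (\<integral>\<^sup>+x. ennreal ((\<eta> x - \<eta> (x - h))\<^sup>2) \<partial>lborel) = 0"
      using K0 by eventually_elim simp
  qed
  then have "nsq (Dn \<eta>) = 0" using nsq_nonneg[of "Dn \<eta>"] by (simp add: energy_Cc_nsq[OF \<eta>(1)])
  then have D0: "AE x in lborel. Dn \<eta> x = 0"
    unfolding nsq_def using integral_nonneg_eq_0_iff_AE[OF sqint_integrable[OF Dn_sqint[OF \<eta>(1)]]] by simp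
  have nz: "Dn \<eta> x \<noteq> 0" if x: "\<epsilon> / 4 < norm x" "norm x < \<epsilon> / 2" for x
  proof
    assume Dx: "Dn \<eta> x = 0"
    have \<eta>x: "\<eta> x = 0" using \<eta>(3) x \<epsilon> by simp
    let ?F = "\<lambda>h. \<eta> (x - h) * (b h \<bullet> x)"
    have i: "integrable lborel (\<lambda>h. ((\<eta> x - \<eta> (x - h)) *\<^sub>R b h) \<bullet> x)"
      using integrable_bounded_linear[OF bounded_linear_inner_left Dn_integrable[OF \<eta>(1)]] .
    have "(LINT h|lborel. ((\<eta> x - \<eta> (x - h)) *\<^sub>R b h) \<bullet> x) = Dn \<eta> x \<bullet> x"
      unfolding Dn_def by (rule integral_bounded_linear[OF bounded_linear_inner_left Dn_integrable[OF \<eta>(1)]])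
    then have I0: "(LINT h|lborel. ?F h) = 0" using Dx \<eta>x by simp
    have Fi: "integrable lborel ?F" using i \<eta>x by simp
    \<comment> \<open>The bump has radius \<open>\<epsilon> / 8\<close>, less than
      \<open>norm x\<close>, so \<open>h\<close> makes an acute angle with \<open>x\<close>; and
      \<open>\<epsilon> / 2 + \<epsilon> / 8 < \<epsilon>\<close> keeps \<open>h\<close> in the
      region where the kernel is positive.\<close>
    have geo: "h \<bullet> x > 0 \<and> norm h < \<epsilon> \<and> h \<noteq> 0" if "norm (x - h) < \<epsilon> / 8" for h
    proof -
      have "(x - h) \<bullet> x \<le> norm (x - h) * norm x" using Cauchy_Schwarz_ineq2[of "x - h" x] by simp
      also have "\<dots> < norm x * norm x" using that x \<epsilon> by (intro mult_strict_right_mono) auto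
      finally have "h \<bullet> x > 0" by (simp add: inner_diff_left power2_norm_eq_inner[symmetric] power2_eq_square)
      moreover have "norm h < \<epsilon>" using norm_triangle_ineq4[of x "x - h"] that x \<epsilon> by simp
      ultimately show ?thesis by auto
    qed
    have Fnn: "?F h \<ge> 0" for h
    proof (cases "norm (x - h) < \<epsilon> / 8")
      case True
      then show ?thesis using geo[OF True] by (simp add: b_def \<eta>(2) r_nonneg)
    qed (simp add: \<eta>(3))
    have "AE h in lborel. ?F h = 0"
      using integral_nonneg_eq_0_iff_AE[OF Fi] Fnn I0 by simp
    then have "AE h in lborel. \<eta> (x - h) = 0"
      using pos
    proof eventually_elim
      case (elim h)
      show ?case
      proof (cases "norm (x - h) < \<epsilon> / 8")
        case True
        then show ?thesis using geo[OF True] elim by (auto simp: b_def)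
      qed (simp add: \<eta>(3))
    qed
    then have "(LINT h|lborel. \<eta> (x - h)) = 0" by (simp add: integral_eq_zero_AE)
    then show False using \<eta>(4) lborel_integral_shift(3)[of \<eta> x] by simp
  qed
  from D0 have "AE x in lborel. x \<in> - {x::real^'n. \<epsilon> / 4 < norm x \<and> norm x < \<epsilon> / 2}"
  proof (rule eventually_mono)
    fix x assume "Dn \<eta> x = 0"
    then show "x \<in> - {x::real^'n. \<epsilon> / 4 < norm x \<and> norm x < \<epsilon> / 2}" using nz[of x] by auto
  qed
  then have "AE x in lebesgue. x \<in> - {x::real^'n. \<epsilon> / 4 < norm x \<and> norm x < \<epsilon> / 2}" by (rule AE_completion)
  moreover have "open {x::real^'n. \<epsilon> / 4 < norm x \<and> norm x < \<epsilon> / 2}"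
    by (intro open_Collect_conj open_Collect_less continuous_intros)
  \<comment> \<open>The open annulus would be a null set, so its closed complement would be
    everything; the vector of norm \<open>3 * \<epsilon> / 8\<close>, halfway between the two radii,
    contradicts this.\<close>
  ultimately have "((3 * \<epsilon> / 8) *\<^sub>R axis undefined 1) \<in> - {x::real^'n. \<epsilon> / 4 < norm x \<and> norm x < \<epsilon> / 2}"
    by (intro mem_closed_if_AE_lebesgue) auto
  then show False using \<epsilon> by auto
qed

lemma energy_zero:
  assumes [measurable]: "u \<in> borel_measurable borel" and e: "energy u = 0" and "bounded \<Omega>"
    and out: "AE x in lborel. x \<notin> \<Omega> \<longrightarrow> u x = 0" and Kn: "\<not> (AE h in lborel. K h = 0)"
  shows "AE x in lborel. u x = 0"
proof -
  have "AE h in lborel. ennreal (K h) * (\<integral>\<^sup>+x. ennreal ((u x - u (x - h))\<^sup>2) \<partial>lborel) = 0"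
    using e unfolding energy_def by (subst (asm) nn_integral_0_iff_AE) auto
  moreover have "AE h in lborel. h \<noteq> (0::real^'n)" by (rule AE_lborel_singleton)
  ultimately have ae: "AE h in lborel. h \<noteq> 0 \<and> ennreal (K h) * (\<integral>\<^sup>+x. ennreal ((u x - u (x - h))\<^sup>2) \<partial>lborel) = 0"
    by eventually_elim simp
  \<comment> \<open>A single shift suffices: if all nonzero shifts had a positive increment
    integral, zero energy would force \<open>K = 0\<close> almost everywhere.\<close>
  have "\<exists>h. h \<noteq> 0 \<and> (\<integral>\<^sup>+x. ennreal ((u x - u (x - h))\<^sup>2) \<partial>lborel) = 0"
  proof (rule ccontr)
    assume "\<not> ?thesis"
    then have n: "(\<integral>\<^sup>+x. ennreal ((u x - u (x - h))\<^sup>2) \<partial>lborel) \<noteq> 0" if "h \<noteq> 0" for h using that by blast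
    from ae have "AE h in lborel. K h = 0"
    proof eventually_elim
      case (elim h)
      then have "ennreal (K h) = 0" using n[of h] by (simp only: mult_eq_0_iff) blast
      then show ?case using K_nonneg[of h] by (simp add: ennreal_eq_0_iff)
    qed
    then show False using Kn by simp
  qed
  then obtain h where h: "h \<noteq> 0" "(\<integral>\<^sup>+x. ennreal ((u x - u (x - h))\<^sup>2) \<partial>lborel) = 0" by blast
  have per: "AE x in lborel. u x = u (x - h)"
    using h(2) by (subst (asm) nn_integral_0_iff_AE) (auto elim!: eventually_mono)
  have perm: "AE x in lborel. u x = u (x - real m *\<^sub>R h)" for m
  proof (induction m)
    case (Suc m)
    have "AE x in lborel. u (x - real m *\<^sub>R h) = u (x - real m *\<^sub>R h - h)" by (rule AE_lborel_shift[OF per])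
    then show ?case using Suc by eventually_elim (simp add: algebra_simps)
  qed simp
  obtain B where B: "\<And>x. x \<in> \<Omega> \<Longrightarrow> norm x \<le> B" using \<open>bounded \<Omega>\<close> by (auto simp: bounded_iff)
  \<comment> \<open>A multiple of the period longer than \<open>2 * B\<close> moves every point of
    the bounded set out of it, to where the function is zero.\<close>
  obtain m :: nat where m: "2 * B + 1 < real m * norm h"
    using ex_less_of_nat_mult[of "norm h" "2 * B + 1"] h(1) by auto
  have "AE x in lborel. x - real m *\<^sub>R h \<notin> \<Omega> \<longrightarrow> u (x - real m *\<^sub>R h) = 0" by (rule AE_lborel_shift[OF out])
  then show ?thesis using out perm[of m]
  proof eventually_elim
    case (elim x)
    show ?case
    proof (cases "x \<in> \<Omega>")
      case True
      have "x - real m *\<^sub>R h \<notin> \<Omega>"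
      proof
        assume "x - real m *\<^sub>R h \<in> \<Omega>"
        then have "norm (x - real m *\<^sub>R h) \<le> B" by (rule B)
        moreover have "real m * norm h \<le> norm x + norm (x - real m *\<^sub>R h)"
          using norm_triangle_ineq4[of x "x - real m *\<^sub>R h"] by simp
        ultimately show False using m B[OF True] by simp
      qed
      then show ?thesis using elim by simp
    qed (use elim in simp)
  qed
qed

end

section \<open>The maximum principle\<close>

context even_kernel_K
begin

lemma energy_pair:
  assumes [measurable]: "u \<in> borel_measurable borel"
  shows "energy u = (\<integral>\<^sup>+p. ennreal ((u (fst p) - u (snd p))\<^sup>2 * K (fst p - snd p)) \<partial>(lborel \<Otimes>\<^sub>M lborel))"
proof -
  have "energy u = (\<integral>\<^sup>+x. (\<integral>\<^sup>+h. ennreal (K h * (u x - u (x - h))\<^sup>2) \<partial>lborel) \<partial>lborel)"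
    unfolding energy_alt[OF assms] by (rule lborel_pair.Fubini') measurable
  also have "\<dots> = (\<integral>\<^sup>+x. (\<integral>\<^sup>+y. ennreal ((u x - u y)\<^sup>2 * K (x - y)) \<partial>lborel) \<partial>lborel)"
  proof (rule nn_integral_cong)
    fix x
    show "(\<integral>\<^sup>+h. ennreal (K h * (u x - u (x - h))\<^sup>2) \<partial>lborel) = (\<integral>\<^sup>+y. ennreal ((u x - u y)\<^sup>2 * K (x - y)) \<partial>lborel)"
      using nn_integral_lborel_shift(3)[of "\<lambda>h. ennreal (K h * (u x - u (x - h))\<^sup>2)" x] by (simp add: mult.commute)
  qed
  also have "\<dots> = (\<integral>\<^sup>+p. ennreal ((u (fst p) - u (snd p))\<^sup>2 * K (fst p - snd p)) \<partial>(lborel \<Otimes>\<^sub>M lborel))"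
    by (subst lborel.nn_integral_fst[symmetric]) auto
  finally show ?thesis .
qed

definition form :: "(real^'n \<Rightarrow> real) \<Rightarrow> (real^'n \<Rightarrow> real) \<Rightarrow> (real^'n) \<times> (real^'n) \<Rightarrow> real" where
  "form u v p = (u (fst p) - u (snd p)) * (v (fst p) - v (snd p)) * K (fst p - snd p)"

lemma form_measurable[measurable]:
  assumes [measurable]: "u \<in> borel_measurable borel" "v \<in> borel_measurable borel"
  shows "form u v \<in> borel_measurable (borel \<Otimes>\<^sub>M borel)"
  unfolding form_def[abs_def] by measurable

text \<open>By \<open>\<bar>a * c\<bar> \<le> a * a + c * c\<close> the mixed integrand is dominated
  by the two diagonal ones. Integrability on the product space is what makes the iterated Bochner
  integrals in \<open>bilinear_form\<close> meaningful and additive.\<close>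

lemma form_integrable:
  assumes [measurable]: "u \<in> borel_measurable borel" "v \<in> borel_measurable borel"
    and fin: "energy u < \<infinity>" "energy v < \<infinity>"
  shows "integrable (lborel \<Otimes>\<^sub>M lborel) (form u v)"
proof -
  have sq: "integrable (lborel \<Otimes>\<^sub>M lborel) (form w w)" if [measurable]: "w \<in> borel_measurable borel" and "energy w < \<infinity>" for w
  proof (rule integrableI_bounded)
    show "form w w \<in> borel_measurable (lborel \<Otimes>\<^sub>M lborel)" by measurable
    show "(\<integral>\<^sup>+p. ennreal (norm (form w w p)) \<partial>(lborel \<Otimes>\<^sub>M lborel)) < \<infinity>"
      using that(2) unfolding energy_pair[OF that(1)] by (simp add: form_def power2_eq_square abs_mult K_nonneg)
  qed
  show ?thesis
  proof (rule Bochner_Integration.integrable_bound[where f="\<lambda>p. form u u p + form v v p"])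
    show "integrable (lborel \<Otimes>\<^sub>M lborel) (\<lambda>p. form u u p + form v v p)"
      by (intro Bochner_Integration.integrable_add sq fin) measurable
    show "form u v \<in> borel_measurable (lborel \<Otimes>\<^sub>M lborel)" by measurable
    have "norm (form u v p) \<le> norm (form u u p + form v v p)" for p
    proof -
      have "\<bar>a * c\<bar> \<le> a * a + c * c" for a c :: real
      proof -
        have "2 * (\<bar>a\<bar> * \<bar>c\<bar>) \<le> a * a + c * c"
          using sum_squares_bound[of "\<bar>a\<bar>" "\<bar>c\<bar>"] by (simp add: power2_eq_square mult.assoc)
        moreover have "0 \<le> \<bar>a\<bar> * \<bar>c\<bar>" by simp
        ultimately show ?thesis unfolding abs_mult by linarith
      qed
      from mult_right_mono[OF this K_nonneg[of "fst p - snd p"]]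
      show ?thesis by (simp add: form_def abs_mult K_nonneg distrib_right)
    qed
    then show "AE p in lborel \<Otimes>\<^sub>M lborel. norm (form u v p) \<le> norm (form u u p + form v v p)" by simp
  qed
qed

lemma bilinear_form_eq:
  assumes [measurable]: "u \<in> borel_measurable borel" "v \<in> borel_measurable borel"
    and fin: "energy u < \<infinity>" "energy v < \<infinity>"
  shows "bilinear_form K u v = (\<integral>p. form u v p \<partial>(lborel \<Otimes>\<^sub>M lborel))"
proof -
  have "bilinear_form K u v = (LINT x|lebesgue. (LINT y|lborel. (u x - u y) * (v x - v y) * K (x - y)))"
    unfolding bilinear_form_def by (subst integral_completion) auto
  also have "\<dots> = (LINT x|lborel. (LINT y|lborel. (u x - u y) * (v x - v y) * K (x - y)))"
    by (rule integral_completion) measurable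
  also have "\<dots> = (LINT x|lborel. (LINT y|lborel. form u v (x, y)))" by (simp add: form_def)
  also have "\<dots> = (\<integral>p. form u v p \<partial>(lborel \<Otimes>\<^sub>M lborel))"
    by (rule lborel_pair.integral_fst'[OF form_integrable[OF assms]])
  finally show ?thesis .
qed

theorem weak_maximum_principle:
  assumes u: "approximable u" "AE x in lborel. x \<notin> \<Omega> \<longrightarrow> u x = 0"
    and v: "approximable v" "AE x in lborel. x \<notin> \<Omega> \<longrightarrow> v x = 0"
    and "bounded \<Omega>" and Kn: "\<not> (AE h in lborel. K h = 0)"
    and test: "\<And>\<phi>. approximable \<phi> \<Longrightarrow> (\<And>x. \<phi> x \<ge> 0) \<Longrightarrow> (AE x in lborel. x \<notin> \<Omega> \<longrightarrow> \<phi> x = 0) \<Longrightarrow>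
      bilinear_form K v \<phi> \<le> bilinear_form K u \<phi>"
  shows "AE x in lborel. v x \<le> u x"
proof -
  have [measurable]: "u \<in> borel_measurable borel" "v \<in> borel_measurable borel"
    using u v by (auto simp: approximable_def sqint_def)
  define \<phi> where "\<phi> x = max 0 (v x - u x)" for x
  have \<phi>: "approximable \<phi>" unfolding \<phi>_def by (intro approximable_pos_part approximable_diff u v)
  then have [measurable]: "\<phi> \<in> borel_measurable borel" by (auto simp: approximable_def sqint_def)
  have \<phi>out: "AE x in lborel. x \<notin> \<Omega> \<longrightarrow> \<phi> x = 0"
    using u(2) v(2) by eventually_elim (simp add: \<phi>_def)
  note eu = approximable_energy[OF u(1)] and ev = approximable_energy[OF v(1)] and ep = approximable_energy[OF \<phi>]
  have iu: "integrable (lborel \<Otimes>\<^sub>M lborel) (form u \<phi>)" and iv: "integrable (lborel \<Otimes>\<^sub>M lborel) (form v \<phi>)"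
    and ip: "integrable (lborel \<Otimes>\<^sub>M lborel) (form \<phi> \<phi>)"
    by (intro form_integrable eu ev ep; measurable)+
  have test': "bilinear_form K v \<phi> \<le> bilinear_form K u \<phi>" by (rule test[OF \<phi> _ \<phi>out]) (simp add: \<phi>_def)
  have le: "(\<integral>p. form v \<phi> p \<partial>(lborel \<Otimes>\<^sub>M lborel)) \<le> (\<integral>p. form u \<phi> p \<partial>(lborel \<Otimes>\<^sub>M lborel))"
  proof -
    have "bilinear_form K u \<phi> = (\<integral>p. form u \<phi> p \<partial>(lborel \<Otimes>\<^sub>M lborel))"
      by (rule bilinear_form_eq[OF _ _ eu ep]) measurable
    moreover have "bilinear_form K v \<phi> = (\<integral>p. form v \<phi> p \<partial>(lborel \<Otimes>\<^sub>M lborel))"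
      by (rule bilinear_form_eq[OF _ _ ev ep]) measurable
    ultimately show ?thesis using test' by simp
  qed
  have "(\<integral>p. form \<phi> \<phi> p \<partial>(lborel \<Otimes>\<^sub>M lborel)) \<le> (\<integral>p. form v \<phi> p - form u \<phi> p \<partial>(lborel \<Otimes>\<^sub>M lborel))"
  proof (rule integral_mono[OF ip Bochner_Integration.integrable_diff[OF iv iu]])
    fix p :: "(real^'n) \<times> (real^'n)"
    \<comment> \<open>The positive part is increasing and does not enlarge differences, so
      \<open>max 0 a - max 0 c\<close> has the sign of \<open>a - c\<close> and at most its size.
      Multiplied by \<open>K \<ge> 0\<close>, this bounds the form of \<open>\<phi>\<close> by that
      of \<open>v - u\<close> against \<open>\<phi>\<close>.\<close>
    have "(max 0 a - max 0 c) * (max 0 a - max 0 c) \<le> (a - c) * (max 0 a - max 0 c)" for a c :: real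
    proof (cases "a \<le> c")
      case True
      then have "(c - a) * (max 0 c - max 0 a) \<ge> (max 0 c - max 0 a) * (max 0 c - max 0 a)"
        by (intro mult_right_mono) (auto simp: max_def)
      then show ?thesis by (simp add: algebra_simps)
    qed (intro mult_right_mono, auto simp: max_def)
    from mult_right_mono[OF this[of "v (fst p) - u (fst p)" "v (snd p) - u (snd p)"] K_nonneg[of "fst p - snd p"]]
    show "form \<phi> \<phi> p \<le> form v \<phi> p - form u \<phi> p" by (simp add: form_def \<phi>_def left_diff_distrib)
  qed
  also have "\<dots> \<le> 0" using iu iv le by simp
  finally have I0: "(\<integral>p. form \<phi> \<phi> p \<partial>(lborel \<Otimes>\<^sub>M lborel)) \<le> 0" .
  have "energy \<phi> = (\<integral>\<^sup>+p. ennreal (form \<phi> \<phi> p) \<partial>(lborel \<Otimes>\<^sub>M lborel))"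
    by (simp add: energy_pair form_def power2_eq_square)
  also have "\<dots> = ennreal (\<integral>p. form \<phi> \<phi> p \<partial>(lborel \<Otimes>\<^sub>M lborel))"
    by (rule nn_integral_eq_integral[OF ip]) (simp add: form_def K_nonneg)
  also have "\<dots> = 0" using I0 by (simp add: ennreal_neg)
  finally have "AE x in lborel. \<phi> x = 0"
    by (intro energy_zero[OF _ _ \<open>bounded \<Omega>\<close> \<phi>out Kn]) measurable
  then show ?thesis by eventually_elim (simp add: \<phi>_def max_def split: if_splits)
qed

end

section \<open>Null sets and Borel versions\<close>

lemma lebesgue_cong_AE:
  fixes f g :: "'a::euclidean_space \<Rightarrow> 'b::euclidean_space"
  assumes "AE x in lborel. f x = g x"
  shows "integral\<^sup>L lebesgue f = integral\<^sup>L lebesgue g" and "integrable lebesgue f \<longleftrightarrow> integrable lebesgue g"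
proof -
  have ae: "AE x in lebesgue. f x = g x" "AE x in lebesgue. g x = f x"
    using assms by (auto intro!: AE_completion simp: eq_commute)
  \<comment> \<open>The completed measure makes measurability itself invariant under changes on a
    null set. In the non-measurable case both integrals are therefore the default
    \<open>0\<close>.\<close>
  have m: "f \<in> borel_measurable lebesgue \<longleftrightarrow> g \<in> borel_measurable lebesgue"
    using borel_measurable_AE[OF _ ae(1)] borel_measurable_AE[OF _ ae(2)] by blast
  show i: "integrable lebesgue f \<longleftrightarrow> integrable lebesgue g"
  proof (cases "f \<in> borel_measurable lebesgue")
    case True then show ?thesis using integrable_cong_AE[OF _ _ ae(1)] m by blast
  next
    case False then show ?thesis using m borel_measurable_integrable by blast
  qed
  show "integral\<^sup>L lebesgue f = integral\<^sup>L lebesgue g"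
  proof (cases "f \<in> borel_measurable lebesgue")
    case True then show ?thesis using integral_cong_AE[OF _ _ ae(1)] m by blast
  next
    case False
    then have "\<not> integrable lebesgue f" using borel_measurable_integrable by blast
    then show ?thesis using i by (simp add: not_integrable_integral_eq)
  qed
qed

lemma lebesgue_borel_version:
  fixes f :: "'a::euclidean_space \<Rightarrow> real"
  assumes "f \<in> borel_measurable lebesgue"
  obtains g where "g \<in> borel_measurable borel" "AE x in lborel. g x = f x"
  using completion_ex_borel_measurable_real[OF assms] by (auto simp: eq_commute)

lemma AE_lborel_orthogonal:
  fixes T :: "'a::euclidean_space \<Rightarrow> 'a"
  assumes "orthogonal_transformation T" "AE x in lborel. P x"
  shows "AE x in lborel. P (T x)"
proof (rule AE_distrD[of T lborel borel P])
  show "T \<in> lborel \<rightarrow>\<^sub>M borel" using orthogonal_transformation_measurable[OF assms(1)] by simp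
  show "AE x in distr lborel borel T. P x" using assms by (simp only: orthogonal_distr_lborel)
qed

lemma AE_lborel_reflect:
  fixes x :: "'a::euclidean_space"
  assumes "AE h in lborel. P h"
  shows "AE y in lborel. P (x - y)"
proof -
  have "orthogonal_transformation (uminus :: 'a \<Rightarrow> 'a)"
    by (simp add: orthogonal_transformation_def linear_uminus)
  from AE_lborel_orthogonal[OF this, of "\<lambda>y. P y"] assms have "AE y in lborel. P (- y)" by simp
  from AE_lborel_shift[OF this, of x] show ?thesis by simp
qed

text \<open>Local integrability gives measurability on each compact subset; along an exhaustion by
  such sets the truncations converge pointwise. The indicator discards the values outside
  \<open>U\<close>, about which nothing is known.\<close>

lemma L1_loc_measurable:
  fixes f :: "real^'n::finite \<Rightarrow> real"
  assumes f: "f \<in> L1_loc U" and C: "\<And>n. compact (C n)" "\<And>n. C n \<subseteq> U"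
    and ex: "\<And>x. x \<in> U \<Longrightarrow> eventually (\<lambda>n. x \<in> C n) sequentially"
  shows "(\<lambda>x. indicator U x * f x) \<in> borel_measurable lebesgue"
proof (rule borel_measurable_LIMSEQ_real)
  fix x
  have "eventually (\<lambda>n. indicator (C n) x * f x = indicator U x * f x) sequentially"
  proof (cases "x \<in> U")
    case True
    from ex[OF this] show ?thesis by eventually_elim (simp add: True)
  next
    case False
    then have "x \<notin> C n" for n using C(2) by blast
    then show ?thesis using False by simp
  qed
  then show "(\<lambda>n. indicator (C n) x * f x) \<longlonglongrightarrow> indicator U x * f x" by (rule tendsto_eventually)
next
  fix n
  have "set_integrable lebesgue (C n) f" using f C by (auto simp: L1_loc_def)
  then show "(\<lambda>x. indicator (C n) x * f x) \<in> borel_measurable lebesgue"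
    unfolding set_integrable_def by (auto dest: borel_measurable_integrable)
qed

lemma nonlocal_gradient_cong_AE:
  assumes "AE h in lborel. \<rho> h = r h"
  shows "nonlocal_gradient \<rho> f = nonlocal_gradient r f"
proof
  fix x
  have "AE y in lborel. \<rho> (x - y) = r (x - y)" by (rule AE_lborel_reflect[OF assms])
  then show "nonlocal_gradient \<rho> f x = nonlocal_gradient r f x"
    unfolding nonlocal_gradient_def by (intro lebesgue_cong_AE(1)) (auto elim!: eventually_mono)
qed

lemma H_rho2_cong_AE:
  assumes \<rho>: "AE h in lborel. \<rho> h = r h" and uv: "AE x in lborel. u x = v x" and u: "u \<in> H_rho2 \<rho>"
  shows "v \<in> H_rho2 r"
proof -
  have L: "L2_norm (\<lambda>x. f x - u x) = L2_norm (\<lambda>x. f x - v x)" for f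
    unfolding L2_norm_def using uv by (subst lebesgue_cong_AE(1)) (auto elim!: eventually_mono)
  have "v \<in> L2"
  proof -
    have "u \<in> borel_measurable lebesgue" "integrable lebesgue (\<lambda>x. (norm (u x))\<^sup>2)"
      using u by (auto simp: H_rho2_def L2_def)
    moreover have "integrable lebesgue (\<lambda>x. (norm (u x))\<^sup>2) \<longleftrightarrow> integrable lebesgue (\<lambda>x. (norm (v x))\<^sup>2)"
      by (rule lebesgue_cong_AE(2)) (use uv in \<open>auto elim!: eventually_mono\<close>)
    ultimately show ?thesis using borel_measurable_AE[OF _ AE_completion[OF uv]] by (auto simp: L2_def)
  qed
  then show ?thesis using u unfolding H_rho2_def by (simp add: L nonlocal_gradient_cong_AE[OF \<rho>])
qed

lemma K_distribution_cong_AE: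
  assumes "AE h in lborel. \<rho> h = r h"
  shows "K_distribution \<rho> = K_distribution r"
proof -
  have "Q_hat \<rho> \<xi> = Q_hat r \<xi>" for \<xi>
  proof -
    have "(LINT x|lebesgue. \<rho> x * x $ i / (norm x)\<^sup>2 * sin (2 * pi * norm \<xi> * x $ i)) =
        (LINT x|lebesgue. r x * x $ i / (norm x)\<^sup>2 * sin (2 * pi * norm \<xi> * x $ i))" for i
      by (rule lebesgue_cong_AE(1)) (use assms in \<open>auto elim!: eventually_mono\<close>)
    then show ?thesis by (simp only: Q_hat_def Let_def)
  qed
  then show ?thesis by (simp add: K_distribution_def lambda_symbol_def)
qed

lemma Cc_infinity_of_real:
  fixes f :: "real^'n::finite \<Rightarrow> real"
  assumes "f \<in> Cc_infinity U"
  shows "(\<lambda>x. complex_of_real (f x)) \<in> Cc_infinity U"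
  using assms C_k_linear[OF bounded_linear_of_real] by (auto simp: Cc_infinity_def)

lemma bilinear_form_cong_AE:
  assumes "AE h in lborel. K h = K' h" "AE x in lborel. u x = u' x" "AE x in lborel. v x = v' x"
  shows "bilinear_form K u v = bilinear_form K' u' v'"
  unfolding bilinear_form_def
proof (rule lebesgue_cong_AE(1))
  show "AE x in lborel. (LINT y|lebesgue. (u x - u y) * (v x - v y) * K (x - y)) = (LINT y|lebesgue. (u' x - u' y) * (v' x - v' y) * K' (x - y))"
    using assms(2,3)
  proof eventually_elim
    case (elim x)
    show ?case
    proof (rule lebesgue_cong_AE(1))
      show "AE y in lborel. (u x - u y) * (v x - v y) * K (x - y) = (u' x - u' y) * (v' x - v' y) * K' (x - y)"
        using assms(2,3) AE_lborel_reflect[OF assms(1), of x] by eventually_elim (simp add: elim)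
    qed
  qed
qed

lemma radial_kernel_borel_version:
  fixes \<rho> :: "real^'n::finite \<Rightarrow> real"
  assumes rad: "radial_kernel \<rho>" and loc: "\<rho> \<in> L1_loc UNIV"
    and int: "integrable lebesgue (\<lambda>x. min 1 (inverse (norm x)) * \<rho> x)"
  obtains r where "even_kernel r" "AE h in lborel. \<rho> h = r h"
proof -
  have "(\<lambda>x. indicator UNIV x * \<rho> x) \<in> borel_measurable lebesgue"
  proof (rule L1_loc_measurable[OF loc, where C="\<lambda>n. cball 0 (real n)"])
    show "eventually (\<lambda>n. x \<in> cball 0 (real n)) sequentially" for x :: "real^'n"
      by (rule eventually_sequentiallyI[of "nat \<lceil>norm x\<rceil>"]) (auto simp: nat_ceiling_le_eq)
  qed auto
  then have "\<rho> \<in> borel_measurable lebesgue" by simp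
  then obtain q where [measurable]: "q \<in> borel_measurable borel" and q: "AE x in lborel. q x = \<rho> x"
    by (rule lebesgue_borel_version)
  \<comment> \<open>Taking positive parts and averaging over \<open>h\<close> and \<open>-h\<close>
    enforces sign and evenness at every point, and changes nothing almost everywhere because the
    kernel has both properties off the origin.\<close>
  define r where "r h = (max 0 (q h) + max 0 (q (- h))) / 2" for h
  have [measurable]: "r \<in> borel_measurable borel" unfolding r_def by measurable
  have z: "AE h in lborel. h \<noteq> (0::real^'n)" by (rule AE_lborel_singleton)
  have \<rho>rot: "\<rho> (T h) = \<rho> h" if "orthogonal_transformation T" "h \<noteq> 0" for T :: "real^'n \<Rightarrow> real^'n" and h
  proof -
    have n: "norm (T h) = norm h" by (rule orthogonal_transformation_norm[OF that(1)])
    then have "T h \<noteq> 0" using that(2) by auto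
    with n that(2) show ?thesis using rad by (metis radial_kernel_def)
  qed
  have om: "orthogonal_transformation (\<lambda>x::real^'n. - x)"
    by (simp add: orthogonal_transformation_def linear_uminus)
  have eq: "AE h in lborel. r h = \<rho> h"
    using q AE_lborel_orthogonal[OF om q] z
  proof eventually_elim
    case (elim h)
    moreover have "\<rho> h \<ge> 0" using rad elim by (simp add: radial_kernel_def)
    ultimately show ?case using \<rho>rot[OF om, of h] by (simp add: r_def)
  qed
  then have eq': "AE h in lborel. \<rho> h = r h" by (auto elim!: eventually_mono)
  have "even_kernel r"
  proof
    show "r \<in> borel_measurable borel" by measurable
    show "0 \<le> r h" "r (- h) = r h" for h by (simp_all add: r_def)
    show "AE h in lborel. r (T h) = r h" if T: "orthogonal_transformation T" for T :: "real^'n \<Rightarrow> real^'n"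
      using eq AE_lborel_orthogonal[OF T eq] z by eventually_elim (simp add: \<rho>rot[OF T])
    have "integrable lebesgue (\<lambda>x. min 1 (inverse (norm x)) * \<rho> x) \<longleftrightarrow> integrable lebesgue (\<lambda>x. min 1 (inverse (norm x)) * r x)"
      by (rule lebesgue_cong_AE(2)) (use eq in \<open>auto elim!: eventually_mono\<close>)
    then show "integrable lborel (\<lambda>h. min 1 (inverse (norm h)) * r h)"
      using int by (simp add: integrable_completion)
  qed
  with eq' show ?thesis by (rule that[rotated])
qed

lemma represented_borel_version:
  fixes K :: "real^'n::finite \<Rightarrow> real"
  assumes "even_kernel r" and rep: "represented_off_origin (K_distribution r) K" and nn: "\<And>x. x \<noteq> 0 \<Longrightarrow> K x \<ge> 0"
  obtains K' where "even_kernel_K r K'" "AE h in lborel. K h = K' h"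
proof -
  interpret even_kernel r by fact
  have loc: "K \<in> L1_loc (- {0})" using rep by (simp add: represented_off_origin_def)
  \<comment> \<open>The punctured space is exhausted by closed shells whose inner radii tend to
    \<open>0\<close> and outer radii to infinity.\<close>
  have "(\<lambda>x. indicator (- {0}) x * K x) \<in> borel_measurable lebesgue"
  proof (rule L1_loc_measurable[OF loc, where C="\<lambda>n. cball 0 (real n) - ball 0 (inverse (real (Suc n)))"])
    show "compact (cball 0 (real n) - ball 0 (inverse (real (Suc n))) :: (real^'n) set)" for n
      by (intro compact_diff) auto
    show "eventually (\<lambda>n. x \<in> cball 0 (real n) - ball 0 (inverse (real (Suc n)))) sequentially" if "x \<in> - {0}" for x :: "real^'n"
    proof -
      have "eventually (\<lambda>n. inverse (real (Suc n)) < norm x) sequentially"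
        using that by (intro order_tendstoD(2)[OF LIMSEQ_inverse_real_of_nat]) simp
      moreover have "eventually (\<lambda>n. norm x \<le> real n) sequentially"
        by (rule eventually_sequentiallyI[of "nat \<lceil>norm x\<rceil>"]) (auto simp: nat_ceiling_le_eq)
      ultimately show ?thesis by eventually_elim auto
    qed
  qed auto
  then obtain q where [measurable]: "q \<in> borel_measurable borel" and q: "AE x in lborel. q x = indicator (- {0}) x * K x"
    by (rule lebesgue_borel_version)
  define K' where "K' h = max 0 (q h)" for h
  have [measurable]: "K' \<in> borel_measurable borel" unfolding K'_def by measurable
  have z: "AE h in lborel. h \<noteq> (0::real^'n)" by (rule AE_lborel_singleton)
  have eq: "AE h in lborel. K h = K' h"
    using q z by eventually_elim (simp add: K'_def nn)
  have "even_kernel_K r K'"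
  proof (intro even_kernel_K.intro even_kernel_K_axioms.intro)
    show "even_kernel r" by fact
    show "K' \<in> borel_measurable borel" by measurable
    show "K' h \<ge> 0" for h by (simp add: K'_def)
    fix f :: "real^'n \<Rightarrow> real" assume f: "f \<in> Cc_infinity (- {0})"
    note fU = Cc_mono[OF f]
    have [measurable]: "f \<in> borel_measurable borel" using Cc_integrable[OF fU] by auto
    obtain B where B: "\<And>x. norm (f x) \<le> B" using Cc_bounded[OF fU] by blast
    \<comment> \<open>The closed support is compact and avoids \<open>0\<close>, so \<open>K\<close>
      is integrable on it; bounded test functions then pair absolutely with
      \<open>K\<close>.\<close>
    define S where "S = closure {x. f x \<noteq> 0}"
    have S: "compact S" "S \<subseteq> - {0}" using f by (auto simp: Cc_infinity_def S_def)
    have iS: "integrable lebesgue (\<lambda>x. indicator S x * K x)"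
      using loc S by (auto simp: L1_loc_def set_integrable_def)
    have "integrable lebesgue (\<lambda>x. (indicator S x * K x) * f x)"
    proof (rule Bochner_Integration.integrable_bound[where f="\<lambda>x. B * (indicator S x * K x)"])
      show "integrable lebesgue (\<lambda>x. B * (indicator S x * K x))" using iS by (rule integrable_mult_right)
      show "(\<lambda>x. (indicator S x * K x) * f x) \<in> borel_measurable lebesgue"
      proof (rule borel_measurable_times[OF borel_measurable_integrable[OF iS]])
        show "f \<in> borel_measurable lebesgue" by (rule measurable_completion) simp
      qed
      show "AE x in lebesgue. norm ((indicator S x * K x) * f x) \<le> norm (B * (indicator S x * K x))"
        using B by (intro AE_I2) (auto simp: abs_mult mult.commute[of B] intro!: mult_left_mono order_trans[OF _ abs_ge_self])
    qed
    also have "(\<lambda>x. (indicator S x * K x) * f x) = (\<lambda>x. K x * f x)"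
    proof
      fix x
      have "x \<in> S" if "f x \<noteq> 0" using that closure_subset by (force simp: S_def)
      then show "(indicator S x * K x) * f x = K x * f x" by (cases "f x = 0") auto
    qed
    finally have iK: "integrable lebesgue (\<lambda>x. K x * f x)" .
    have ae: "AE x in lborel. K x * f x = K' x * f x" using eq by eventually_elim simp
    show "integrable lborel (\<lambda>x. K' x * f x)"
      using iK lebesgue_cong_AE(2)[OF ae] by (simp add: integrable_completion)
    \<comment> \<open>The representation is assumed for complex test functions; it is used for real
      ones, where both sides are real.\<close>
    have "complex_of_real (L f) = regular_distribution K (\<lambda>x. complex_of_real (f x))"
      using rep Cc_infinity_of_real[OF f] by (simp add: represented_off_origin_def K_distribution_eq_L[OF fU, symmetric])
    also have "\<dots> = complex_of_real (LINT x|lebesgue. K x * f x)"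
      unfolding regular_distribution_def of_real_mult[symmetric] by (rule integral_complex_of_real)
    also have "(LINT x|lebesgue. K x * f x) = (LINT x|lebesgue. K' x * f x)" by (rule lebesgue_cong_AE(1)[OF ae])
    also have "\<dots> = (LINT x|lborel. K' x * f x)" by (rule integral_completion) measurable
    finally show "(LINT x|lborel. K' x * f x) = L f" by simp
  qed
  with eq show ?thesis by (rule that[rotated])
qed

text \<open>Kernel, representing function and the two given elements are replaced by Borel versions,
  which affects neither the space nor the form. Each test function of the maximum principle is
  carried back to the original data, where the hypothesis applies.\<close>

theorem corollary5p5:
  fixes \<rho> K :: "real ^ 'n::finite \<Rightarrow> real"
    and \<Omega> :: "(real ^ 'n) set"
    and u v :: "real ^ 'n \<Rightarrow> real"
  assumes "radial_kernel \<rho>"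
    and "\<rho> \<in> L1_loc UNIV"
    and "integrable lebesgue (\<lambda>x. min 1 (inverse (norm x)) * \<rho> x)"
    and "\<exists>\<epsilon>>0. (INF x \<in> cball 0 \<epsilon> - {0}. \<rho> x) > 0"
    and "represented_off_origin (K_distribution \<rho>) K"
    and "\<forall>x. x \<noteq> 0 \<longrightarrow> K x \<ge> 0"
    and "open \<Omega>" and "bounded \<Omega>"
    and "u \<in> H0_rho2 \<rho> \<Omega>" and "v \<in> H0_rho2 \<rho> \<Omega>"
    and "\<forall>\<phi> \<in> H0_rho2 \<rho> \<Omega>. (AE x in lebesgue. \<phi> x \<ge> 0) \<longrightarrow>
           bilinear_form K u \<phi> \<ge> bilinear_form K v \<phi>"
    and "AE x in lebesgue. x \<notin> \<Omega> \<longrightarrow> u x \<ge> v x"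
  shows "AE x in lebesgue. u x \<ge> v x"
proof -
  obtain r where r: "even_kernel r" "AE h in lborel. \<rho> h = r h"
    using radial_kernel_borel_version[OF assms(1-3)] by blast
  have rep: "represented_off_origin (K_distribution r) K"
    using assms(5) by (simp only: K_distribution_cong_AE[OF r(2)])
  obtain K' where K': "even_kernel_K r K'" "AE h in lborel. K h = K' h"
    using represented_borel_version[OF r(1) rep] assms(6) by blast
  interpret even_kernel_K r K' by (rule K'(1))
  have version: "\<exists>w'. approximable w' \<and> (AE x in lborel. w x = w' x) \<and> (AE x in lborel. x \<notin> \<Omega> \<longrightarrow> w' x = 0)"
    if w: "w \<in> H0_rho2 \<rho> \<Omega>" for w
  proof -
    have wH: "w \<in> H_rho2 \<rho>" and out: "AE x in lborel. x \<notin> \<Omega> \<longrightarrow> w x = 0"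
      using w by (auto simp: H0_rho2_def AE_completion_iff)
    then have "w \<in> borel_measurable lebesgue" by (simp add: H_rho2_def L2_def)
    then obtain w' where m: "w' \<in> borel_measurable borel" and w': "AE x in lborel. w' x = w x"
      by (rule lebesgue_borel_version)
    have ww': "AE x in lborel. w x = w' x" using w' by (auto elim!: eventually_mono)
    have "approximable w'" using H_rho2_cong_AE[OF r(2) ww' wH] H_rho2_iff_approximable[OF m] by simp
    moreover have "AE x in lborel. x \<notin> \<Omega> \<longrightarrow> w' x = 0" using w' out by eventually_elim simp
    ultimately show ?thesis using ww' by blast
  qed
  obtain u' where u': "approximable u'" "AE x in lborel. u x = u' x" "AE x in lborel. x \<notin> \<Omega> \<longrightarrow> u' x = 0"
    using version[OF assms(9)] by blast
  obtain v' where v': "approximable v'" "AE x in lborel. v x = v' x" "AE x in lborel. x \<notin> \<Omega> \<longrightarrow> v' x = 0"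
    using version[OF assms(10)] by blast
  obtain \<epsilon> where \<epsilon>: "\<epsilon> > 0" "(INF x \<in> cball 0 \<epsilon> - {0}. \<rho> x) > 0" using assms(4) by blast
  \<comment> \<open>Nonnegativity of the kernel bounds the set of values from below, so the infimum
    is a genuine lower bound and its positivity is inherited pointwise.\<close>
  have pos: "\<rho> h > 0" if "h \<noteq> 0" "norm h < \<epsilon>" for h
  proof -
    have "bdd_below (\<rho> ` (cball 0 \<epsilon> - {0}))"
      using assms(1) by (intro bdd_belowI[where m=0]) (auto simp: radial_kernel_def)
    then have "(INF x \<in> cball 0 \<epsilon> - {0}. \<rho> x) \<le> \<rho> h" by (rule cINF_lower) (use that in auto)
    then show ?thesis using \<epsilon>(2) by linarith
  qed
  have "AE h in lborel. h \<noteq> (0::real^'n)" by (rule AE_lborel_singleton)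
  with r(2) have "AE h in lborel. norm h < \<epsilon> \<longrightarrow> r h > 0"
    by eventually_elim (use pos in metis)
  then have Kn: "\<not> (AE h in lborel. K' h = 0)" by (rule K_not_AE_zero[OF \<epsilon>(1)])
  have "AE x in lborel. v' x \<le> u' x"
  proof (rule weak_maximum_principle[OF u'(1,3) v'(1,3) assms(8) Kn])
    fix \<phi> assume \<phi>: "approximable \<phi>" "\<And>x. \<phi> x \<ge> 0" "AE x in lborel. x \<notin> \<Omega> \<longrightarrow> \<phi> x = 0"
    have m: "\<phi> \<in> borel_measurable borel" using \<phi>(1) by (simp add: approximable_def sqint_def)
    have "AE h in lborel. r h = \<rho> h" using r(2) by (auto elim!: eventually_mono)
    moreover have "\<phi> \<in> H_rho2 r" using \<phi>(1) H_rho2_iff_approximable[OF m] by simp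
    ultimately have "\<phi> \<in> H_rho2 \<rho>" using H_rho2_cong_AE[of r \<rho> \<phi> \<phi>] by simp
    then have "\<phi> \<in> H0_rho2 \<rho> \<Omega>" using \<phi>(3) by (simp add: H0_rho2_def AE_completion_iff)
    then have "bilinear_form K v \<phi> \<le> bilinear_form K u \<phi>" using assms(11) \<phi>(2) by simp
    then show "bilinear_form K' v' \<phi> \<le> bilinear_form K' u' \<phi>"
      using bilinear_form_cong_AE[OF K'(2) u'(2), of \<phi> \<phi>] bilinear_form_cong_AE[OF K'(2) v'(2), of \<phi> \<phi>] by simp
  qed
  then have "AE x in lborel. u x \<ge> v x" using u'(2) v'(2) by eventually_elim simp
  then show ?thesis by (rule AE_completion)
qed

end
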